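(* Let $\tau$ be in the limit circle case at both $a$ and $b$, with boundary condition bases $\{\phi_a,\psi_a\}$ at $a$ and $\{\phi_b,\psi_b\}$ at $b$, and let $T_{0,0}$, $T_{R,\eta}$ and $u_{z,1},u_{z,2}$ be as in the context. Let $\eta\in[0,\pi)$ and $R\in \mathrm{SL}_2(\mathbb R)$. If $R_{1,2}\neq0$, then $T_{0,0}$ and $T_{R,\eta}$ are relatively prime with respect to $T_{\min}$. Moreover, for each $z\in\rho(T_{0,0})\cap\rho(T_{R,\eta})$ the matrix $$K_{R,\eta}(z)=\begin{pmatrix}\dfrac{R_{2,2}}{R_{1,2}}-[u_{z,1},\psi_b](b) & -\dfrac{e^{-i\eta}}{R_{1,2}}+[u_{z,1},\psi_a](a)\\[3mm] -\dfrac{e^{i\eta}}{R_{1,2}}-[u_{z,2},\psi_b](b) & \dfrac{R_{1,1}}{R_{1,2}}+[u_{z,2},\psi_a](a)\end{pmatrix}$$ is invertible and $$(T_{R,\eta}-zI)^{-1}=(T_{0,0}-zI)^{-1}+\sum_{j,k=1}^2\big[K_{R,\eta}(z)^{-1}\big]_{j,k}\,\langle u_{\overline z,j},\,\cdot\,\rangle\,u_{z,k}.$$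
   Context: Setting. Let $-\infty\le a<b\le\infty$ and let $p,q,r$ be real-valued Lebesgue measurable functions on $(a,b)$ with $p>0$, $r>0$ a.e. and $p^{-1},q,r\in L^1_{\mathrm{loc}}((a,b);dx)$. Let $\mathfrak D(a,b)$ be the set of $f\in AC_{\mathrm{loc}}(a,b)$ (complex-valued) with $pf'\in AC_{\mathrm{loc}}(a,b)$, and $\tau f=\frac1r[-(pf')'+qf]$ for $f\in\mathfrak D(a,b)$. The Lagrange bracket is $[f,g](x)=f(x)\overline{(pg')(x)}-(pf')(x)\overline{g(x)}$ for $f,g\in\mathfrak D(a,b)$. $I$ and $\langle\cdot,\cdot\rangle$ (linear in the second argument) are the identity and inner product of $L^2((a,b);r(x)\,dx)$. $\mathrm{SL}_2(\mathbb R)$ is the set of real $2\times2$ matrices with determinant $1$. The maximal operator is $T_{\max}f=\tau f$ with $\operatorname{dom}(T_{\max})=\{g\in\mathfrak D(a,b): g,\tau g\in L^2((a,b);r\,dx)\}$; it is densely defined, and the minimal operator is $T_{\min}:=(T_{\max})^*$, which is closed, symmetric, densely defined, with $(T_{\min})^*=T_{\max}$. For $f,g\in\operatorname{dom}(T_{\max})$ the limits $[f,g](a)=\lim_{x\downarrow a}[f,g](x)$ and $[f,g](b)=\lim_{x\uparrow b}[f,g](x)$ exist and are finite. $\tau$ is in the limit circle case at an endpoint if for each $z\in\mathbb C$ all solutions $y\in\mathfrak D(a,b)$ of $\tau y=zy$ are square integrable w.r.t. $r\,dx$ near that endpoint. A boundary condition basis at $c\in\{a,b\}$ is a pair of real-valued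 functions $\phi,\psi\in\operatorname{dom}(T_{\max})$ with $[\psi,\phi](c)=1$. $T_{0,0}$ is the restriction of $T_{\max}$ to $\{g\in\operatorname{dom}(T_{\max}): [g,\phi_a](a)=[g,\phi_b](b)=0\}$. For $\eta\in[0,\pi)$ and $R\in\mathrm{SL}_2(\mathbb R)$, $T_{R,\eta}$ is the restriction of $T_{\max}$ to the set of $g\in\operatorname{dom}(T_{\max})$ with $$\begin{pmatrix}[g,\phi_b](b)\\ [g,\psi_b](b)\end{pmatrix}=e^{i\eta}R\begin{pmatrix}[g,\phi_a](a)\\ [g,\psi_a](a)\end{pmatrix}.$$ Both are known to be self-adjoint extensions of $T_{\min}$. For $z\in\rho(T_{0,0})$, $u_{z,1},u_{z,2}$ are the solutions of $\tau u=zu$ satisfying $$[u_{z,1},\phi_a](a)=0,\ [u_{z,1},\phi_b](b)=1,\qquad [u_{z,2},\phi_a](a)=1,\ [u_{z,2},\phi_b](b)=0.$$ For self-adjoint extensions $T,T'$ of a symmetric operator $S$, the maximal common part $C_{T,T'}$ is the restriction of $T$ to $\{f\in\operatorname{dom}(T)\cap\operatorname{dom}(T'): Tf=T'f\}$; $T$ and $T'$ are relatively prime with respect to $S$ if $C_{T,T'}=S$. *)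

theory Defs
  imports "HOL-Analysis.Analysis"
begin

text \<open>
  Elements of the Hilbert space L2(M) are represented by square integrable functions, and functions
  that agree M-almost everywhere represent the same element.  A linear operator is represented by
  its graph on representatives, that is, the set of all pairs (f, h) for which the class of f lies
  in the domain and the class of h is its image.  All operators below are closed under changing
  both components on M-null sets, so that equality of these relations is equality of the operators
  (including their domains).
\<close>

type_synonym l2op = "((real \<Rightarrow> complex) \<times> (real \<Rightarrow> complex)) set"

definition L2 :: "real measure \<Rightarrow> (real \<Rightarrow> complex) set" where
  "L2 M = {f \<in> borel_measurable M. integrable M (\<lambda>x. (cmod (f x))\<^sup>2)}"

definition l2_inner :: "real measure \<Rightarrow> (real \<Rightarrow> complex) \<Rightarrow> (real \<Rightarrow> complex) \<Rightarrow> complex" where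
  "l2_inner M f g = (\<integral>x. cnj (f x) * g x \<partial>M)"

definition l2_norm :: "real measure \<Rightarrow> (real \<Rightarrow> complex) \<Rightarrow> real" where
  "l2_norm M f = sqrt (\<integral>x. (cmod (f x))\<^sup>2 \<partial>M)"

definition op_adjoint :: "real measure \<Rightarrow> l2op \<Rightarrow> l2op" where
  "op_adjoint M T = {(g, h). g \<in> L2 M \<and> h \<in> L2 M \<and>
     (\<forall>(f, k) \<in> T. l2_inner M g k = l2_inner M h f)}"

text \<open>F acts on representatives and is to respect equality almost everywhere.\<close>

definition op_of :: "real measure \<Rightarrow> ((real \<Rightarrow> complex) \<Rightarrow> (real \<Rightarrow> complex)) \<Rightarrow> l2op" where
  "op_of M F = {(f, g). f \<in> L2 M \<and> g \<in> L2 M \<and> (AE x in M. g x = F f x)}"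

definition op_add :: "real measure \<Rightarrow> l2op \<Rightarrow> l2op \<Rightarrow> l2op" where
  "op_add M S T = {(f, g). g \<in> L2 M \<and>
     (\<exists>g1 g2. (f, g1) \<in> S \<and> (f, g2) \<in> T \<and> (AE x in M. g x = g1 x + g2 x))}"

definition op_shift :: "real measure \<Rightarrow> l2op \<Rightarrow> complex \<Rightarrow> l2op" where
  "op_shift M T z = {(f, k). k \<in> L2 M \<and>
     (\<exists>h. (f, h) \<in> T \<and> (AE x in M. k x = h x - z * f x))}"

definition op_resolvent :: "real measure \<Rightarrow> l2op \<Rightarrow> complex \<Rightarrow> l2op" where
  "op_resolvent M T z = (op_shift M T z)\<inverse>"

text \<open>
  The norm bound forces f to vanish almost everywhere whenever k does, so it also expresses the
  injectivity of T - z I.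
\<close>

definition resolvent_set :: "real measure \<Rightarrow> l2op \<Rightarrow> complex set" where
  "resolvent_set M T = {z. Domain (op_resolvent M T z) = L2 M \<and>
     (\<exists>C. \<forall>(k, f) \<in> op_resolvent M T z. l2_norm M f \<le> C * l2_norm M k)}"

definition maximal_common_part :: "real measure \<Rightarrow> l2op \<Rightarrow> l2op \<Rightarrow> l2op" where
  "maximal_common_part M T T' =
     {(f, h). (f, h) \<in> T \<and> (\<exists>h'. (f, h') \<in> T' \<and> (AE x in M. h x = h' x))}"

text \<open>To be used for self-adjoint extensions T, T' of the symmetric operator S.\<close>

definition relatively_prime :: "real measure \<Rightarrow> l2op \<Rightarrow> l2op \<Rightarrow> l2op \<Rightarrow> bool" where
  "relatively_prime M S T T' \<longleftrightarrow> maximal_common_part M T T' = S"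

definition abs_cont_on :: "real \<Rightarrow> real \<Rightarrow> (real \<Rightarrow> complex) \<Rightarrow> bool" where
  "abs_cont_on c d f \<longleftrightarrow>
     (\<forall>\<epsilon>>0. \<exists>\<delta>>0. \<forall>D :: (real \<times> real) set.
        finite D \<and> (\<forall>(s, t) \<in> D. c \<le> s \<and> s \<le> t \<and> t \<le> d) \<and>
        disjoint_family_on (\<lambda>(s, t). {s<..<t}) D \<and> (\<Sum>(s, t)\<in>D. t - s) < \<delta>
        \<longrightarrow> (\<Sum>(s, t)\<in>D. cmod (f t - f s)) < \<epsilon>)"

definition AC_loc :: "ereal \<Rightarrow> ereal \<Rightarrow> (real \<Rightarrow> complex) set" where
  "AC_loc a b = {f. \<forall>c d. c \<le> d \<and> {c..d} \<subseteq> einterval a b \<longrightarrow> abs_cont_on c d f}"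

text \<open>
  Functions on (a, b) are functions on the whole real line whose values outside (a, b) play no role.
\<close>

definition sl_coefficients ::
  "ereal \<Rightarrow> ereal \<Rightarrow> (real \<Rightarrow> real) \<Rightarrow> (real \<Rightarrow> real) \<Rightarrow> (real \<Rightarrow> real) \<Rightarrow> bool" where
  "sl_coefficients a b p q r \<longleftrightarrow>
     p \<in> borel_measurable (lebesgue_on (einterval a b)) \<and>
     q \<in> borel_measurable (lebesgue_on (einterval a b)) \<and>
     r \<in> borel_measurable (lebesgue_on (einterval a b)) \<and>
     (AE x in lebesgue_on (einterval a b). p x > 0) \<and>
     (AE x in lebesgue_on (einterval a b). r x > 0) \<and>
     (\<forall>c d. {c..d} \<subseteq> einterval a b \<longrightarrow>
        (\<lambda>x. 1 / p x) absolutely_integrable_on {c..d} \<and>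
        q absolutely_integrable_on {c..d} \<and>
        r absolutely_integrable_on {c..d})"

definition sl_measure :: "ereal \<Rightarrow> ereal \<Rightarrow> (real \<Rightarrow> real) \<Rightarrow> real measure" where
  "sl_measure a b r = density (lebesgue_on (einterval a b)) (\<lambda>x. ennreal (r x))"

context
  fixes a b :: ereal and p q r :: "real \<Rightarrow> real"
begin

text \<open>
  The derivative of an absolutely continuous f, and hence p f', is only defined almost everywhere;
  ``p f' belongs to AC_loc'' means that it has a representative in AC_loc.  By continuity this
  representative, the quasi-derivative, is unique on (a, b).
\<close>

definition is_quasi_deriv :: "(real \<Rightarrow> complex) \<Rightarrow> (real \<Rightarrow> complex) \<Rightarrow> bool" where
  "is_quasi_deriv f g \<longleftrightarrow> g \<in> AC_loc a b \<and>
     (AE x in lebesgue_on (einterval a b). g x = of_real (p x) * vector_derivative f (at x))"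

definition quasi_deriv :: "(real \<Rightarrow> complex) \<Rightarrow> real \<Rightarrow> complex" where
  "quasi_deriv f = (SOME g. is_quasi_deriv f g)"

definition sl_domain :: "(real \<Rightarrow> complex) set" where
  "sl_domain = {f \<in> AC_loc a b. \<exists>g. is_quasi_deriv f g}"

definition sl_tau :: "(real \<Rightarrow> complex) \<Rightarrow> real \<Rightarrow> complex" where
  "sl_tau f x = (- vector_derivative (quasi_deriv f) (at x) + of_real (q x) * f x) / of_real (r x)"

definition bracket :: "(real \<Rightarrow> complex) \<Rightarrow> (real \<Rightarrow> complex) \<Rightarrow> real \<Rightarrow> complex" where
  "bracket f g x = f x * cnj (quasi_deriv g x) - quasi_deriv f x * cnj (g x)"

text \<open>
  The filter is \<^term>\<open>at_right a\<close> for the value at a and \<^term>\<open>at_left b\<close> for the value at b, on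
  the extended reals.  The limits exist for f and g in the maximal domain (\<open>dom_max\<close> below), the
  only case in which they are used.
\<close>

definition bracket_lim ::
  "ereal filter \<Rightarrow> (real \<Rightarrow> complex) \<Rightarrow> (real \<Rightarrow> complex) \<Rightarrow> complex" where
  "bracket_lim F f g = Lim F (\<lambda>x. bracket f g (real_of_ereal x))"

abbreviation bracket_a :: "(real \<Rightarrow> complex) \<Rightarrow> (real \<Rightarrow> complex) \<Rightarrow> complex" where
  "bracket_a \<equiv> bracket_lim (at_right a)"

abbreviation bracket_b :: "(real \<Rightarrow> complex) \<Rightarrow> (real \<Rightarrow> complex) \<Rightarrow> complex" where
  "bracket_b \<equiv> bracket_lim (at_left b)"

definition sl_solution :: "complex \<Rightarrow> (real \<Rightarrow> complex) \<Rightarrow> bool" where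
  "sl_solution z y \<longleftrightarrow> y \<in> sl_domain \<and>
     (AE x in lebesgue_on (einterval a b). sl_tau y x = z * y x)"

definition limit_circle_a :: bool where
  "limit_circle_a \<longleftrightarrow> (\<forall>z y. sl_solution z y \<longrightarrow>
     (\<exists>c \<in> einterval a b. set_integrable (sl_measure a b r) {..<c} (\<lambda>x. (cmod (y x))\<^sup>2)))"

definition limit_circle_b :: bool where
  "limit_circle_b \<longleftrightarrow> (\<forall>z y. sl_solution z y \<longrightarrow>
     (\<exists>c \<in> einterval a b. set_integrable (sl_measure a b r) {c<..} (\<lambda>x. (cmod (y x))\<^sup>2)))"

text \<open>The locally absolutely continuous representatives of the elements of the maximal domain.\<close>

definition dom_max :: "(real \<Rightarrow> complex) set" where
  "dom_max = {g \<in> sl_domain. g \<in> L2 (sl_measure a b r) \<and> sl_tau g \<in> L2 (sl_measure a b r)}"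

definition sl_operator :: "(real \<Rightarrow> complex) set \<Rightarrow> l2op" where
  "sl_operator S = {(f, h). f \<in> L2 (sl_measure a b r) \<and> h \<in> L2 (sl_measure a b r) \<and>
     (\<exists>g \<in> S. (AE x in sl_measure a b r. f x = g x) \<and>
              (AE x in sl_measure a b r. h x = sl_tau g x))}"

definition T_max :: l2op where
  "T_max = sl_operator dom_max"

definition T_min :: l2op where
  "T_min = op_adjoint (sl_measure a b r) T_max"

definition bc_basis :: "ereal filter \<Rightarrow> (real \<Rightarrow> complex) \<Rightarrow> (real \<Rightarrow> complex) \<Rightarrow> bool" where
  "bc_basis F \<phi> \<psi> \<longleftrightarrow> \<phi> \<in> dom_max \<and> \<psi> \<in> dom_max \<and>
     (\<forall>x \<in> einterval a b. \<phi> x \<in> \<real> \<and> \<psi> x \<in> \<real>) \<and> bracket_lim F \<psi> \<phi> = 1"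

definition T_00 :: "(real \<Rightarrow> complex) \<Rightarrow> (real \<Rightarrow> complex) \<Rightarrow> l2op" where
  "T_00 \<phi>a \<phi>b = sl_operator {g \<in> dom_max. bracket_a g \<phi>a = 0 \<and> bracket_b g \<phi>b = 0}"

definition T_R ::
  "(real \<Rightarrow> complex) \<Rightarrow> (real \<Rightarrow> complex) \<Rightarrow> (real \<Rightarrow> complex) \<Rightarrow> (real \<Rightarrow> complex) \<Rightarrow>
   real^2^2 \<Rightarrow> real \<Rightarrow> l2op" where
  "T_R \<phi>a \<psi>a \<phi>b \<psi>b R \<eta> = sl_operator {g \<in> dom_max.
     (vector [bracket_b g \<phi>b, bracket_b g \<psi>b] :: complex^2) =
       exp (\<i> * of_real \<eta>) *s
         (map_matrix complex_of_real R *v vector [bracket_a g \<phi>a, bracket_a g \<psi>a])}"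

definition K_R ::
  "(real \<Rightarrow> complex) \<Rightarrow> (real \<Rightarrow> complex) \<Rightarrow> real^2^2 \<Rightarrow> real \<Rightarrow>
   (2 \<Rightarrow> real \<Rightarrow> complex) \<Rightarrow> complex^2^2" where
  "K_R \<psi>a \<psi>b R \<eta> u = vector
     [vector [of_real (R$2$2) / of_real (R$1$2) - bracket_b (u 1) \<psi>b,
              - (exp (- (\<i> * of_real \<eta>)) / of_real (R$1$2)) + bracket_a (u 1) \<psi>a],
      vector [- (exp (\<i> * of_real \<eta>) / of_real (R$1$2)) - bracket_b (u 2) \<psi>b,
              of_real (R$1$1) / of_real (R$1$2) + bracket_a (u 2) \<psi>a]]"

end

end

theory Submission
  imports Defs
begin

text \<open>
  Three ingredients carry the proof.

  First, boundary values.  By Lagrange's identity the bracket \<open>[f, g]\<close> of two elements of the maximal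
  domain is an indefinite integral of an integrable function, so it has limits at both endpoints, and
  \<open>[f, g](b) - [f, g](a) = \<langle>g, \<tau> f\<rangle> - \<langle>\<tau> g, f\<rangle>\<close> (\<open>lagrange_limits\<close>).  The bracket is a symplectic
  form on a plane, hence the two numbers \<open>[f, \<phi>](c)\<close> and \<open>[f, \<psi>](c)\<close> given by a boundary condition
  basis determine all the boundary values of f at c (\<open>br_pluecker\<close>).

  Second, the minimal operator.  In the limit circle case all solutions of \<open>\<tau> u = 0\<close> are square
  integrable over the whole interval, so variation of constants solves \<open>\<tau> f = k\<close> for every square
  integrable k by a function with vanishing boundary values at a and with boundary values at b that
  are inner products of k with the solutions.  Testing the adjoint of the maximal operator against
  such f shows that it is the restriction of the maximal operator to functions all of whose boundary
  values vanish (\<open>T_min_boundary_values\<close>).  If \<open>R\<^sub>1\<^sub>2 \<noteq> 0\<close>, a function that satisfies the separated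
  and the coupled boundary conditions has four vanishing boundary values, and this is the relative
  primeness.

  Third, linear algebra.  Let \<open>f = (T\<^sub>0\<^sub>,\<^sub>0 - z)\<^sup>-\<^sup>1 k\<close>.  The function \<open>f + c\<^sub>1 u\<^sub>1 + c\<^sub>2 u\<^sub>2\<close> solves the
  same inhomogeneous equation, and it satisfies the coupled conditions exactly if
  \<open>K(z)\<^sup>T c = ([f, \<psi>\<^sub>b](b), - [f, \<psi>\<^sub>a](a))\<close> (\<open>correction_in_domain_R_iff\<close>).  By Lagrange's identity the
  right-hand side is the pair of inner products of k with the solutions for the conjugate spectral
  parameter (\<open>inner_u_eq_boundary_value\<close>).  A vector in the kernel of \<open>K(z)\<^sup>T\<close> would give an
  eigenfunction of the coupled operator, so \<open>K(z)\<close> is invertible, and solving for c gives the formula.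

  All of this rests on the calculus of absolutely continuous functions, which are here defined by the
  epsilon-delta condition while derivatives are pointwise.  The link between the two is that such a
  function is the indefinite integral of an integrable function (\<open>abs_cont_on_imp_integral\<close>, by the
  Radon-Nikodym theorem) and that an indefinite integral is differentiable almost everywhere
  (\<open>lebesgue_differentiation\<close>).
\<close>

section \<open>Total variation of absolutely continuous functions\<close>

text \<open>
  The families of intervals that occur in the definition of absolute continuity.  They may contain
  degenerate intervals, even inside other intervals of the family.
\<close>
definition nonoverlapping :: "real \<Rightarrow> real \<Rightarrow> (real \<times> real) set \<Rightarrow> bool" where
  "nonoverlapping c d D \<longleftrightarrow> finite D \<and> (\<forall>(s, t)\<in>D. c \<le> s \<and> s \<le> t \<and> t \<le> d) \<and>
     disjoint_family_on (\<lambda>(s, t). {s<..<t}) D"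

definition variation :: "(real \<Rightarrow> complex) \<Rightarrow> (real \<times> real) set \<Rightarrow> real" where
  "variation f D = (\<Sum>(s, t)\<in>D. cmod (f t - f s))"

definition total_variation :: "(real \<Rightarrow> complex) \<Rightarrow> real \<Rightarrow> real \<Rightarrow> real" where
  "total_variation f c d = Sup (variation f ` {D. nonoverlapping c d D})"

lemma abs_cont_on_iff_variation:
  "abs_cont_on c d f \<longleftrightarrow> (\<forall>\<epsilon>>0. \<exists>\<delta>>0. \<forall>D. nonoverlapping c d D \<and> (\<Sum>(s, t)\<in>D. t - s) < \<delta> \<longrightarrow>
     variation f D < \<epsilon>)"
  unfolding abs_cont_on_def nonoverlapping_def variation_def by (simp add: conj_assoc)

lemma nonoverlapping_finite: "nonoverlapping c d D \<Longrightarrow> finite D"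
  by (simp add: nonoverlapping_def)

lemma nonoverlapping_bounds:
  assumes "nonoverlapping c d D" "i \<in> D"
  shows "c \<le> fst i" "fst i \<le> snd i" "snd i \<le> d"
  using assms unfolding nonoverlapping_def by (cases i; force)+

lemma nonoverlapping_disjoint:
  assumes "nonoverlapping c d D" "i \<in> D" "j \<in> D" "i \<noteq> j"
  shows "{fst i<..<snd i} \<inter> {fst j<..<snd j} = {}"
  using assms unfolding nonoverlapping_def disjoint_family_on_def
  by (metis (no_types, lifting) case_prod_beta)

lemma nonoverlappingI:
  assumes "finite D" "\<And>i. i \<in> D \<Longrightarrow> c \<le> fst i \<and> fst i \<le> snd i \<and> snd i \<le> d"
    "\<And>i j. i \<in> D \<Longrightarrow> j \<in> D \<Longrightarrow> i \<noteq> j \<Longrightarrow> {fst i<..<snd i} \<inter> {fst j<..<snd j} = {}"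
  shows "nonoverlapping c d D"
  using assms unfolding nonoverlapping_def disjoint_family_on_def
  by (auto simp: case_prod_beta)

lemma nonoverlapping_empty [simp]: "nonoverlapping c d {}"
  by (auto simp: nonoverlapping_def disjoint_family_on_def)

lemma nonoverlapping_mono:
  assumes "nonoverlapping s t D" "c \<le> s" "t \<le> d"
  shows "nonoverlapping c d D"
proof (rule nonoverlappingI)
  show "c \<le> fst i \<and> fst i \<le> snd i \<and> snd i \<le> d" if "i \<in> D" for i
    using nonoverlapping_bounds[OF assms(1) that] assms(2,3) by simp
qed (use nonoverlapping_finite[OF assms(1)] nonoverlapping_disjoint[OF assms(1)] in auto)

lemma nonoverlapping_length_le_measure:
  assumes D: "nonoverlapping c d D" and sub: "\<And>s t. (s, t) \<in> D \<Longrightarrow> {s<..<t} \<subseteq> S"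
    and S: "S \<in> lmeasurable"
  shows "(\<Sum>(s, t)\<in>D. t - s) \<le> measure lebesgue S"
proof -
  let ?I = "\<lambda>i :: real \<times> real. {fst i<..<snd i}"
  have "(\<Sum>(s, t)\<in>D. t - s) = (\<Sum>i\<in>D. measure lebesgue (?I i))"
  proof (intro sum.cong refl, clarify)
    fix s t assume "(s, t) \<in> D"
    then have "s \<le> t" using nonoverlapping_bounds[OF D] by force
    then show "t - s = measure lebesgue (?I (s, t))" by simp
  qed
  also have "\<dots> = measure lebesgue (\<Union>i\<in>D. ?I i)"
    by (rule measure_UNION'[symmetric])
       (use nonoverlapping_finite[OF D] nonoverlapping_disjoint[OF D] in
         \<open>auto simp: pairwise_def disjnt_def lmeasurable_interval\<close>)
  also have "\<dots> \<le> measure lebesgue S"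
  proof (rule measure_mono_fmeasurable)
    show "(\<Union>i\<in>D. ?I i) \<subseteq> S" using sub by force
    show "(\<Union>i\<in>D. ?I i) \<in> sets lebesgue" using nonoverlapping_finite[OF D] by (intro sets.finite_UN) auto
  qed fact
  finally show ?thesis .
qed

lemma nonoverlapping_length_le:
  assumes "nonoverlapping c d D" "c \<le> d"
  shows "(\<Sum>(s, t)\<in>D. t - s) \<le> d - c"
  using nonoverlapping_length_le_measure[OF assms(1), of "{c..d}"] nonoverlapping_bounds[OF assms(1)]
    assms(2) by force

text \<open>
  Refining every interval of a family by a family of its own.  Degenerate intervals are discarded,
  because one at a common endpoint may belong to the refinements of two neighbours and would be
  counted only once in the union.
\<close>
lemma nonoverlapping_refine:
  fixes E :: "real \<times> real \<Rightarrow> (real \<times> real) set" and h :: "real \<times> real \<Rightarrow> real"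
  assumes D: "nonoverlapping c d D" and E: "\<And>i. i \<in> D \<Longrightarrow> nonoverlapping (fst i) (snd i) (E i)"
  defines "U \<equiv> (\<Union>i\<in>D. {j \<in> E i. fst j < snd j})"
  shows "nonoverlapping c d U"
    and "(\<And>s. h (s, s) = 0) \<Longrightarrow> sum h U = (\<Sum>i\<in>D. sum h (E i))"
proof -
  have sub: "{fst j<..<snd j} \<subseteq> {fst i<..<snd i}" if "i \<in> D" "j \<in> E i" for i j
    using nonoverlapping_bounds[OF E[OF that(1)] that(2)] by auto
  have same: "i = i'" if "i \<in> D" "i' \<in> D" "j \<in> E i" "j' \<in> E i'"
    "{fst j<..<snd j} \<inter> {fst j'<..<snd j'} \<noteq> {}" for i i' j j'
    using nonoverlapping_disjoint[OF D that(1,2)] sub[OF that(1,3)] sub[OF that(2,4)] that(5) by blast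
  show "nonoverlapping c d U"
  proof (rule nonoverlappingI)
    show "finite U"
      unfolding U_def using nonoverlapping_finite[OF D] nonoverlapping_finite[OF E] by auto
    show "c \<le> fst j \<and> fst j \<le> snd j \<and> snd j \<le> d" if "j \<in> U" for j
    proof -
      obtain i where "i \<in> D" "j \<in> E i" using \<open>j \<in> U\<close> U_def by blast
      then show ?thesis
        using nonoverlapping_bounds[OF D, of i] nonoverlapping_bounds[OF E, of i j] by linarith
    qed
    show "{fst j<..<snd j} \<inter> {fst j'<..<snd j'} = {}" if jj: "j \<in> U" "j' \<in> U" "j \<noteq> j'" for j j'
    proof (rule ccontr)
      assume ne: "{fst j<..<snd j} \<inter> {fst j'<..<snd j'} \<noteq> {}"
      obtain i i' where i: "i \<in> D" "j \<in> E i" "i' \<in> D" "j' \<in> E i'" using jj U_def by blast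
      then show False
        using same[OF i(1,3,2,4) ne] nonoverlapping_disjoint[OF E[OF i(1)] i(2) _ jj(3)] i(4) ne by blast
    qed
  qed
  assume h: "\<And>s. h (s, s) = 0"
  have "sum h U = (\<Sum>i\<in>D. sum h {j \<in> E i. fst j < snd j})"
    unfolding U_def
  proof (rule sum.UNION_disjoint)
    show "\<forall>i\<in>D. \<forall>i'\<in>D. i \<noteq> i' \<longrightarrow> {j \<in> E i. fst j < snd j} \<inter> {j \<in> E i'. fst j < snd j} = {}"
    proof (intro ballI impI, rule ccontr)
      fix i i' assume i: "i \<in> D" "i' \<in> D" "i \<noteq> i'"
        "{j \<in> E i. fst j < snd j} \<inter> {j \<in> E i'. fst j < snd j} \<noteq> {}"
      then obtain j where "j \<in> E i" "j \<in> E i'" "fst j < snd j" by blast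
      then show False using same[OF i(1,2), of j j] i(3) by auto
    qed
  qed (use nonoverlapping_finite[OF D] nonoverlapping_finite[OF E] in auto)
  also have "\<dots> = (\<Sum>i\<in>D. sum h (E i))"
  proof (rule sum.cong[OF refl])
    fix i assume i: "i \<in> D"
    have "h j = 0" if "j \<in> E i - {j \<in> E i. fst j < snd j}" for j
    proof -
      have "fst j = snd j" using nonoverlapping_bounds[OF E[OF i], of j] that by auto
      then show ?thesis using h[of "fst j"] by (metis prod.collapse)
    qed
    then show "sum h {j \<in> E i. fst j < snd j} = sum h (E i)"
      using nonoverlapping_finite[OF E[OF i]] by (intro sum.mono_neutral_left) auto
  qed
  finally show "sum h U = (\<Sum>i\<in>D. sum h (E i))" .
qed

text \<open>
  With k the minimum or the maximum with y, this cuts a family at y.  Two different intervals with the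
  same image are both collapsed to a point, so that their identification does not change the variation.
\<close>
lemma nonoverlapping_clip:
  fixes k :: "real \<Rightarrow> real"
  assumes D: "nonoverlapping x z D" and k: "mono k" and range: "\<And>u. x \<le> u \<Longrightarrow> u \<le> z \<Longrightarrow> k u \<in> {x'..z'}"
    and sub: "\<And>s t. s \<le> t \<Longrightarrow> {k s<..<k t} \<subseteq> {s<..<t}"
  shows "nonoverlapping x' z' ((\<lambda>i. (k (fst i), k (snd i))) ` D)"
    and "variation f ((\<lambda>i. (k (fst i), k (snd i))) ` D) = (\<Sum>(s, t)\<in>D. cmod (f (k t) - f (k s)))"
proof -
  let ?k = "\<lambda>i. (k (fst i), k (snd i))"
  have sub': "{k (fst i)<..<k (snd i)} \<subseteq> {fst i<..<snd i}" if "i \<in> D" for i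
    using sub nonoverlapping_bounds[OF D that] by blast
  show "nonoverlapping x' z' (?k ` D)"
  proof (rule nonoverlappingI)
    show "x' \<le> fst i \<and> fst i \<le> snd i \<and> snd i \<le> z'" if ik: "i \<in> ?k ` D" for i
    proof -
      obtain j where j: "j \<in> D" "i = ?k j" using ik by blast
      then show ?thesis
        using nonoverlapping_bounds[OF D j(1)] range[of "fst j"] range[of "snd j"] monoD[OF k] by auto
    qed
    show "{fst i<..<snd i} \<inter> {fst j<..<snd j} = {}" if ij: "i \<in> ?k ` D" "j \<in> ?k ` D" "i \<noteq> j" for i j
    proof -
      obtain i' j' where "i' \<in> D" "i = ?k i'" "j' \<in> D" "j = ?k j'" using ij by blast
      then show ?thesis
        using sub'[of i'] sub'[of j'] nonoverlapping_disjoint[OF D, of i' j'] ij(3) by fastforce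
    qed
  qed (use nonoverlapping_finite[OF D] in auto)
  have "variation f (?k ` D) = (\<Sum>i\<in>D. ((\<lambda>(s, t). cmod (f t - f s)) \<circ> ?k) i)"
    unfolding variation_def
  proof (rule sum.reindex_nontrivial)
    fix i j assume ij: "i \<in> D" "j \<in> D" "i \<noteq> j" "?k i = ?k j"
    have "{k (fst i)<..<k (snd i)} = {}"
    proof -
      have "{k (fst i)<..<k (snd i)} \<subseteq> {fst i<..<snd i} \<inter> {fst j<..<snd j}"
        using sub'[OF ij(1)] sub'[OF ij(2)] ij(4) by (metis Int_subset_iff prod.inject)
      then show ?thesis using nonoverlapping_disjoint[OF D ij(1-3)] by simp
    qed
    moreover have "k (fst i) \<le> k (snd i)" using monoD[OF k] nonoverlapping_bounds[OF D ij(1)] by blast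
    ultimately have "k (fst i) = k (snd i)" by auto
    then show "(case ?k i of (s, t) \<Rightarrow> cmod (f t - f s)) = 0" by simp
  qed (use nonoverlapping_finite[OF D] in auto)
  then show "variation f (?k ` D) = (\<Sum>(s, t)\<in>D. cmod (f (k t) - f (k s)))"
    by (simp add: case_prod_beta)
qed

lemma nonoverlapping_split:
  assumes D: "nonoverlapping x z D" and "x \<le> y" "y \<le> z"
  obtains D1 D2 where "nonoverlapping x y D1" "nonoverlapping y z D2"
    "variation f D \<le> variation f D1 + variation f D2"
proof -
  let ?l = "\<lambda>u. min u y" and ?r = "\<lambda>u. max u y"
  let ?D1 = "(\<lambda>i. (?l (fst i), ?l (snd i))) ` D" and ?D2 = "(\<lambda>i. (?r (fst i), ?r (snd i))) ` D"
  have 1: "nonoverlapping x y ?D1" "variation f ?D1 = (\<Sum>(s, t)\<in>D. cmod (f (?l t) - f (?l s)))"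
    using assms by (intro nonoverlapping_clip[OF D] monoI; auto simp: min_def)+
  have 2: "nonoverlapping y z ?D2" "variation f ?D2 = (\<Sum>(s, t)\<in>D. cmod (f (?r t) - f (?r s)))"
    using assms by (intro nonoverlapping_clip[OF D] monoI; auto simp: max_def)+
  have "variation f D \<le> (\<Sum>(s, t)\<in>D. cmod (f (?l t) - f (?l s)) + cmod (f (?r t) - f (?r s)))"
    unfolding variation_def
  proof (intro sum_mono, clarify)
    fix s t assume "(s, t) \<in> D"
    then have "s \<le> t" using nonoverlapping_bounds[OF D] by force
    have "f t - f s = (f (?l t) - f (?l s)) + (f (?r t) - f (?r s))"
      using \<open>s \<le> t\<close> by (auto simp: min_def max_def)
    then show "cmod (f t - f s) \<le> cmod (f (?l t) - f (?l s)) + cmod (f (?r t) - f (?r s))"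
      by (metis norm_triangle_ineq)
  qed
  also have "\<dots> = variation f ?D1 + variation f ?D2"
    unfolding 1 2 by (simp add: case_prod_beta sum.distrib)
  finally show thesis using that 1(1) 2(1) by blast
qed

text \<open>
  On an interval that is shorter than the \<open>\<delta>\<close> belonging to \<open>\<epsilon> = 1\<close> the variation is at most 1, and
  bounds for adjacent intervals add up.
\<close>
lemma abs_cont_on_imp_bounded_variation:
  assumes f: "abs_cont_on c d f" and "c \<le> d"
  shows "bdd_above (variation f ` {D. nonoverlapping c d D})"
proof -
  obtain \<delta> where \<delta>: "\<delta> > 0"
    "\<And>D. nonoverlapping c d D \<Longrightarrow> (\<Sum>(s, t)\<in>D. t - s) < \<delta> \<Longrightarrow> variation f D < 1"
    using f unfolding abs_cont_on_iff_variation by (meson zero_less_one)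
  have "c \<le> c \<and> d \<le> d \<longrightarrow> bdd_above (variation f ` {D. nonoverlapping c d D})"
  proof (rule Bolzano[where P = "\<lambda>x y. c \<le> x \<and> y \<le> d \<longrightarrow> bdd_above (variation f ` {D. nonoverlapping x y D})",
        OF \<open>c \<le> d\<close>], goal_cases)
    case trans: (1 x y z)
    show ?case
    proof
      assume "c \<le> x \<and> z \<le> d"
      then obtain B1 B2 where B: "\<And>D. nonoverlapping x y D \<Longrightarrow> variation f D \<le> B1"
        "\<And>D. nonoverlapping y z D \<Longrightarrow> variation f D \<le> B2"
        using trans by (auto simp: bdd_above_def)
      show "bdd_above (variation f ` {D. nonoverlapping x z D})"
      proof (rule bdd_aboveI2)
        fix D assume "D \<in> {D. nonoverlapping x z D}"
        then obtain D1 D2 where "nonoverlapping x y D1" "nonoverlapping y z D2"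
          "variation f D \<le> variation f D1 + variation f D2"
          using nonoverlapping_split trans(3,4) by blast
        then show "variation f D \<le> B1 + B2" using B by (meson add_mono order_trans)
      qed
    qed
  next
    case (2 x)
    have *: "bdd_above (variation f ` {D. nonoverlapping s t D})"
      if "s \<le> x \<and> x \<le> t \<and> t - s < \<delta>" "c \<le> s \<and> t \<le> d" for s t
    proof (rule bdd_aboveI2)
      fix D assume "D \<in> {D. nonoverlapping s t D}"
      then have "nonoverlapping c d D" "(\<Sum>(s, t)\<in>D. t - s) \<le> t - s"
        using nonoverlapping_mono nonoverlapping_length_le that by (blast, force)
      then show "variation f D \<le> 1" using \<delta>(2)[of D] that by linarith
    qed
    show ?case using \<delta>(1) * by blast
  qed
  then show ?thesis by simp
qed

lemma abs_cont_on_subset: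
  assumes "abs_cont_on c d f" "c \<le> s" "t \<le> d"
  shows "abs_cont_on s t f"
  using assms nonoverlapping_mono unfolding abs_cont_on_iff_variation by meson

text \<open>
  The variation function inherits absolute continuity: replace each interval of a family of small total
  length by a subdivision that nearly exhausts the variation of f over it.  All the subdivisions
  together form again a family of small total length, over which f varies little.
\<close>
lemma total_variation_function:
  assumes f: "abs_cont_on c d f" and "c \<le> d"
  defines "W \<equiv> total_variation f c"
  shows "\<And>x y. c \<le> x \<Longrightarrow> x \<le> y \<Longrightarrow> y \<le> d \<Longrightarrow> cmod (f y - f x) \<le> W y - W x"
    and "\<And>\<epsilon>. \<epsilon> > 0 \<Longrightarrow> \<exists>\<delta>>0. \<forall>D. nonoverlapping c d D \<and> (\<Sum>(s, t)\<in>D. t - s) < \<delta> \<longrightarrow>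
           (\<Sum>(s, t)\<in>D. W t - W s) < \<epsilon>"
proof -
  have bdd: "bdd_above (variation f ` {D. nonoverlapping x y D})" if "c \<le> x" "x \<le> y" "y \<le> d" for x y
    by (intro abs_cont_on_imp_bounded_variation[OF abs_cont_on_subset[OF f]]) (use that in auto)
  have upper: "variation f D \<le> total_variation f x y"
    if "c \<le> x" "x \<le> y" "y \<le> d" "nonoverlapping x y D" for x y D
    unfolding total_variation_def using that bdd by (intro cSup_upper) auto
  have least: "total_variation f x y \<le> B" if "\<And>D. nonoverlapping x y D \<Longrightarrow> variation f D \<le> B" for x y B
  proof -
    have "{D. nonoverlapping x y D} \<noteq> {}" using nonoverlapping_empty by blast
    then show ?thesis unfolding total_variation_def using that by (intro cSup_least) auto
  qed
  show "cmod (f y - f x) \<le> W y - W x" if xy: "c \<le> x" "x \<le> y" "y \<le> d" for x y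
  proof (cases "x = y")
    case False
    have "W x \<le> W y - cmod (f y - f x)" unfolding W_def
    proof (rule least)
      fix D assume D: "nonoverlapping c x D"
      have notin: "(x, y) \<notin> D" using nonoverlapping_bounds[OF D] xy False by force
      have "nonoverlapping c y (insert (x, y) D)"
      proof (rule nonoverlappingI)
        show "c \<le> fst i \<and> fst i \<le> snd i \<and> snd i \<le> y" if "i \<in> insert (x, y) D" for i
          using nonoverlapping_bounds[OF D, of i] that xy by (cases "i = (x, y)") auto
        have "{x<..<y} \<inter> {fst j<..<snd j} = {}" if "j \<in> D" for j
          using nonoverlapping_bounds[OF D that] by auto
        then show "{fst i<..<snd i} \<inter> {fst j<..<snd j} = {}"
          if "i \<in> insert (x, y) D" "j \<in> insert (x, y) D" "i \<noteq> j" for i j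
          using that nonoverlapping_disjoint[OF D, of i j] by (cases "i = (x, y)"; cases "j = (x, y)") (simp_all add: Int_commute)
      qed (use nonoverlapping_finite[OF D] in auto)
      then have "variation f (insert (x, y) D) \<le> total_variation f c y"
        by (intro upper) (use xy in auto)
      then show "variation f D \<le> total_variation f c y - cmod (f y - f x)"
        using notin nonoverlapping_finite[OF D] by (simp add: variation_def)
    qed
    then show ?thesis by simp
  qed simp
  have sub: "W y - W x \<le> total_variation f x y" if xy: "c \<le> x" "x \<le> y" "y \<le> d" for x y
  proof -
    have "W y \<le> W x + total_variation f x y" unfolding W_def
    proof (rule least)
      fix D assume "nonoverlapping c y D"
      then obtain D1 D2 where *: "nonoverlapping c x D1" "nonoverlapping x y D2"
          "variation f D \<le> variation f D1 + variation f D2"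
        using nonoverlapping_split xy by blast
      have "variation f D1 \<le> total_variation f c x" 
        by (rule upper[OF _ _ _ *(1)]) (use xy in auto)
      moreover have "variation f D2 \<le> total_variation f x y"
        by (rule upper[OF _ _ _ *(2)]) (use xy in auto)
      ultimately show "variation f D \<le> total_variation f c x + total_variation f x y" using *(3) by linarith
    qed
    then show ?thesis by simp
  qed
  fix \<epsilon> :: real assume "\<epsilon> > 0"
  then have "\<epsilon>/2 > 0" by simp
  with f have "\<exists>\<delta>>0. \<forall>D. nonoverlapping c d D \<and> (\<Sum>(s, t)\<in>D. t - s) < \<delta> \<longrightarrow> variation f D < \<epsilon>/2"
    unfolding abs_cont_on_iff_variation by blast
  then obtain \<delta> where \<delta>: "\<delta> > 0"
    "\<And>D. nonoverlapping c d D \<Longrightarrow> (\<Sum>(s, t)\<in>D. t - s) < \<delta> \<Longrightarrow> variation f D < \<epsilon>/2"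
    by blast
  have "(\<Sum>(s, t)\<in>D. W t - W s) < \<epsilon>" if D: "nonoverlapping c d D" "(\<Sum>(s, t)\<in>D. t - s) < \<delta>" for D
  proof -
    define \<eta> where "\<eta> = \<epsilon> / (4 * (real (card D) + 1))"
    have "\<eta> > 0" using \<open>\<epsilon> > 0\<close> by (simp add: \<eta>_def)
    have ex: "\<exists>E. nonoverlapping (fst i) (snd i) E \<and> total_variation f (fst i) (snd i) - \<eta> < variation f E"
      if "i \<in> D" for i
    proof (rule ccontr)
      assume "\<not> ?thesis"
      then have "total_variation f (fst i) (snd i) \<le> total_variation f (fst i) (snd i) - \<eta>"
        by (intro least) force
      then show False using \<open>\<eta> > 0\<close> by simp
    qed
    obtain E where E: "\<And>i. i \<in> D \<Longrightarrow> nonoverlapping (fst i) (snd i) (E i)"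
      "\<And>i. i \<in> D \<Longrightarrow> total_variation f (fst i) (snd i) - \<eta> < variation f (E i)"
    proof -
      have "\<forall>i\<in>D. \<exists>E. nonoverlapping (fst i) (snd i) E \<and> total_variation f (fst i) (snd i) - \<eta> < variation f E"
        using ex by blast
      from bchoice[OF this] show thesis using that by blast
    qed
    define U where "U = (\<Union>i\<in>D. {j \<in> E i. fst j < snd j})"
    have U: "nonoverlapping c d U" unfolding U_def by (rule nonoverlapping_refine(1)[OF D(1) E(1)])
    have sumU: "sum h U = (\<Sum>i\<in>D. sum h (E i))" if "\<And>s. h (s, s) = 0" for h :: "real \<times> real \<Rightarrow> real"
      unfolding U_def by (rule nonoverlapping_refine(2)[where E = E and h = h, OF D(1) E(1) that])
    have "(\<Sum>(s, t)\<in>U. t - s) = (\<Sum>i\<in>D. \<Sum>(s, t)\<in>E i. t - s)"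
      by (rule sumU) auto
    also have "\<dots> \<le> (\<Sum>(s, t)\<in>D. t - s)"
      using nonoverlapping_length_le[OF E(1)] nonoverlapping_bounds[OF D(1)]
      by (intro sum_mono) (auto simp: case_prod_beta)
    finally have varU: "variation f U < \<epsilon>/2" using \<delta>(2)[OF U] D(2) by linarith
    have "(\<Sum>(s, t)\<in>D. W t - W s) \<le> (\<Sum>i\<in>D. variation f (E i) + \<eta>)"
    proof (rule sum_mono)
      fix i assume i: "i \<in> D"
      show "(case i of (s, t) \<Rightarrow> W t - W s) \<le> variation f (E i) + \<eta>"
        using sub[of "fst i" "snd i"] E(2)[OF i] nonoverlapping_bounds[OF D(1) i]
        by (simp add: case_prod_beta)
    qed
    also have "\<dots> = variation f U + real (card D) * \<eta>"
      unfolding variation_def by (subst sumU) (auto simp: sum.distrib)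
    also have "real (card D) * \<eta> \<le> \<epsilon> / 4"
      using \<open>\<epsilon> > 0\<close> by (simp add: \<eta>_def field_simps)
    finally show ?thesis using varU \<open>\<epsilon> > 0\<close> by linarith
  qed
  then show "\<exists>\<delta>>0. \<forall>D. nonoverlapping c d D \<and> (\<Sum>(s, t)\<in>D. t - s) < \<delta> \<longrightarrow> (\<Sum>(s, t)\<in>D. W t - W s) < \<epsilon>"
    using \<delta>(1) by blast
qed

section \<open>Absolutely continuous functions are indefinite integrals\<close>

text \<open>
  A null set is covered by countably many nonoverlapping closed intervals of small total length.
  Absolute continuity bounds the measure of every finite union of them, and continuity from below
  extends the bound to the whole cover.
\<close>
lemma abs_cont_interval_measure_null:
  assumes mono: "\<And>x y. x \<le> y \<Longrightarrow> G x \<le> G y" and cont: "continuous_on UNIV G"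
    and ac: "\<And>\<epsilon>. \<epsilon> > 0 \<Longrightarrow> \<exists>\<delta>>0. \<forall>D. nonoverlapping c d D \<and> (\<Sum>(s, t)\<in>D. t - s) < \<delta> \<longrightarrow>
           (\<Sum>(s, t)\<in>D. G t - G s) < \<epsilon>"
    and N: "N \<in> null_sets lborel" "N \<subseteq> {c..d}"
  shows "emeasure (interval_measure G) N = 0"
proof -
  let ?\<mu> = "interval_measure G"
  have Icc: "emeasure ?\<mu> {s..t} = ennreal (G t - G s)" if "s \<le> t" for s t
    using emeasure_interval_measure_Icc[OF that mono cont] by simp
  have "emeasure ?\<mu> N \<le> ennreal \<epsilon>" if eps: "\<epsilon> > 0" for \<epsilon> :: real
  proof -
    obtain \<delta> where \<delta>: "\<delta> > 0" "\<And>D. nonoverlapping c d D \<Longrightarrow> (\<Sum>(s, t)\<in>D. t - s) < \<delta> \<Longrightarrow>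
           (\<Sum>(s, t)\<in>D. G t - G s) < \<epsilon>"
      using ac[OF eps] by blast
    have N': "N \<in> null_sets lebesgue" using N by (simp add: null_sets_completionI)
    then have "N \<in> lmeasurable" "measure lebesgue N = 0"
      by (simp_all add: negligible_imp_measurable negligible_imp_measure0 negligible_iff_null_sets)
    then obtain \<D> where \<D>: "countable \<D>"
      "\<And>K. K \<in> \<D> \<Longrightarrow> K \<subseteq> cbox c d \<and> K \<noteq> {} \<and> (\<exists>u v. K = cbox u v)"
      "pairwise (\<lambda>A B. interior A \<inter> interior B = {}) \<D>"
      "N \<subseteq> \<Union>\<D>" "\<Union>\<D> \<in> lmeasurable" "measure lebesgue (\<Union>\<D>) \<le> \<delta>/2"
      using measurable_outer_intervals_bounded[of N c d "\<delta>/2"] N(2) \<delta>(1)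
      by (metis (no_types, lifting) add_0 cbox_interval half_gt_zero)
    have K: "K = {Inf K..Sup K} \<and> Inf K \<le> Sup K \<and> c \<le> Inf K \<and> Sup K \<le> d" if "K \<in> \<D>" for K
      using \<D>(2)[OF that] by auto
    have fin: "emeasure ?\<mu> (\<Union>\<F>) \<le> ennreal \<epsilon>" if \<F>: "finite \<F>" "\<F> \<subseteq> \<D>" for \<F>
    proof -
      define E where "E = (\<lambda>K. (Inf K, Sup K)) ` \<F>"
      have inj: "inj_on (\<lambda>K. (Inf K, Sup K)) \<F>"
        by (rule inj_onI) (metis K \<F>(2) prod.inject subsetD)
      have EK: "K \<in> \<F> \<and> {fst i<..<snd i} = interior K" if "K \<in> \<F>" "i = (Inf K, Sup K)" for i and K
        using K[of K] that \<F>(2) by (metis fst_conv interior_atLeastAtMost_real snd_conv subsetD)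
      have E: "nonoverlapping c d E"
      proof (rule nonoverlappingI)
        show "finite E" using \<F> by (simp add: E_def)
        show "c \<le> fst i \<and> fst i \<le> snd i \<and> snd i \<le> d" if "i \<in> E" for i
          using that K \<F>(2) unfolding E_def by fastforce
        show "{fst i<..<snd i} \<inter> {fst j<..<snd j} = {}" if ij: "i \<in> E" "j \<in> E" "i \<noteq> j" for i j
        proof -
          obtain A B where AB: "A \<in> \<F>" "i = (Inf A, Sup A)" "B \<in> \<F>" "j = (Inf B, Sup B)"
            using ij unfolding E_def by blast
          then have "A \<noteq> B" using ij by blast
          then have "interior A \<inter> interior B = {}"
            using pairwiseD[OF \<D>(3)] AB \<F>(2) by blast
          then show ?thesis using EK[OF AB(1,2)] EK[OF AB(3,4)] by simp
        qed
      qed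
      have "(\<Sum>(s, t)\<in>E. t - s) \<le> measure lebesgue (\<Union>\<D>)"
      proof (rule nonoverlapping_length_le_measure[OF E _ \<D>(5)])
        fix s t assume "(s, t) \<in> E"
        then obtain K where "K \<in> \<F>" "s = Inf K" "t = Sup K" unfolding E_def by blast
        then have "{s<..<t} \<subseteq> K" using K[of K] \<F>(2) by (metis greaterThanLessThan_subseteq_atLeastAtMost_iff order_refl subsetD)
        then show "{s<..<t} \<subseteq> \<Union>\<D>" using \<open>K \<in> \<F>\<close> \<F>(2) by blast
      qed
      then have "(\<Sum>(s, t)\<in>E. G t - G s) < \<epsilon>" using \<delta>(2)[OF E] \<D>(6) \<delta>(1) by linarith
      moreover have "(\<Sum>(s, t)\<in>E. G t - G s) = (\<Sum>K\<in>\<F>. G (Sup K) - G (Inf K))"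
        unfolding E_def by (subst sum.reindex[OF inj]) simp
      moreover have "emeasure ?\<mu> (\<Union>K\<in>\<F>. K) \<le> (\<Sum>K\<in>\<F>. emeasure ?\<mu> K)"
        using \<D>(2) \<F> by (intro emeasure_subadditive_finite) fastforce+
      moreover have "(\<Sum>K\<in>\<F>. emeasure ?\<mu> K) = (\<Sum>K\<in>\<F>. ennreal (G (Sup K) - G (Inf K)))"
        by (rule sum.cong[OF refl]) (metis K Icc \<F>(2) subsetD)
      moreover have "\<dots> = ennreal (\<Sum>K\<in>\<F>. G (Sup K) - G (Inf K))"
        by (rule sum_ennreal) (use K \<F>(2) mono in force)
      ultimately have "emeasure ?\<mu> (\<Union>\<F>) \<le> ennreal (\<Sum>(s, t)\<in>E. G t - G s)" "(\<Sum>(s, t)\<in>E. G t - G s) \<le> \<epsilon>"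
        by simp_all
      then show ?thesis using ennreal_leI order_trans by blast
    qed
    show ?thesis
    proof (cases "\<D> = {}")
      case True
      then show ?thesis using \<D>(4) by simp
    next
      case False
      define A where "A n = (\<Union>i\<in>{..n}. from_nat_into \<D> i)" for n :: nat
      have meas: "from_nat_into \<D> i \<in> sets borel" for i
        using \<D>(2)[OF from_nat_into[OF False, of i]] by auto
      have "\<Union>\<D> \<subseteq> (\<Union>n. A n)"
        unfolding A_def using subset_range_from_nat_into[OF \<D>(1)] by blast
      then have "emeasure ?\<mu> N \<le> emeasure ?\<mu> (\<Union>n. A n)"
        using \<D>(4) meas by (intro emeasure_mono) (auto simp: A_def)
      also have "\<dots> = (SUP n. emeasure ?\<mu> (A n))"
      proof (rule SUP_emeasure_incseq[symmetric])
        show "range A \<subseteq> sets ?\<mu>" using meas by (auto simp: A_def)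
        show "incseq A" by (rule incseq_SucI) (auto simp: A_def atMost_Suc)
      qed
      also have "\<dots> \<le> ennreal \<epsilon>"
        unfolding A_def by (intro SUP_least fin) (use from_nat_into[OF False] in auto)
      finally show ?thesis .
    qed
  qed
  then show ?thesis
    by (metis ennreal_le_epsilon add_0 le_zero_eq)
qed

text \<open>
  The density is obtained from the Radon-Nikodym theorem for the Lebesgue-Stieltjes measure of F, which
  is absolutely continuous by the preceding lemma.
\<close>
lemma mono_abs_cont_imp_integral:
  fixes F :: "real \<Rightarrow> real"
  assumes "c \<le> d" and mono: "\<And>x y. c \<le> x \<Longrightarrow> x \<le> y \<Longrightarrow> y \<le> d \<Longrightarrow> F x \<le> F y"
    and ac: "\<And>\<epsilon>. \<epsilon> > 0 \<Longrightarrow> \<exists>\<delta>>0. \<forall>D. nonoverlapping c d D \<and> (\<Sum>(s, t)\<in>D. t - s) < \<delta> \<longrightarrow>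
           (\<Sum>(s, t)\<in>D. F t - F s) < \<epsilon>"
  obtains g where "g absolutely_integrable_on {c..d}"
    "\<And>x. x \<in> {c..d} \<Longrightarrow> F x - F c = integral {c..x} g"
proof -
  \<comment> \<open>F is extended by constants, because Stieltjes measures are defined for functions on the real line.\<close>
  let ?k = "\<lambda>x. max c (min d x)"
  define G where "G x = F (?k x)" for x
  have k: "?k x \<in> {c..d}" for x using \<open>c \<le> d\<close> by auto
  have G_mono: "G x \<le> G y" if "x \<le> y" for x y
    unfolding G_def using \<open>c \<le> d\<close> that by (intro mono) auto
  have G_eq: "G x = F x" if "x \<in> {c..d}" for x using that by (simp add: G_def)
  have G_ac: "\<exists>\<delta>>0. \<forall>D. nonoverlapping c d D \<and> (\<Sum>(s, t)\<in>D. t - s) < \<delta> \<longrightarrow>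
           (\<Sum>(s, t)\<in>D. G t - G s) < \<epsilon>" if "\<epsilon> > 0" for \<epsilon>
  proof -
    have "(\<Sum>(s, t)\<in>D. G t - G s) = (\<Sum>(s, t)\<in>D. F t - F s)" if "nonoverlapping c d D" for D
      by (rule sum.cong[OF refl])
        (use nonoverlapping_bounds[OF that] G_eq in \<open>fastforce simp: case_prod_beta\<close>)
    then show ?thesis using ac[OF \<open>\<epsilon> > 0\<close>] by simp
  qed
  have cont: "continuous_on UNIV G"
    unfolding continuous_on_iff
  proof (intro ballI allI impI)
    fix x \<epsilon> :: real assume "0 < \<epsilon>"
    then obtain \<delta> where \<delta>: "\<delta> > 0" "\<And>D. nonoverlapping c d D \<Longrightarrow> (\<Sum>(s, t)\<in>D. t - s) < \<delta> \<Longrightarrow>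
           (\<Sum>(s, t)\<in>D. F t - F s) < \<epsilon>"
      using ac by blast
    have *: "G t - G s < \<epsilon>" if "s \<le> t" "t - s < \<delta>" for s t
    proof -
      have "nonoverlapping c d {(?k s, ?k t)}"
        by (rule nonoverlappingI) (use \<open>c \<le> d\<close> that in auto)
      from \<delta>(2)[OF this] show ?thesis using that by (auto simp: G_def)
    qed
    have "dist (G y) (G x) < \<epsilon>" if "dist y x < \<delta>" for y
      using *[of x y] *[of y x] G_mono[of x y] G_mono[of y x] that
      by (cases "x \<le> y") (auto simp: dist_real_def)
    then show "\<exists>\<delta>>0. \<forall>y\<in>UNIV. dist y x < \<delta> \<longrightarrow> dist (G y) (G x) < \<epsilon>" using \<delta>(1) by blast
  qed
  let ?\<mu> = "interval_measure G"
  define \<nu> where "\<nu> = density ?\<mu> (indicator {c..d})"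
  have sets_\<nu>: "sets \<nu> = sets borel" by (simp add: \<nu>_def)
  have \<nu>: "emeasure \<nu> A = emeasure ?\<mu> ({c..d} \<inter> A)" if "A \<in> sets borel" for A
    unfolding \<nu>_def using that
    by (simp add: emeasure_density indicator_inter_arith[symmetric])
  have "absolutely_continuous lborel \<nu>"
    unfolding absolutely_continuous_def
  proof
    fix N assume N: "N \<in> null_sets (lborel :: real measure)"
    then have "{c..d} \<inter> N \<in> null_sets lborel" by (metis null_set_Int1 atLeastAtMost_borel sets_lborel)
    then have "emeasure ?\<mu> ({c..d} \<inter> N) = 0"
      by (intro abs_cont_interval_measure_null[OF G_mono cont G_ac]) auto
    then show "N \<in> null_sets \<nu>" using N sets_\<nu> \<nu> by (auto simp: null_sets_def)
  qed
  then obtain h where h: "h \<in> borel_measurable lborel" "density lborel h = \<nu>"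
    using sigma_finite_measure.Radon_Nikodym[OF sigma_finite_lborel, of \<nu>] sets_\<nu> by (metis sets_lborel)
  have int: "(\<integral>\<^sup>+t. h t * indicator {c..x} t \<partial>lborel) = ennreal (F x - F c)" if x: "x \<in> {c..d}" for x
  proof -
    have "(\<integral>\<^sup>+t. h t * indicator {c..x} t \<partial>lborel) = emeasure \<nu> {c..x}"
      using h(1) by (simp add: emeasure_density flip: h(2))
    also have "\<dots> = emeasure ?\<mu> ({c..d} \<inter> {c..x})" by (rule \<nu>) simp
    also have "{c..d} \<inter> {c..x} = {c..x}" using x by auto
    also have "emeasure ?\<mu> {c..x} = ennreal (G x - G c)"
      using x G_mono cont by (intro emeasure_interval_measure_Icc) auto
    finally show ?thesis using x G_eq by simp
  qed
  \<comment> \<open>h is finite almost everywhere on \<open>[c, d]\<close>, so that passing to a real density changes no integral.\<close>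
  define g where "g t = enn2real (h t)" for t
  have "(\<integral>\<^sup>+t. h t * indicator {c..d} t \<partial>lborel) \<noteq> \<infinity>" using int[of d] \<open>c \<le> d\<close> by simp
  then have fin: "AE t in lborel. h t * indicator {c..d} t \<noteq> \<infinity>"
    using h(1) by (intro nn_integral_PInf_AE) auto
  have hint: "(g has_integral (F x - F c)) {c..x}" if x: "x \<in> {c..d}" for x
  proof -
    have "(\<integral>\<^sup>+t. ennreal (g t * indicator {c..x} t) \<partial>lborel) = (\<integral>\<^sup>+t. h t * indicator {c..x} t \<partial>lborel)"
    proof (rule nn_integral_cong_AE, use fin in eventually_elim)
      case (elim t)
      then show ?case using x by (cases "t \<in> {c..x}") (auto simp: g_def less_top)
    qed
    also have "\<dots> = ennreal (F x - F c)" using int[OF x] .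
    finally have "((\<lambda>t. g t * indicator {c..x} t) has_integral (F x - F c)) UNIV"
      using x mono[of c x] h(1) by (intro nn_integral_has_integral) (auto simp: g_def)
    also have "(\<lambda>t. g t * indicator {c..x} t) = (\<lambda>t. if t \<in> {c..x} then g t else 0)"
      by (auto simp: indicator_def)
    finally show ?thesis by (simp only: has_integral_restrict_UNIV)
  qed
  show thesis
  proof
    show "g absolutely_integrable_on {c..d}"
      using hint[of d] \<open>c \<le> d\<close>
      by (intro nonnegative_absolutely_integrable_1) (auto simp: g_def integrable_on_def)
    show "F x - F c = integral {c..x} g" if "x \<in> {c..d}" for x
      using hint[OF that] by (simp add: integral_unique)
  qed
qed

text \<open>
  With W the variation function of f, the three functions W, \<open>W - Re f\<close> and \<open>W - Im f\<close> are
  nondecreasing, and their increments are at most twice those of W; so the monotone case applies to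
  each of them.
\<close>
lemma abs_cont_on_imp_integral:
  assumes f: "abs_cont_on c d f" and "c \<le> d"
  obtains g where "g absolutely_integrable_on {c..d}"
    "\<And>x. x \<in> {c..d} \<Longrightarrow> f x - f c = integral {c..x} g"
proof -
  define W where "W = total_variation f c"
  have W_le: "cmod (f y - f x) \<le> W y - W x" if "c \<le> x" "x \<le> y" "y \<le> d" for x y
    unfolding W_def using total_variation_function(1)[OF assms that] .
  have W_ac: "\<exists>\<delta>>0. \<forall>D. nonoverlapping c d D \<and> (\<Sum>(s, t)\<in>D. t - s) < \<delta> \<longrightarrow>
           (\<Sum>(s, t)\<in>D. W t - W s) < \<epsilon>" if "\<epsilon> > 0" for \<epsilon>
    unfolding W_def using total_variation_function(2)[OF assms that] .
  have dominated: "\<exists>g. g absolutely_integrable_on {c..d} \<and> (\<forall>x\<in>{c..d}. F x - F c = integral {c..x} g)"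
    if F: "\<And>x y. c \<le> x \<Longrightarrow> x \<le> y \<Longrightarrow> y \<le> d \<Longrightarrow> 0 \<le> F y - F x \<and> F y - F x \<le> 2 * (W y - W x)"
    for F :: "real \<Rightarrow> real"
  proof -
    have "\<exists>\<delta>>0. \<forall>D. nonoverlapping c d D \<and> (\<Sum>(s, t)\<in>D. t - s) < \<delta> \<longrightarrow> (\<Sum>(s, t)\<in>D. F t - F s) < \<epsilon>"
      if "\<epsilon> > 0" for \<epsilon>
    proof -
      have le: "(\<Sum>(s, t)\<in>D. F t - F s) \<le> 2 * (\<Sum>(s, t)\<in>D. W t - W s)" if D: "nonoverlapping c d D" for D
        unfolding sum_distrib_left
        by (intro sum_mono) (use F nonoverlapping_bounds[OF D] in \<open>auto simp: case_prod_beta\<close>)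
      have "\<epsilon>/2 > 0" using that by simp
      from W_ac[OF this] obtain \<delta> where "\<delta> > 0" "\<forall>D. nonoverlapping c d D \<and> (\<Sum>(s, t)\<in>D. t - s) < \<delta> \<longrightarrow>
           (\<Sum>(s, t)\<in>D. W t - W s) < \<epsilon>/2" by blast
      then show ?thesis using le by (intro exI[of _ \<delta>]) force
    qed
    then show ?thesis
      using mono_abs_cont_imp_integral[OF \<open>c \<le> d\<close>, of F] F by (metis diff_ge_0_iff_ge)
  qed
  have Re_le: "\<bar>Re (f y) - Re (f x)\<bar> \<le> W y - W x" and Im_le: "\<bar>Im (f y) - Im (f x)\<bar> \<le> W y - W x"
    if "c \<le> x" "x \<le> y" "y \<le> d" for x y
    using W_le[OF that] abs_Re_le_cmod[of "f y - f x"] abs_Im_le_cmod[of "f y - f x"] by simp_all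
  have "\<exists>g. g absolutely_integrable_on {c..d} \<and> (\<forall>x\<in>{c..d}. W x - W c = integral {c..x} g)"
    by (rule dominated) (use Re_le in force)
  moreover have "\<exists>g. g absolutely_integrable_on {c..d} \<and>
      (\<forall>x\<in>{c..d}. (W x - Re (f x)) - (W c - Re (f c)) = integral {c..x} g)"
    by (rule dominated) (use Re_le in force)
  moreover have "\<exists>g. g absolutely_integrable_on {c..d} \<and>
      (\<forall>x\<in>{c..d}. (W x - Im (f x)) - (W c - Im (f c)) = integral {c..x} g)"
    by (rule dominated) (use Im_le in force)
  ultimately obtain w u v where w: "w absolutely_integrable_on {c..d}"
      "\<And>x. x \<in> {c..d} \<Longrightarrow> W x - W c = integral {c..x} w"
    and u: "u absolutely_integrable_on {c..d}"
      "\<And>x. x \<in> {c..d} \<Longrightarrow> (W x - Re (f x)) - (W c - Re (f c)) = integral {c..x} u"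
    and v: "v absolutely_integrable_on {c..d}"
      "\<And>x. x \<in> {c..d} \<Longrightarrow> (W x - Im (f x)) - (W c - Im (f c)) = integral {c..x} v"
    by metis
  define g where "g x = complex_of_real (w x - u x) + \<i> * complex_of_real (w x - v x)" for x
  have of_real: "(\<lambda>x. complex_of_real (k x)) absolutely_integrable_on {c..d}"
    if "k absolutely_integrable_on {c..d}" for k :: "real \<Rightarrow> real"
    using absolutely_integrable_linear[OF that bounded_linear_of_real] by (simp add: o_def)
  show thesis
  proof
    show "g absolutely_integrable_on {c..d}"
      unfolding g_def
      by (intro set_integral_add(1) set_integrable_mult_right of_real set_integral_diff(1) u v w)
    show "f x - f c = integral {c..x} g" if x: "x \<in> {c..d}" for x
    proof -
      have int: "k integrable_on {c..x}" if "k absolutely_integrable_on {c..d}" for k :: "real \<Rightarrow> real"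
        using integrable_on_subinterval[OF absolutely_integrable_on_def[THEN iffD1, OF that, THEN conjunct1]]
          x by simp
      have hi: "(k has_integral integral {c..x} k) {c..x}" if "k absolutely_integrable_on {c..d}" for k :: "real \<Rightarrow> real"
        using int[OF that] by (simp add: integrable_integral)
      have "((\<lambda>x. complex_of_real (w x - u x) + \<i> * complex_of_real (w x - v x)) has_integral
          (complex_of_real (integral {c..x} w - integral {c..x} u) + \<i> * complex_of_real (integral {c..x} w - integral {c..x} v))) {c..x}"
        by (intro has_integral_add has_integral_mult_right has_integral_of_real has_integral_diff hi u v w)
      then have "integral {c..x} g =
          complex_of_real (integral {c..x} w - integral {c..x} u) + \<i> * complex_of_real (integral {c..x} w - integral {c..x} v)"
        unfolding g_def by (rule integral_unique)
      also have "\<dots> = f x - f c"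
        unfolding w(2)[OF x, symmetric] u(2)[OF x, symmetric] v(2)[OF x, symmetric]
        by (simp add: complex_eq_iff)
      finally show ?thesis by simp
    qed
  qed
qed

section \<open>Indefinite integrals: differentiability and absolute continuity\<close>

text \<open>
  Averages over intervals to the right of a point converge almost everywhere by
  \<open>integrable_ccontinuous_explicit\<close>; averages to the left are reduced to them by reflection.
\<close>
lemma lebesgue_differentiation:
  fixes f :: "real \<Rightarrow> complex"
  assumes f: "f integrable_on {c..d}"
  obtains N where "negligible N"
    "\<And>x. x \<in> {c<..<d} - N \<Longrightarrow> ((\<lambda>y. integral {c..y} f) has_vector_derivative f x) (at x)"
proof -
  define g where "g x = (if x \<in> {c..d} then f x else 0)" for x
  have g_int: "g integrable_on cbox u v" for u v
  proof (rule integrable_on_subcbox)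
    show "g integrable_on UNIV"
      unfolding g_def using f by (simp only: integrable_restrict_UNIV)
  qed auto
  have gr_int: "(\<lambda>x. g (- x)) integrable_on cbox u v" for u v :: real
    using g_int[of "-v" "-u"] integrable_reflect[of g "-u" "-v"] by simp
  obtain N1 where N1: "negligible N1" "\<And>x e. x \<notin> N1 \<Longrightarrow> 0 < e \<Longrightarrow>
      \<exists>r>0. \<forall>h. 0 < h \<and> h < r \<longrightarrow> norm (integral {x..x + h} g /\<^sub>R h - g x) < e"
    using integrable_ccontinuous_explicit[OF g_int] by (simp add: cbox_interval) blast
  obtain N2 where N2: "negligible N2" "\<And>x e. x \<notin> N2 \<Longrightarrow> 0 < e \<Longrightarrow>
      \<exists>r>0. \<forall>h. 0 < h \<and> h < r \<longrightarrow> norm (integral {x..x + h} (\<lambda>x. g (- x)) /\<^sub>R h - g (- x)) < e"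
    using integrable_ccontinuous_explicit[OF gr_int] by (simp add: cbox_interval) blast
  show thesis
  proof
    show "negligible (N1 \<union> uminus ` N2)"
      using N1(1) N2(1)
      by (intro negligible_Un negligible_differentiable_image_negligible)
        (auto intro!: derivative_intros simp: differentiable_on_def)
    fix x assume x: "x \<in> {c<..<d} - (N1 \<union> uminus ` N2)"
    let ?F = "\<lambda>y. integral {c..y} f"
    have F: "?F v - ?F u = integral {u..v} g" if "c \<le> u" "u \<le> v" "v \<le> d" for u v
    proof -
      have "f integrable_on {c..v}" using integrable_on_subinterval[OF f] that by auto
      then have "?F v = ?F u + integral {u..v} f"
        using Henstock_Kurzweil_Integration.integral_combine[of c u v f] that by simp
      also have "integral {u..v} f = integral {u..v} g"
        using that by (intro integral_cong) (auto simp: g_def)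
      finally show ?thesis by simp
    qed
    have scale: "norm (I - h *\<^sub>R w) \<le> e * h" if "norm (I /\<^sub>R h - w) < e" "h > 0"
      for I w :: complex and h e :: real
    proof -
      have "I - h *\<^sub>R w = h *\<^sub>R (I /\<^sub>R h - w)"
        using that(2) by (simp add: scaleR_right_diff_distrib)
      then have "norm (I - h *\<^sub>R w) = h * norm (I /\<^sub>R h - w)"
        using that(2) by (metis abs_of_pos norm_scaleR)
      then show ?thesis using that by (simp add: mult.commute)
    qed
    show "(?F has_vector_derivative f x) (at x)"
      unfolding has_vector_derivative_def has_derivative_within_alt
    proof (intro conjI allI impI)
      show "bounded_linear (\<lambda>h. h *\<^sub>R f x)" by (rule bounded_linear_scaleR_left)
      fix e :: real assume "0 < e"
      have "- x \<notin> N2" using x by force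
      obtain r1 where r1: "r1 > 0" "\<And>h. 0 < h \<Longrightarrow> h < r1 \<Longrightarrow> norm (integral {x..x + h} g /\<^sub>R h - g x) < e"
        using N1(2)[of x e] x \<open>0 < e\<close> by blast
      obtain r2 where r2: "r2 > 0" "\<And>h. 0 < h \<Longrightarrow> h < r2 \<Longrightarrow>
          norm (integral {- x..- x + h} (\<lambda>x. g (- x)) /\<^sub>R h - g x) < e"
        using N2(2)[OF \<open>- x \<notin> N2\<close> \<open>0 < e\<close>] by auto
      define r where "r = Min {r1, r2, x - c, d - x}"
      have r: "r > 0" "r \<le> r1" "r \<le> r2" "r \<le> x - c" "r \<le> d - x"
        unfolding r_def using r1(1) r2(1) x by auto
      have gx: "g x = f x" using x by (auto simp: g_def)
      have "norm (?F y - ?F x - (y - x) *\<^sub>R f x) \<le> e * norm (y - x)" if y: "norm (y - x) < r" for y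
      proof (cases x y rule: linorder_cases)
        case less
        have "norm (integral {x..y} g - (y - x) *\<^sub>R g x) \<le> e * (y - x)"
          using r1(2)[of "y - x"] less y r by (intro scale) auto
        then show ?thesis using F[of x y] less x y r gx by auto
      next
        case greater
        have "integral {- x..- x + (x - y)} (\<lambda>x. g (- x)) = integral {y..x} g"
          using Henstock_Kurzweil_Integration.integral_reflect_real[of x y g] by simp
        then have "norm (integral {y..x} g - (x - y) *\<^sub>R g x) \<le> e * (x - y)"
          using r2(2)[of "x - y"] greater y r by (intro scale) auto
        moreover have "?F y - ?F x - (y - x) *\<^sub>R f x = - (integral {y..x} g - (x - y) *\<^sub>R g x)"
          using F[of y x] greater x y r gx by (auto simp: algebra_simps)
        ultimately show ?thesis using greater by (metis norm_minus_cancel abs_of_neg diff_less_0_iff_less minus_diff_eq real_norm_def)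
      qed simp
      then show "\<exists>d>0. \<forall>y\<in>UNIV. norm (y - x) < d \<longrightarrow>
          norm (?F y - ?F x - (y - x) *\<^sub>R f x) \<le> e * norm (y - x)" using r(1) by blast
    qed
  qed
qed

text \<open>
  Cut off the integrand at a height n: what lies above has a small integral, and what lies below
  contributes at most n times the total length of the intervals.
\<close>
lemma integral_imp_abs_cont_on:
  assumes g: "g absolutely_integrable_on {c..d}"
    and f: "\<And>s t. c \<le> s \<Longrightarrow> s \<le> t \<Longrightarrow> t \<le> d \<Longrightarrow> f t - f s = integral {s..t} g"
  shows "abs_cont_on c d f"
  unfolding abs_cont_on_iff_variation
proof (intro allI impI)
  fix \<epsilon> :: real assume "\<epsilon> > 0"
  let ?m = "\<lambda>n x. min (cmod (g x)) (real n)"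
  let ?k = "\<lambda>n x. cmod (g x) - ?m n x"
  have ng: "(\<lambda>x. cmod (g x)) absolutely_integrable_on {c..d}"
    using g by (rule set_integrable_norm)
  have m: "?m n absolutely_integrable_on {c..d}" for n
    using ng by (intro absolutely_integrable_min_1) (auto intro: absolutely_integrable_on_const)
  have k: "?k n absolutely_integrable_on {c..d}" for n
    using ng m by (rule set_integral_diff)
  have "(\<lambda>n. integral {c..d} (?k n)) \<longlonglongrightarrow> integral {c..d} (\<lambda>x. 0)"
  proof (rule dominated_convergence(2))
    show "?k n integrable_on {c..d}" for n using k by (simp add: absolutely_integrable_on_def)
    show "(\<lambda>x. cmod (g x)) integrable_on {c..d}" using ng by (simp add: absolutely_integrable_on_def)
    show "(\<lambda>n. ?k n x) \<longlonglongrightarrow> 0" for x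
    proof (rule tendsto_eventually)
      obtain n0 :: nat where "cmod (g x) \<le> real n0" using real_arch_simple by blast
      then show "eventually (\<lambda>n. ?k n x = 0) sequentially"
        by (intro eventually_sequentiallyI[of n0]) (auto simp: min_def)
    qed
  qed auto
  then have "(\<lambda>n. integral {c..d} (?k n)) \<longlonglongrightarrow> 0" by simp
  then have "eventually (\<lambda>n. integral {c..d} (?k n) < \<epsilon>/2) sequentially"
    using \<open>\<epsilon> > 0\<close> by (intro order_tendstoD(2)) auto
  then obtain n where n: "integral {c..d} (?k n) < \<epsilon>/2"
    using eventually_happens'[OF sequentially_bot] by blast
  define \<delta> where "\<delta> = \<epsilon> / (2 * (real n + 1))"
  have "\<delta> > 0" using \<open>\<epsilon> > 0\<close> by (simp add: \<delta>_def)
  have "variation f D < \<epsilon>" if D: "nonoverlapping c d D" and len: "(\<Sum>(s, t)\<in>D. t - s) < \<delta>" for D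
  proof -
    have sub: "{fst i..snd i} \<subseteq> {c..d}" if "i \<in> D" for i using nonoverlapping_bounds[OF D that] by auto
    have int: "h integrable_on {fst i..snd i}" if "i \<in> D" "h absolutely_integrable_on {c..d}"
      for i and h :: "real \<Rightarrow> real"
      using that sub integrable_on_subinterval[of h "{c..d}"] by (auto simp: absolutely_integrable_on_def)
    have "variation f D \<le> (\<Sum>i\<in>D. integral {fst i..snd i} (?k n) + real n * (snd i - fst i))"
      unfolding variation_def
    proof (rule sum_mono)
      fix i assume i: "i \<in> D"
      note b = nonoverlapping_bounds[OF D i]
      have "g integrable_on {fst i..snd i}"
        using g sub[OF i] integrable_on_subinterval[of g "{c..d}"] by (auto simp: absolutely_integrable_on_def)
      then have "cmod (integral {fst i..snd i} g) \<le> integral {fst i..snd i} (\<lambda>x. cmod (g x))"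
        by (rule integral_norm_bound_integral) (use int[OF i ng] in auto)
      also have "\<dots> = integral {fst i..snd i} (\<lambda>x. ?k n x + ?m n x)" by simp
      also have "\<dots> = integral {fst i..snd i} (?k n) + integral {fst i..snd i} (?m n)"
        by (rule integral_add[OF int[OF i k] int[OF i m]])
      also have "integral {fst i..snd i} (?m n) \<le> integral {fst i..snd i} (\<lambda>x. real n)"
        by (rule integral_le[OF int[OF i m]]) auto
      also have "\<dots> = real n * (snd i - fst i)" using b by (simp add: mult.commute)
      finally show "(case i of (s, t) \<Rightarrow> cmod (f t - f s)) \<le> integral {fst i..snd i} (?k n) + real n * (snd i - fst i)"
        using f[of "fst i" "snd i"] b by (simp add: case_prod_beta)
    qed
    also have "\<dots> = (\<Sum>i\<in>D. integral {fst i..snd i} (?k n)) + real n * (\<Sum>(s, t)\<in>D. t - s)"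
      by (simp add: sum.distrib sum_distrib_left case_prod_beta)
    also have "(\<Sum>i\<in>D. integral {fst i..snd i} (?k n)) \<le> integral {c..d} (?k n)"
    proof -
      let ?I = "\<lambda>i :: real \<times> real. {fst i<..<snd i}"
      have kI: "?k n absolutely_integrable_on ?I i" if "i \<in> D" for i
        by (rule set_integrable_subset[OF k]) (use sub[OF that] in auto)
      have U: "(\<Union>i\<in>D. ?I i) \<in> sets lebesgue" "(\<Union>i\<in>D. ?I i) \<subseteq> {c..d}"
        using nonoverlapping_finite[OF D] sub by (auto intro!: sets.finite_UN) force+
      have kU: "?k n absolutely_integrable_on (\<Union>i\<in>D. ?I i)"
        using k U by (rule set_integrable_subset)
      have disj: "disjoint_family_on ?I D"
        using D unfolding nonoverlapping_def disjoint_family_on_def by (simp add: case_prod_beta)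
      have "(\<Sum>i\<in>D. integral {fst i..snd i} (?k n)) = (\<Sum>i\<in>D. LINT x:?I i|lebesgue. ?k n x)"
      proof (rule sum.cong[OF refl])
        fix i assume "i \<in> D"
        then show "integral {fst i..snd i} (?k n) = (LINT x:?I i|lebesgue. ?k n x)"
          by (rule trans[OF integral_open_interval_real set_lebesgue_integral_eq_integral(2)[OF kI, symmetric]])
      qed
      also have "\<dots> = (LINT x:(\<Union>i\<in>D. ?I i)|lebesgue. ?k n x)"
        by (rule set_integral_finite_Union[symmetric, OF nonoverlapping_finite[OF D] disj kI]) auto
      also have "\<dots> = integral (\<Union>i\<in>D. ?I i) (?k n)"
        by (rule set_lebesgue_integral_eq_integral(2)[OF kU])
      also have "\<dots> \<le> integral {c..d} (?k n)"
        using kU k[of n] U(2) by (intro integral_subset_le) (auto simp: absolutely_integrable_on_def)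
      finally show ?thesis .
    qed
    also have "real n * (\<Sum>(s, t)\<in>D. t - s) \<le> real n * \<delta>" using len by (intro mult_left_mono) auto
    also have "real n * \<delta> \<le> \<epsilon>/2" using \<open>\<epsilon> > 0\<close> by (simp add: \<delta>_def field_simps)
    finally show ?thesis using n by linarith
  qed
  then show "\<exists>\<delta>>0. \<forall>D. nonoverlapping c d D \<and> (\<Sum>(s, t)\<in>D. t - s) < \<delta> \<longrightarrow> variation f D < \<epsilon>"
    using \<open>\<delta> > 0\<close> by blast
qed

section \<open>Primitives on an open interval\<close>

text \<open>
  ``f is locally absolutely continuous and \<open>f' = g\<close> almost everywhere'', stated through integrals:
  in this form the notion passes to limits without differentiating, and g matters only up to null sets.
\<close>
definition primitive :: "ereal \<Rightarrow> ereal \<Rightarrow> (real \<Rightarrow> complex) \<Rightarrow> (real \<Rightarrow> complex) \<Rightarrow> bool" where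
  "primitive a b f g \<longleftrightarrow> (\<forall>c d. c \<le> d \<and> {c..d} \<subseteq> einterval a b \<longrightarrow>
     g absolutely_integrable_on {c..d} \<and> f d - f c = integral {c..d} g)"

definition locally_integrable :: "ereal \<Rightarrow> ereal \<Rightarrow> (real \<Rightarrow> complex) \<Rightarrow> bool" where
  "locally_integrable a b g \<longleftrightarrow> (\<forall>c d. {c..d} \<subseteq> einterval a b \<longrightarrow> g absolutely_integrable_on {c..d})"

lemma Icc_subset_einterval:
  assumes "x \<in> einterval a b" "y \<in> einterval a b"
  shows "{x..y} \<subseteq> einterval a b"
  using assms by (auto simp: einterval_iff) (meson ereal_less_eq(3) le_less_trans less_le_trans)+

lemma AE_einterval_iff:
  "(AE x in lebesgue_on (einterval a b). P x) \<longleftrightarrow> (\<exists>N. negligible N \<and> (\<forall>x\<in>einterval a b - N. P x))"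
proof -
  have "(AE x in lebesgue_on (einterval a b). P x) \<longleftrightarrow> (AE x in lebesgue. x \<in> einterval a b \<longrightarrow> P x)"
    by (rule AE_restrict_space_iff) simp
  then show ?thesis unfolding eventually_ae_filter_negligible by blast
qed

lemma primitiveD:
  assumes "primitive a b f g" "x \<in> einterval a b" "y \<in> einterval a b" "x \<le> y"
  shows "g absolutely_integrable_on {x..y}" "g integrable_on {x..y}" "f y - f x = integral {x..y} g"
  using assms Icc_subset_einterval[OF assms(2,3)] set_lebesgue_integral_eq_integral(1)[of "{x..y}" g]
  unfolding primitive_def by blast+

lemma primitiveI:
  assumes "\<And>x y. x \<in> einterval a b \<Longrightarrow> y \<in> einterval a b \<Longrightarrow> x \<le> y \<Longrightarrow>
     g absolutely_integrable_on {x..y} \<and> f y - f x = integral {x..y} g"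
  shows "primitive a b f g"
  using assms unfolding primitive_def by (auto simp: subset_iff)

lemma locally_integrableD:
  assumes "locally_integrable a b g" "x \<in> einterval a b" "y \<in> einterval a b"
  shows "g absolutely_integrable_on {x..y}" "g integrable_on {x..y}"
  using assms Icc_subset_einterval[OF assms(2,3)] set_lebesgue_integral_eq_integral(1)[of "{x..y}" g]
  unfolding locally_integrable_def by blast+

lemma primitive_AC_loc:
  assumes "primitive a b f g" shows "f \<in> AC_loc a b"
  unfolding AC_loc_def
proof (intro CollectI allI impI)
  fix c d :: real assume cd: "c \<le> d \<and> {c..d} \<subseteq> einterval a b"
  then have "c \<in> einterval a b" "d \<in> einterval a b" by auto
  show "abs_cont_on c d f"
  proof (rule integral_imp_abs_cont_on)
    show "g absolutely_integrable_on {c..d}" using assms cd unfolding primitive_def by blast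
    show "f t - f s = integral {s..t} g" if "c \<le> s" "s \<le> t" "t \<le> d" for s t
      using that cd by (intro primitiveD(3)[OF assms]) auto
  qed
qed

text \<open>
  Intervals with rational endpoints suffice to cover (a, b), so that the union of their exceptional
  sets is still a null set.
\<close>
lemma primitive_has_vector_derivative:
  assumes "primitive a b f g"
  shows "AE x in lebesgue_on (einterval a b). (f has_vector_derivative g x) (at x)"
proof -
  have "\<exists>N. negligible N \<and> (\<forall>x\<in>{u<..<v} - N. (f has_vector_derivative g x) (at x))"
    if uv: "{u..v} \<subseteq> einterval a b" for u v :: real
  proof (cases "u \<le> v")
    case True
    then have mem: "u \<in> einterval a b" "v \<in> einterval a b" using uv by auto
    obtain N where N: "negligible N"
      "\<And>x. x \<in> {u<..<v} - N \<Longrightarrow> ((\<lambda>y. integral {u..y} g) has_vector_derivative g x) (at x)"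
      using lebesgue_differentiation[OF primitiveD(2)[OF assms mem True]] by blast
    have "(f has_vector_derivative g x) (at x)" if x: "x \<in> {u<..<v} - N" for x
    proof -
      have "((\<lambda>y. integral {u..y} g + f u) has_vector_derivative g x) (at x)"
        unfolding has_vector_derivative_add_const by (rule N(2)[OF x])
      moreover have "integral {u..y} g + f u = f y" if "y \<in> {u<..<v}" for y
      proof -
        have "y \<in> einterval a b" "u \<le> y" using that uv by (simp_all add: subset_iff)
        from primitiveD(3)[OF assms mem(1) this] show ?thesis by (metis add.commute diff_add_cancel)
      qed
      ultimately show ?thesis
        using x by (elim has_vector_derivative_transform_within_open[where S = "{u<..<v}" and g = f]) simp_all
    qed
    then show ?thesis using N(1) by blast
  qed (auto intro!: exI[of _ "{}"])
  then obtain N where N: "\<And>u v. {u..v} \<subseteq> einterval a b \<Longrightarrow> negligible (N u v)"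
    "\<And>u v x. {u..v} \<subseteq> einterval a b \<Longrightarrow> x \<in> {u<..<v} - N u v \<Longrightarrow> (f has_vector_derivative g x) (at x)"
    by metis
  define NN where "NN = (\<Union>u\<in>\<rat>. \<Union>v\<in>\<rat>. if {u..v} \<subseteq> einterval a b then N u v else {})"
  have "negligible NN"
    unfolding NN_def
    by (intro negligible_countable_Union countable_image countable_rat; (clarify)?)+
      (auto intro: N(1))
  moreover have "(f has_vector_derivative g x) (at x)" if x: "x \<in> einterval a b - NN" for x
  proof -
    obtain e where e: "e > 0" "\<And>y. dist y x < e \<Longrightarrow> y \<in> einterval a b"
      using x open_einterval[of a b] unfolding open_dist by blast
    obtain u where u: "u \<in> \<rat>" "x - e < u" "u < x" using Rats_dense_in_real[of "x - e" x] e(1) by auto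
    obtain v where v: "v \<in> \<rat>" "x < v" "v < x + e" using Rats_dense_in_real[of x "x + e"] e(1) by auto
    have "{u..v} \<subseteq> einterval a b" using u v by (auto intro!: e(2) simp: dist_real_def)
    moreover from this have "x \<notin> N u v" using x u(1) v(1) unfolding NN_def by auto
    ultimately show ?thesis using N(2)[of u v x] u v by auto
  qed
  ultimately show ?thesis unfolding AE_einterval_iff by blast
qed

lemma primitive_cong_AE:
  assumes "primitive a b f g" "AE x in lebesgue_on (einterval a b). g x = g' x"
  shows "primitive a b f g'"
proof (rule primitiveI)
  obtain N where N: "negligible N" "\<And>x. x \<in> einterval a b - N \<Longrightarrow> g x = g' x"
    using assms(2) unfolding AE_einterval_iff by blast
  fix x y assume xy: "x \<in> einterval a b" "y \<in> einterval a b" "x \<le> y"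
  have sub: "g' t = g t" if "t \<in> {x..y} - N" for t
    using N(2)[of t] Icc_subset_einterval[OF xy(1,2)] that by auto
  show "g' absolutely_integrable_on {x..y} \<and> f y - f x = integral {x..y} g'"
    using absolutely_integrable_spike[OF primitiveD(1)[OF assms(1) xy] N(1) sub]
      primitiveD(3)[OF assms(1) xy] integral_spike[OF N(1), of "{x..y}" g' g, OF sub] by simp
qed

lemma primitive_cong:
  assumes "primitive a b f g" "\<And>x. x \<in> einterval a b \<Longrightarrow> f x = f' x" "\<And>x. x \<in> einterval a b \<Longrightarrow> g x = g' x"
  shows "primitive a b f' g'"
proof -
  have "primitive a b f g'"
    by (rule primitive_cong_AE[OF assms(1)]) (use assms(3) in \<open>auto simp: AE_einterval_iff intro: exI[of _ "{}"]\<close>)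
  then show ?thesis by (intro primitiveI) (use assms(2) primitiveD in metis)
qed

lemma primitive_unique_AE:
  assumes "primitive a b f g" "primitive a b f g'"
  shows "AE x in lebesgue_on (einterval a b). g x = g' x"
  using primitive_has_vector_derivative[OF assms(1)] primitive_has_vector_derivative[OF assms(2)]
  by eventually_elim (rule vector_derivative_unique_at)

text \<open>
  Conversely every function in \<open>AC_loc\<close> is a primitive of its pointwise derivative, whose default value
  at points of non-differentiability matters only on a null set.
\<close>
lemma AC_loc_primitive:
  assumes "f \<in> AC_loc a b"
  shows "primitive a b f (\<lambda>x. vector_derivative f (at x))"
proof (rule primitiveI)
  fix u v assume uv: "u \<in> einterval a b" "v \<in> einterval a b" "u \<le> v"
  have "abs_cont_on u v f"
    using assms uv Icc_subset_einterval unfolding AC_loc_def by blast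
  then obtain g where g: "g absolutely_integrable_on {u..v}"
    "\<And>x. x \<in> {u..v} \<Longrightarrow> f x - f u = integral {u..x} g"
    using abs_cont_on_imp_integral[OF _ uv(3)] by blast
  obtain N where N: "negligible N"
      "\<And>x. x \<in> {u<..<v} - N \<Longrightarrow> ((\<lambda>y. integral {u..y} g) has_vector_derivative g x) (at x)"
    using lebesgue_differentiation[OF set_lebesgue_integral_eq_integral(1)[OF g(1)]] by blast
  have eq: "vector_derivative f (at x) = g x" if x: "x \<in> {u..v} - (N \<union> {u, v})" for x
  proof -
    have x': "x \<in> {u<..<v} - N" using x by (simp add: order_less_le)
    have "((\<lambda>y. integral {u..y} g + f u) has_vector_derivative g x) (at x)"
      unfolding has_vector_derivative_add_const by (rule N(2)[OF x'])
    moreover have "integral {u..y} g + f u = f y" if "y \<in> {u<..<v}" for y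
    proof -
      have "y \<in> {u..v}" using that by simp
      from g(2)[OF this] show ?thesis by (metis add.commute diff_add_cancel)
    qed
    ultimately have "(f has_vector_derivative g x) (at x)"
      using x' by (elim has_vector_derivative_transform_within_open[where S = "{u<..<v}" and g = f]) simp_all
    then show ?thesis by (rule vector_derivative_at)
  qed
  have neg: "negligible (N \<union> {u, v})" using N(1) by auto
  show "(\<lambda>x. vector_derivative f (at x)) absolutely_integrable_on {u..v} \<and>
      f v - f u = integral {u..v} (\<lambda>x. vector_derivative f (at x))"
    using absolutely_integrable_spike[OF g(1) neg eq] integral_spike[OF neg, of "{u..v}" "\<lambda>x. vector_derivative f (at x)" g, OF eq]
      g(2)[of v] uv(3) by simp
qed

lemma primitive_linear:
  assumes L: "bounded_linear L" and "primitive a b f g"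
  shows "primitive a b (\<lambda>x. L (f x)) (\<lambda>x. L (g x))"
proof (rule primitiveI, intro conjI)
  fix x y assume xy: "x \<in> einterval a b" "y \<in> einterval a b" "x \<le> y"
  note P = primitiveD[OF assms(2) xy]
  show "(\<lambda>x. L (g x)) absolutely_integrable_on {x..y}"
    using absolutely_integrable_linear[OF P(1) L] by (simp add: o_def)
  show "L (f y) - L (f x) = integral {x..y} (\<lambda>x. L (g x))"
    using integral_linear[OF P(2) L] P(3) by (simp add: o_def bounded_linear.linear[OF L] flip: linear_diff)
qed

lemma primitive_cmult: "primitive a b f g \<Longrightarrow> primitive a b (\<lambda>x. k * f x) (\<lambda>x. k * g x)"
  by (rule primitive_linear[OF bounded_linear_mult_right])

lemma primitive_cnj: "primitive a b f g \<Longrightarrow> primitive a b (\<lambda>x. cnj (f x)) (\<lambda>x. cnj (g x))"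
  by (rule primitive_linear[OF bounded_linear_cnj])

lemma primitive_add:
  assumes "primitive a b f g" "primitive a b f' g'"
  shows "primitive a b (\<lambda>x. f x + f' x) (\<lambda>x. g x + g' x)"
proof (rule primitiveI, intro conjI)
  fix x y assume xy: "x \<in> einterval a b" "y \<in> einterval a b" "x \<le> y"
  note P = primitiveD[OF assms(1) xy] and Q = primitiveD[OF assms(2) xy]
  show "(\<lambda>x. g x + g' x) absolutely_integrable_on {x..y}" using P Q by (intro set_integral_add)
  show "f y + f' y - (f x + f' x) = integral {x..y} (\<lambda>x. g x + g' x)"
    using P(3) Q(3) by (simp add: integral_add[OF P(2) Q(2)] algebra_simps)
qed

lemma primitive_diff:
  assumes "primitive a b f g" "primitive a b f' g'"
  shows "primitive a b (\<lambda>x. f x - f' x) (\<lambda>x. g x - g' x)"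
  using primitive_add[OF assms(1) primitive_cmult[OF assms(2), of "-1"]] by simp

lemma primitive_const: "primitive a b (\<lambda>x. k) (\<lambda>x. 0)"
  by (rule primitiveI) auto

lemma primitive_continuous_on:
  assumes "primitive a b f g" shows "continuous_on (einterval a b) f"
proof (rule continuous_at_imp_continuous_on, rule ballI)
  fix x assume x: "x \<in> einterval a b"
  obtain e where e: "e > 0" "\<And>y. dist y x < e \<Longrightarrow> y \<in> einterval a b"
    using x open_einterval[of a b] unfolding open_dist by blast
  define u v where "u = x - e/2" and "v = x + e/2"
  have uv: "u \<in> einterval a b" "v \<in> einterval a b" "u \<le> v" "x \<in> {u<..<v}"
    using e by (auto intro!: e(2) simp: dist_real_def u_def v_def)
  have "continuous_on {u..v} (\<lambda>y. integral {u..y} g + f u)"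
    by (intro continuous_intros indefinite_integral_continuous_1 primitiveD(2)[OF assms uv(1-3)])
  then have "continuous_on {u..v} f"
  proof (rule continuous_on_eq)
    fix y assume y: "y \<in> {u..v}"
    then have "y \<in> einterval a b" "u \<le> y" using Icc_subset_einterval[OF uv(1,2)] by auto
    from primitiveD(3)[OF assms uv(1) this] show "integral {u..y} g + f u = f y"
      by (metis add.commute diff_add_cancel)
  qed
  then show "isCont f x"
    using uv(4) by (intro continuous_on_interior[of "{u..v}"]) auto
qed

lemma abs_cont_on_dominated:
  assumes f: "abs_cont_on c d f" and f': "abs_cont_on c d f'" and "B > 0"
    and h: "\<And>s t. c \<le> s \<Longrightarrow> s \<le> t \<Longrightarrow> t \<le> d \<Longrightarrow>
      cmod (h t - h s) \<le> B * (cmod (f t - f s) + cmod (f' t - f' s))"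
  shows "abs_cont_on c d h"
  unfolding abs_cont_on_iff_variation
proof (intro allI impI)
  fix \<epsilon> :: real assume "\<epsilon> > 0"
  then have "\<epsilon> / (2 * B) > 0" using \<open>B > 0\<close> by simp
  with f f' obtain \<delta> \<delta>' where \<delta>: "\<delta> > 0" "\<delta>' > 0"
    "\<And>D. nonoverlapping c d D \<Longrightarrow> (\<Sum>(s, t)\<in>D. t - s) < \<delta> \<Longrightarrow> variation f D < \<epsilon> / (2 * B)"
    "\<And>D. nonoverlapping c d D \<Longrightarrow> (\<Sum>(s, t)\<in>D. t - s) < \<delta>' \<Longrightarrow> variation f' D < \<epsilon> / (2 * B)"
    unfolding abs_cont_on_iff_variation by metis
  have "variation h D < \<epsilon>" if D: "nonoverlapping c d D" "(\<Sum>(s, t)\<in>D. t - s) < min \<delta> \<delta>'" for D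
  proof -
    have "variation h D \<le> B * (variation f D + variation f' D)"
      unfolding variation_def sum.distrib[symmetric] sum_distrib_left
      by (intro sum_mono) (use h nonoverlapping_bounds[OF D(1)] in \<open>auto simp: case_prod_beta\<close>)
    also have "\<dots> < B * (\<epsilon> / (2 * B) + \<epsilon> / (2 * B))"
      using \<delta>(3,4)[OF D(1)] D(2) \<open>B > 0\<close> by (intro mult_strict_left_mono add_strict_mono) auto
    also have "\<dots> = \<epsilon>" using \<open>B > 0\<close> by (simp add: field_simps)
    finally show ?thesis .
  qed
  then show "\<exists>\<delta>>0. \<forall>D. nonoverlapping c d D \<and> (\<Sum>(s, t)\<in>D. t - s) < \<delta> \<longrightarrow> variation h D < \<epsilon>"
    using \<delta>(1,2) by (intro exI[of _ "min \<delta> \<delta>'"]) auto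
qed

lemma primitive_bounded:
  assumes "primitive a b f g" "{c..d} \<subseteq> einterval a b"
  obtains B where "B > 0" "\<And>x. x \<in> {c..d} \<Longrightarrow> cmod (f x) \<le> B"
proof -
  have "compact (f ` {c..d})"
    using continuous_on_subset[OF primitive_continuous_on[OF assms(1)] assms(2)]
    by (intro compact_continuous_image) auto
  then have "bounded (f ` {c..d})" by (rule compact_imp_bounded)
  then show thesis using that unfolding bounded_pos by auto
qed

text \<open>
  The product is absolutely continuous, hence a primitive of its own derivative, and the latter is
  given almost everywhere by the product rule.
\<close>
lemma primitive_mult:
  assumes f: "primitive a b f g" and f': "primitive a b f' g'"
  shows "primitive a b (\<lambda>x. f x * f' x) (\<lambda>x. g x * f' x + f x * g' x)"
proof -
  let ?h = "\<lambda>x. f x * f' x"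
  have "?h \<in> AC_loc a b"
    unfolding AC_loc_def
  proof (intro CollectI allI impI)
    fix c d :: real assume cd: "c \<le> d \<and> {c..d} \<subseteq> einterval a b"
    obtain B where B: "B > 0" "\<And>x. x \<in> {c..d} \<Longrightarrow> cmod (f x) \<le> B"
      using primitive_bounded[OF f] cd by blast
    obtain B' where B': "B' > 0" "\<And>x. x \<in> {c..d} \<Longrightarrow> cmod (f' x) \<le> B'"
      using primitive_bounded[OF f'] cd by blast
    show "abs_cont_on c d ?h"
    proof (rule abs_cont_on_dominated[of c d f f' "B + B'"])
      show "abs_cont_on c d f" "abs_cont_on c d f'"
        using primitive_AC_loc[OF f] primitive_AC_loc[OF f'] cd by (auto simp: AC_loc_def)
      fix s t assume st: "c \<le> s" "s \<le> t" "t \<le> d"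
      have "?h t - ?h s = (f t - f s) * f' t + f s * (f' t - f' s)" by (simp add: algebra_simps)
      also have "cmod \<dots> \<le> cmod (f t - f s) * cmod (f' t) + cmod (f s) * cmod (f' t - f' s)"
        by (metis norm_mult norm_triangle_ineq)
      also have "\<dots> \<le> cmod (f t - f s) * (B + B') + (B + B') * cmod (f' t - f' s)"
        using B(2)[of s] B'(2)[of t] B(1) B'(1) st
        by (intro add_mono mult_left_mono mult_right_mono) auto
      finally show "cmod (?h t - ?h s) \<le> (B + B') * (cmod (f t - f s) + cmod (f' t - f' s))"
        by (simp add: algebra_simps)
    qed (use B(1) B'(1) in auto)
  qed
  then have "primitive a b ?h (\<lambda>x. vector_derivative ?h (at x))" by (rule AC_loc_primitive)
  moreover have "AE x in lebesgue_on (einterval a b). vector_derivative ?h (at x) = g x * f' x + f x * g' x"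
    using primitive_has_vector_derivative[OF f] primitive_has_vector_derivative[OF f']
  proof eventually_elim
    case (elim x)
    show ?case
      using vector_derivative_at[OF has_vector_derivative_mult[OF elim]] by (simp add: algebra_simps)
  qed
  ultimately show ?thesis by (rule primitive_cong_AE)
qed

lemma primitive_exists:
  assumes g: "locally_integrable a b g" and c0: "c0 \<in> einterval a b"
  obtains f where "f c0 = v" "primitive a b f g"
proof -
  \<comment> \<open>For every x one of the two integrals is over an empty or degenerate interval and vanishes.\<close>
  let ?f = "\<lambda>x. v + integral {c0..x} g - integral {x..c0} g"
  have "primitive a b ?f g"
  proof (rule primitiveI, intro conjI)
    fix x y assume xy: "x \<in> einterval a b" "y \<in> einterval a b" "x \<le> y"
    show "g absolutely_integrable_on {x..y}" using locally_integrableD(1)[OF g xy(1,2)] .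
    note int = locally_integrableD(2)[OF g]
    note comb = Henstock_Kurzweil_Integration.integral_combine
    consider "c0 \<le> x" | "x \<le> c0" "c0 \<le> y" | "y \<le> c0" by linarith
    then show "?f y - ?f x = integral {x..y} g"
    proof cases
      case 1
      have "integral {x..c0} g = 0" "integral {y..c0} g = 0"
        using 1 xy(3) by (cases "c0 = x"; cases "c0 = y"; simp)+
      then show ?thesis using comb[OF 1 xy(3) int[OF c0 xy(2)]] by (simp add: algebra_simps)
    next
      case 2
      have "integral {c0..x} g = 0" "integral {y..c0} g = 0"
        using 2 by (cases "c0 = x"; cases "c0 = y"; simp)+
      then show ?thesis using comb[OF 2 int[OF xy(1,2)]] by (simp add: algebra_simps)
    next
      case 3
      have "integral {c0..x} g = 0" "integral {c0..y} g = 0"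
        using 3 xy(3) by (cases "c0 = x"; cases "c0 = y"; simp)+
      then show ?thesis using comb[OF xy(3) 3 int[OF xy(1) c0]] by (simp add: algebra_simps)
    qed
  qed
  then show thesis using that[of ?f] by simp
qed

lemma locally_integrable_mult_primitive:
  assumes f: "primitive a b f f'" and g: "locally_integrable a b g"
  shows "locally_integrable a b (\<lambda>x. f x * g x)"
  unfolding locally_integrable_def
proof (intro allI impI)
  fix c d :: real assume cd: "{c..d} \<subseteq> einterval a b"
  have cont: "continuous_on {c..d} f"
    using continuous_on_subset[OF primitive_continuous_on[OF f] cd] .
  show "(\<lambda>x. f x * g x) absolutely_integrable_on {c..d}"
  proof (rule absolutely_integrable_bounded_measurable_product[where h = "(*)"])
    show "bilinear ((*) :: complex \<Rightarrow> complex \<Rightarrow> complex)"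
      using bilinear_conv_bounded_bilinear bounded_bilinear_mult by blast
    show "f \<in> borel_measurable (lebesgue_on {c..d})"
      by (intro continuous_imp_measurable_on_sets_lebesgue cont) auto
    show "bounded (f ` {c..d})"
      by (intro compact_imp_bounded compact_continuous_image cont) auto
    show "g absolutely_integrable_on {c..d}" using g cd unfolding locally_integrable_def by blast
  qed auto
qed

lemma locally_integrable_of_real:
  fixes g :: "real \<Rightarrow> real"
  assumes "\<And>c d. {c..d} \<subseteq> einterval a b \<Longrightarrow> g absolutely_integrable_on {c..d}"
  shows "locally_integrable a b (\<lambda>x. of_real (g x))"
  unfolding locally_integrable_def
  using absolutely_integrable_linear[OF assms bounded_linear_of_real] by (auto simp: o_def)

lemma primitive_dominated:
  assumes F: "primitive a b F \<phi>" and H: "primitive a b H \<eta>" and xy: "x \<in> einterval a b" "y \<in> einterval a b" "x \<le> y"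
    and le: "\<And>t. t \<in> {x..y} \<Longrightarrow> cmod (\<phi> t) \<le> Re (\<eta> t)"
  shows "cmod (F y - F x) \<le> Re (H y) - Re (H x)"
proof -
  note P = primitiveD[OF F xy] and Q = primitiveD[OF H xy]
  have hR: "((\<lambda>t. Re (\<eta> t)) has_integral Re (integral {x..y} \<eta>)) {x..y}"
    using has_integral_linear[OF integrable_integral[OF Q(2)] bounded_linear_Re] by (simp add: o_def)
  have "cmod (F y - F x) \<le> integral {x..y} (\<lambda>t. Re (\<eta> t))"
    unfolding P(3) by (rule integral_norm_bound_integral[OF P(2)]) (use hR le in auto)
  also have "\<dots> = Re (H y - H x)" unfolding Q(3) using hR by (rule integral_unique)
  finally show ?thesis by simp
qed

section \<open>The Sturm-Liouville equation as a first-order system\<close>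

lemma AE_eq_imp_eq_on_einterval:
  fixes f g :: "real \<Rightarrow> complex"
  assumes "continuous_on (einterval a b) f" "continuous_on (einterval a b) g"
    and "AE x in lebesgue_on (einterval a b). f x = g x" and x: "x \<in> einterval a b"
  shows "f x = g x"
proof -
  let ?S = "{x \<in> einterval a b. f x - g x \<in> - {0}}"
  have "open ?S"
    using assms(1,2) by (intro continuous_open_preimage[unfolded vimage_def Int_def, simplified] continuous_on_diff open_einterval) auto
  moreover obtain N where "negligible N" "\<forall>x\<in>einterval a b - N. f x = g x"
    using assms(3) unfolding AE_einterval_iff by blast
  then have "negligible ?S" by (elim negligible_subset) auto
  ultimately have "?S = {}" using open_not_negligible by blast
  then show ?thesis using x by auto
qed

lemma borel_measurable_lebesgue_on_cong_AE:
  fixes f g :: "real \<Rightarrow> complex"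
  assumes "f \<in> borel_measurable (lebesgue_on S)" "AE x in lebesgue_on S. f x = g x" and S: "S \<in> sets lebesgue"
  shows "g \<in> borel_measurable (lebesgue_on S)"
proof -
  have "AE x in lebesgue. x \<in> S \<longrightarrow> f x = g x"
    using assms(2) AE_restrict_space_iff[of S lebesgue] S by simp
  then have "AE x in lebesgue. (if x \<in> S then f x else 0) = (if x \<in> S then g x else 0)"
    by eventually_elim auto
  from borel_measurable_AE[OF borel_measurable_if_I[OF assms(1) S] this] show ?thesis
    by (rule borel_measurable_if_D)
qed

locale sturm_liouville =
  fixes a b :: ereal and p q r :: "real \<Rightarrow> real"
  assumes less: "a < b" and coefficients: "sl_coefficients a b p q r"
begin

abbreviation "I \<equiv> einterval a b"
abbreviation "M \<equiv> sl_measure a b r"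
abbreviation "qd \<equiv> quasi_deriv a b p"
abbreviation "\<tau> \<equiv> sl_tau a b p q r"
abbreviation "domain_max \<equiv> dom_max a b p q r"
abbreviation "ae P \<equiv> (AE x in lebesgue_on I. P x)"

lemma p_pos: "ae (\<lambda>x. p x > 0)" and r_pos: "ae (\<lambda>x. r x > 0)"
  and r_measurable [measurable]: "r \<in> borel_measurable (lebesgue_on I)"
  using coefficients by (auto simp: sl_coefficients_def)

lemma locally_integrable_coefficients:
  "locally_integrable a b (\<lambda>x. of_real (1 / p x))" "locally_integrable a b (\<lambda>x. of_real (q x))"
  "locally_integrable a b (\<lambda>x. of_real (r x))"
proof -
  have *: "(\<lambda>x. 1 / p x) absolutely_integrable_on {c..d}" "q absolutely_integrable_on {c..d}"
    "r absolutely_integrable_on {c..d}" if "{c..d} \<subseteq> I" for c d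
    using coefficients that unfolding sl_coefficients_def by blast+
  show "locally_integrable a b (\<lambda>x. of_real (1 / p x))" by (rule locally_integrable_of_real[OF *(1)])
  show "locally_integrable a b (\<lambda>x. of_real (q x))" by (rule locally_integrable_of_real[OF *(2)])
  show "locally_integrable a b (\<lambda>x. of_real (r x))" by (rule locally_integrable_of_real[OF *(3)])
qed

text \<open>
  The equation \<open>\<tau> f = h\<close> with quasi-derivative \<open>f'\<close>.  In contrast to \<open>qd f\<close> and \<open>\<tau> f\<close>, which are fixed
  by choice and by pointwise differentiation, the functions \<open>f'\<close> and h are arbitrary representatives, so
  that systems can be combined linearly and limits and products can be verified directly.
\<close>
definition system :: "(real \<Rightarrow> complex) \<Rightarrow> (real \<Rightarrow> complex) \<Rightarrow> (real \<Rightarrow> complex) \<Rightarrow> bool" where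
  "system f f' h \<longleftrightarrow> primitive a b f (\<lambda>x. of_real (1 / p x) * f' x) \<and>
     primitive a b f' (\<lambda>x. of_real (q x) * f x - of_real (r x) * h x)"

text \<open>
  This lemma and the next one translate between the pointwise definitions and systems.
\<close>
lemma system_quasi_deriv:
  assumes f: "f \<in> sl_domain a b p"
  shows "system f (qd f) (\<tau> f)"
proof -
  have "is_quasi_deriv a b p f (qd f)"
    using someI_ex[of "is_quasi_deriv a b p f"] f unfolding quasi_deriv_def sl_domain_def by simp
  then have qd: "qd f \<in> AC_loc a b" "ae (\<lambda>x. qd f x = of_real (p x) * vector_derivative f (at x))"
    unfolding is_quasi_deriv_def by auto
  have "f \<in> AC_loc a b" using f by (auto simp: sl_domain_def)
  then have "primitive a b f (\<lambda>x. of_real (1 / p x) * qd f x)"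
    by (rule primitive_cong_AE[OF AC_loc_primitive]) (use qd(2) p_pos in eventually_elim, simp)
  moreover have "primitive a b (qd f) (\<lambda>x. of_real (q x) * f x - of_real (r x) * \<tau> f x)"
    by (rule primitive_cong_AE[OF AC_loc_primitive[OF qd(1)]])
      (use r_pos in eventually_elim, simp add: sl_tau_def)
  ultimately show ?thesis by (simp add: system_def)
qed

lemma system_imp_sl_domain:
  assumes "system f f' h"
  shows "f \<in> sl_domain a b p" "\<And>x. x \<in> I \<Longrightarrow> qd f x = f' x" "ae (\<lambda>x. \<tau> f x = h x)"
proof -
  have f: "primitive a b f (\<lambda>x. of_real (1 / p x) * f' x)"
    and f': "primitive a b f' (\<lambda>x. of_real (q x) * f x - of_real (r x) * h x)"
    using assms by (auto simp: system_def)
  have "is_quasi_deriv a b p f f'"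
    unfolding is_quasi_deriv_def
  proof
    show "f' \<in> AC_loc a b" using f' by (rule primitive_AC_loc)
    show "ae (\<lambda>x. f' x = of_real (p x) * vector_derivative f (at x))"
      using primitive_has_vector_derivative[OF f] p_pos
      by eventually_elim (simp add: vector_derivative_at)
  qed
  then show dom: "f \<in> sl_domain a b p" using primitive_AC_loc[OF f] by (auto simp: sl_domain_def)
  note qd = system_quasi_deriv[OF dom, unfolded system_def]
  have "ae (\<lambda>x. qd f x = f' x)"
    using primitive_unique_AE[OF conjunct1[OF qd] f] p_pos by eventually_elim simp
  then show eq: "qd f x = f' x" if "x \<in> I" for x
    using AE_eq_imp_eq_on_einterval[OF primitive_continuous_on[OF conjunct2[OF qd]]
        primitive_continuous_on[OF f'] _ that] by blast
  have "primitive a b f' (\<lambda>x. of_real (q x) * f x - of_real (r x) * \<tau> f x)"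
    using conjunct2[OF qd] eq by (rule primitive_cong) auto
  from primitive_unique_AE[OF this f'] show "ae (\<lambda>x. \<tau> f x = h x)"
    using r_pos by eventually_elim simp
qed

lemma system_continuous_on:
  assumes "system f f' h" shows "continuous_on I f" "continuous_on I f'"
  using assms primitive_continuous_on by (auto simp: system_def)

lemma system_cong_AE:
  assumes "system f f' h" "ae (\<lambda>x. h x = h' x)"
  shows "system f f' h'"
  unfolding system_def
proof
  show "primitive a b f (\<lambda>x. of_real (1 / p x) * f' x)" using assms by (simp add: system_def)
  show "primitive a b f' (\<lambda>x. of_real (q x) * f x - of_real (r x) * h' x)"
    by (rule primitive_cong_AE[OF conjunct2[OF assms(1)[unfolded system_def]]])
      (use assms(2) in eventually_elim, simp)
qed

lemma system_add:
  assumes "system f f' h" "system g g' k"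
  shows "system (\<lambda>x. f x + g x) (\<lambda>x. f' x + g' x) (\<lambda>x. h x + k x)"
proof -
  note F = assms(1)[unfolded system_def] and G = assms(2)[unfolded system_def]
  show ?thesis
    unfolding system_def
  proof
    show "primitive a b (\<lambda>x. f x + g x) (\<lambda>x. of_real (1 / p x) * (f' x + g' x))"
      by (rule primitive_cong[OF primitive_add[OF conjunct1[OF F] conjunct1[OF G]]])
        (simp_all add: add_divide_distrib)
    show "primitive a b (\<lambda>x. f' x + g' x) (\<lambda>x. of_real (q x) * (f x + g x) - of_real (r x) * (h x + k x))"
      by (rule primitive_cong[OF primitive_add[OF conjunct2[OF F] conjunct2[OF G]]])
        (simp_all add: algebra_simps)
  qed
qed

lemma system_cmult:
  assumes "system f f' h"
  shows "system (\<lambda>x. c * f x) (\<lambda>x. c * f' x) (\<lambda>x. c * h x)"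
proof -
  note F = assms(1)[unfolded system_def]
  show ?thesis
    unfolding system_def
  proof
    show "primitive a b (\<lambda>x. c * f x) (\<lambda>x. of_real (1 / p x) * (c * f' x))"
      by (rule primitive_cong[OF primitive_cmult[OF conjunct1[OF F], of c]]) simp_all
    show "primitive a b (\<lambda>x. c * f' x) (\<lambda>x. of_real (q x) * (c * f x) - of_real (r x) * (c * h x))"
      by (rule primitive_cong[OF primitive_cmult[OF conjunct2[OF F], of c]]) (simp_all add: algebra_simps)
  qed
qed

lemma system_cnj:
  assumes "system f f' h"
  shows "system (\<lambda>x. cnj (f x)) (\<lambda>x. cnj (f' x)) (\<lambda>x. cnj (h x))"
proof -
  note F = assms(1)[unfolded system_def]
  show ?thesis
    unfolding system_def
  proof
    show "primitive a b (\<lambda>x. cnj (f x)) (\<lambda>x. of_real (1 / p x) * cnj (f' x))"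
      by (rule primitive_cong[OF primitive_cnj[OF conjunct1[OF F]]]) simp_all
    show "primitive a b (\<lambda>x. cnj (f' x)) (\<lambda>x. of_real (q x) * cnj (f x) - of_real (r x) * cnj (h x))"
      by (rule primitive_cong[OF primitive_cnj[OF conjunct2[OF F]]]) simp_all
  qed
qed

lemma system_unique:
  assumes f: "system f f' h" and g: "system g g' k" and eq: "ae (\<lambda>x. f x = g x)"
  shows "\<And>x. x \<in> I \<Longrightarrow> f x = g x" "\<And>x. x \<in> I \<Longrightarrow> f' x = g' x" "ae (\<lambda>x. h x = k x)"
proof -
  show fg: "f x = g x" if "x \<in> I" for x
    using AE_eq_imp_eq_on_einterval[OF system_continuous_on(1)[OF f] system_continuous_on(1)[OF g] eq that] .
  have "system f g' k"
    unfolding system_def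
  proof
    show "primitive a b f (\<lambda>x. of_real (1 / p x) * g' x)"
      by (rule primitive_cong[OF conjunct1[OF g[unfolded system_def]]]) (simp_all add: fg)
    show "primitive a b g' (\<lambda>x. of_real (q x) * f x - of_real (r x) * k x)"
      by (rule primitive_cong[OF conjunct2[OF g[unfolded system_def]]]) (simp_all add: fg)
  qed
  note F = system_imp_sl_domain[OF f] and G = system_imp_sl_domain[OF this]
  show "f' x = g' x" if "x \<in> I" for x using F(2)[OF that] G(2)[OF that] by simp
  show "ae (\<lambda>x. h x = k x)" using F(3) G(3) by eventually_elim simp
qed

text \<open>
  In the derivative of the bracket the terms with \<open>1 / p\<close> and with q cancel, since both are real.
\<close>
lemma lagrange_identity:
  assumes f: "system f f' h" and g: "system g g' k"
  shows "primitive a b (\<lambda>x. f x * cnj (g' x) - f' x * cnj (g x))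
           (\<lambda>x. of_real (r x) * (cnj (g x) * h x - cnj (k x) * f x))"
proof -
  note F = f[unfolded system_def] and G = system_cnj[OF g, unfolded system_def]
  show ?thesis
    by (rule primitive_cong[OF primitive_diff[OF
          primitive_mult[OF conjunct1[OF F] conjunct2[OF G]] primitive_mult[OF conjunct2[OF F] conjunct1[OF G]]]])
      (auto simp: algebra_simps)
qed

section \<open>The weighted Hilbert space\<close>

lemma space_M [simp]: "space M = I" and sets_M: "sets M = sets (lebesgue_on I)"
  by (simp_all add: sl_measure_def)

lemma measurable_M: "f \<in> borel_measurable M \<longleftrightarrow> f \<in> borel_measurable (lebesgue_on I)"
  by (simp add: measurable_cong_sets[OF sets_M refl])

lemma AE_M_iff: "(AE x in M. P x) \<longleftrightarrow> ae P"
proof -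
  have "(AE x in M. P x) \<longleftrightarrow> ae (\<lambda>x. 0 < ennreal (r x) \<longrightarrow> P x)"
    unfolding sl_measure_def by (rule AE_density) simp
  also have "\<dots> \<longleftrightarrow> ae P"
    by (rule eventually_cong[OF eventually_mono[OF r_pos]]) auto
  finally show ?thesis .
qed

lemma integrable_M_iff:
  fixes f :: "real \<Rightarrow> complex"
  assumes "f \<in> borel_measurable M"
  shows "integrable M f \<longleftrightarrow> integrable (lebesgue_on I) (\<lambda>x. of_real (r x) * f x)"
    and "integral\<^sup>L M f = integral\<^sup>L (lebesgue_on I) (\<lambda>x. of_real (r x) * f x)"
proof -
  have nn: "ae (\<lambda>x. 0 \<le> r x)" using r_pos by eventually_elim simp
  have f: "f \<in> borel_measurable (lebesgue_on I)" using assms unfolding measurable_M .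
  show "integrable M f \<longleftrightarrow> integrable (lebesgue_on I) (\<lambda>x. of_real (r x) * f x)"
    using integrable_density[OF f r_measurable nn] by (simp add: sl_measure_def scaleR_conv_of_real)
  show "integral\<^sup>L M f = integral\<^sup>L (lebesgue_on I) (\<lambda>x. of_real (r x) * f x)"
    using integral_density[OF f r_measurable nn] by (simp add: sl_measure_def scaleR_conv_of_real)
qed

lemma L2_measurable: "f \<in> L2 M \<Longrightarrow> f \<in> borel_measurable M"
  by (simp add: L2_def)

lemma measurable_cnj: "f \<in> borel_measurable M \<Longrightarrow> (\<lambda>x. cnj (f x)) \<in> borel_measurable M"
  by (rule measurable_compose[OF _ borel_measurable_continuous_onI[OF continuous_on_cnj[OF continuous_on_id]]])

lemma L2_inner_integrable:
  assumes "f \<in> L2 M" "g \<in> L2 M"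
  shows "integrable M (\<lambda>x. cnj (f x) * g x)"
proof (rule Bochner_Integration.integrable_bound)
  show "integrable M (\<lambda>x. (cmod (f x))\<^sup>2 + (cmod (g x))\<^sup>2)"
    using assms by (auto simp: L2_def)
  show "(\<lambda>x. cnj (f x) * g x) \<in> borel_measurable M"
    using assms by (intro borel_measurable_times measurable_cnj L2_measurable)
  have "x * y \<le> x\<^sup>2 + y\<^sup>2" if "x \<ge> 0" "y \<ge> 0" for x y :: real
    using sum_squares_bound[of x y] that mult_nonneg_nonneg[OF that] by linarith
  then show "AE x in M. norm (cnj (f x) * g x) \<le> norm ((cmod (f x))\<^sup>2 + (cmod (g x))\<^sup>2)"
    by (auto simp: norm_mult)
qed

lemma L2_bound:
  assumes g: "g \<in> L2 M" and f: "f \<in> borel_measurable M" and le: "AE x in M. cmod (f x) \<le> C * cmod (g x)"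
  shows "f \<in> L2 M"
proof -
  have "integrable M (\<lambda>x. (cmod (f x))\<^sup>2)"
  proof (rule Bochner_Integration.integrable_bound)
    show "integrable M (\<lambda>x. C\<^sup>2 * (cmod (g x))\<^sup>2)" using g by (auto simp: L2_def)
    show "(\<lambda>x. (cmod (f x))\<^sup>2) \<in> borel_measurable M" using f by measurable
    show "AE x in M. norm ((cmod (f x))\<^sup>2) \<le> norm (C\<^sup>2 * (cmod (g x))\<^sup>2)"
      using le
    proof eventually_elim
      case (elim x)
      then have "(cmod (f x))\<^sup>2 \<le> (C * cmod (g x))\<^sup>2" by (intro power_mono) auto
      then show ?case by (simp add: power_mult_distrib)
    qed
  qed
  then show ?thesis using f by (simp add: L2_def)
qed

lemma L2_add:
  assumes "f \<in> L2 M" "g \<in> L2 M" shows "(\<lambda>x. f x + g x) \<in> L2 M"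
proof -
  have f: "f \<in> borel_measurable M" and g: "g \<in> borel_measurable M" using assms L2_measurable by auto
  have "integrable M (\<lambda>x. (cmod (f x + g x))\<^sup>2)"
  proof (rule Bochner_Integration.integrable_bound)
    show "integrable M (\<lambda>x. 2 * (cmod (f x))\<^sup>2 + 2 * (cmod (g x))\<^sup>2)"
      using assms by (auto simp: L2_def)
    show "(\<lambda>x. (cmod (f x + g x))\<^sup>2) \<in> borel_measurable M" using f g by measurable
    have "(cmod (x + y))\<^sup>2 \<le> 2 * (cmod x)\<^sup>2 + 2 * (cmod y)\<^sup>2" for x y
    proof -
      have "(cmod (x + y))\<^sup>2 \<le> (cmod x + cmod y)\<^sup>2" by (intro power_mono norm_triangle_ineq) auto
      also have "\<dots> \<le> 2 * (cmod x)\<^sup>2 + 2 * (cmod y)\<^sup>2"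
        using sum_squares_bound[of "cmod x" "cmod y"] by (simp add: power2_sum)
      finally show ?thesis .
    qed
    then show "AE x in M. norm ((cmod (f x + g x))\<^sup>2) \<le> norm (2 * (cmod (f x))\<^sup>2 + 2 * (cmod (g x))\<^sup>2)"
      by auto
  qed
  then show ?thesis using f g by (simp add: L2_def borel_measurable_add)
qed

lemma L2_cmult: "f \<in> L2 M \<Longrightarrow> (\<lambda>x. c * f x) \<in> L2 M"
  by (rule L2_bound[where g = f and C = "cmod c"]) (auto simp: L2_measurable norm_mult intro: borel_measurable_times)

lemma L2_diff: "f \<in> L2 M \<Longrightarrow> g \<in> L2 M \<Longrightarrow> (\<lambda>x. f x - g x) \<in> L2 M"
  using L2_add[of f "\<lambda>x. -1 * g x"] L2_cmult[of g "-1"] by simp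

lemma L2_cnj: "f \<in> L2 M \<Longrightarrow> (\<lambda>x. cnj (f x)) \<in> L2 M"
  by (rule L2_bound[where g = f and C = 1]) (auto simp: L2_measurable intro: measurable_cnj)

lemma L2_cong_AE:
  assumes "f \<in> L2 M" "ae (\<lambda>x. f x = g x)" shows "g \<in> L2 M"
proof (rule L2_bound[OF assms(1)])
  show "g \<in> borel_measurable M"
    using borel_measurable_lebesgue_on_cong_AE[OF _ assms(2)] L2_measurable[OF assms(1)] unfolding measurable_M by simp
  show "AE x in M. cmod (g x) \<le> 1 * cmod (f x)"
    using assms(2) unfolding AE_M_iff by eventually_elim simp
qed

lemma l2_inner_cong_AE:
  assumes "f \<in> L2 M" "g \<in> L2 M" "ae (\<lambda>x. f x = f' x)" "ae (\<lambda>x. g x = g' x)"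
  shows "l2_inner M f g = l2_inner M f' g'"
  unfolding l2_inner_def
proof (rule integral_cong_AE)
  show "(\<lambda>x. cnj (f' x) * g' x) \<in> borel_measurable M"
    using L2_cong_AE[OF assms(1,3)] L2_cong_AE[OF assms(2,4)]
    by (rule borel_measurable_integrable[OF L2_inner_integrable])
  show "(\<lambda>x. cnj (f x) * g x) \<in> borel_measurable M"
    using assms(1,2) by (rule borel_measurable_integrable[OF L2_inner_integrable])
  show "AE x in M. cnj (f x) * g x = cnj (f' x) * g' x"
    using assms(3,4) unfolding AE_M_iff by eventually_elim simp
qed

lemma l2_inner_add_right:
  assumes "f \<in> L2 M" "g \<in> L2 M" "h \<in> L2 M"
  shows "l2_inner M f (\<lambda>x. g x + h x) = l2_inner M f g + l2_inner M f h"
  using L2_inner_integrable[OF assms(1,2)] L2_inner_integrable[OF assms(1,3)]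
  by (simp add: l2_inner_def distrib_left)

lemma l2_inner_cmult_right: "l2_inner M f (\<lambda>x. c * g x) = c * l2_inner M f g"
  by (simp add: l2_inner_def mult.left_commute)

lemma l2_inner_commute: "l2_inner M g f = cnj (l2_inner M f g)"
proof -
  have "cnj (l2_inner M f g) = (\<integral>x. cnj (cnj (f x) * g x) \<partial>M)"
    unfolding l2_inner_def by (rule Bochner_Integration.integral_cnj[symmetric])
  then show ?thesis by (simp add: l2_inner_def mult.commute)
qed

lemma l2_inner_self_eq_0:
  assumes "f \<in> L2 M" "l2_inner M f f = 0" shows "ae (\<lambda>x. f x = 0)"
proof -
  have "(\<lambda>x. cnj (f x) * f x) = (\<lambda>x. complex_of_real ((cmod (f x))\<^sup>2))"
    by (rule ext) (metis complex_norm_square mult.commute)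
  then have "(\<integral>x. (cmod (f x))\<^sup>2 \<partial>M) = 0"
    using assms(2) by (simp add: l2_inner_def del: of_real_power)
  then have "AE x in M. (cmod (f x))\<^sup>2 = 0"
    using assms(1) by (subst (asm) integral_nonneg_eq_0_iff_AE) (auto simp: L2_def)
  then show ?thesis unfolding AE_M_iff by simp
qed

lemma system_measurable:
  assumes "system f f' h" shows "f \<in> borel_measurable M" "f' \<in> borel_measurable M"
  using system_continuous_on[OF assms]
  by (auto simp: measurable_M intro!: continuous_imp_measurable_on_sets_lebesgue)

lemma domain_maxI:
  assumes "system f f' h" "f \<in> L2 M" "h \<in> L2 M" shows "f \<in> domain_max"
proof -
  have "ae (\<lambda>x. h x = \<tau> f x)" using system_imp_sl_domain(3)[OF assms(1)] by eventually_elim simp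
  then show ?thesis
    using assms system_imp_sl_domain(1) L2_cong_AE unfolding dom_max_def by blast
qed

lemma domain_maxD:
  assumes "f \<in> domain_max" shows "system f (qd f) (\<tau> f)" "f \<in> L2 M" "\<tau> f \<in> L2 M"
  using assms system_quasi_deriv unfolding dom_max_def by auto

end

section \<open>Linear systems with locally integrable coefficients\<close>

lemma primitive_power:
  assumes f: "primitive a b f g"
  shows "primitive a b (\<lambda>x. f x ^ n) (\<lambda>x. of_nat n * f x ^ (n - 1) * g x)"
proof (induction n)
  case 0
  show ?case using primitive_const[of a b 1] by simp
next
  case (Suc n)
  show ?case
    by (rule primitive_cong[OF primitive_mult[OF f Suc.IH]]) (cases n; simp add: algebra_simps)+
qed

lemma locally_integrable_mult_primitive':
  assumes "locally_integrable a b g" "primitive a b f f'"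
  shows "locally_integrable a b (\<lambda>x. g x * f x)"
  using locally_integrable_mult_primitive[OF assms(2,1)] by (simp add: mult.commute)

lemma exp_partial_sum_le:
  fixes z :: real assumes "z \<ge> 0"
  shows "(\<Sum>k<n. z ^ Suc k / fact (Suc k)) \<le> exp z"
proof -
  have "(\<Sum>k<n. z ^ Suc k / fact (Suc k)) \<le> (\<Sum>k<Suc n. z ^ k / fact k)"
    by (subst sum.lessThan_Suc_shift) simp
  also have "\<dots> \<le> exp z"
    unfolding exp_def using summable_exp[of z] assms
    by (simp add: divide_inverse mult.commute sum_le_suminf del: sum.lessThan_Suc)
  finally show ?thesis .
qed

text \<open>
  Picard iteration on the whole interval at once.  If w is the primitive of \<open>\<omega> = |A| + |B|\<close> that
  vanishes at \<open>c0\<close>, the increments of the n-th step are at most \<open>C |w|\<^sup>n / n!\<close>, because the derivative of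
  \<open>|w|\<^sup>n\<^sup>+\<^sup>1 / (n + 1)!\<close> is \<open>\<omega> |w|\<^sup>n / n!\<close> up to sign.  Hence the iterates converge, and they are bounded by a
  continuous function, which allows passing to the limit under the integral.
\<close>
lemma linear_system_exists:
  assumes A: "locally_integrable a b A" and B: "locally_integrable a b B" and c0: "c0 \<in> einterval a b"
  obtains f g where "f c0 = \<alpha>" "g c0 = \<beta>"
    "primitive a b f (\<lambda>x. A x * g x)" "primitive a b g (\<lambda>x. B x * f x)"
proof -
  let ?I = "einterval a b"
  define prim where "prim k v = (SOME f. f c0 = v \<and> primitive a b f k)" for k v
  have prim: "prim k v c0 = v \<and> primitive a b (prim k v) k" if "locally_integrable a b k" for k v
  proof -
    have "\<exists>f. f c0 = v \<and> primitive a b f k" using primitive_exists[OF that c0, of v] by blast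
    then show ?thesis unfolding prim_def by (rule someI_ex)
  qed
  define Y where "Y = rec_nat ((\<lambda>_. \<alpha>, \<lambda>_. \<beta>) :: (real \<Rightarrow> complex) \<times> (real \<Rightarrow> complex))
    (\<lambda>_ y. (prim (\<lambda>x. A x * snd y x) \<alpha>, prim (\<lambda>x. B x * fst y x) \<beta>))"
  define F where "F n = fst (Y n)" for n
  define G where "G n = snd (Y n)" for n
  have F0: "F 0 = (\<lambda>_. \<alpha>)" and G0: "G 0 = (\<lambda>_. \<beta>)" by (simp_all add: F_def G_def Y_def)
  have FS: "F (Suc n) = prim (\<lambda>x. A x * G n x) \<alpha>" and GS: "G (Suc n) = prim (\<lambda>x. B x * F n x) \<beta>" for n
    by (simp_all add: F_def G_def Y_def)
  have "(\<exists>k. primitive a b (F n) k) \<and> (\<exists>k. primitive a b (G n) k)" for n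
  proof (induction n)
    case 0
    show ?case unfolding F0 G0 using primitive_const by blast
  next
    case (Suc n)
    then have "locally_integrable a b (\<lambda>x. A x * G n x)" "locally_integrable a b (\<lambda>x. B x * F n x)"
      using locally_integrable_mult_primitive'[OF A] locally_integrable_mult_primitive'[OF B] by blast+
    then show ?case unfolding FS GS using prim by blast
  qed
  then have lint: "locally_integrable a b (\<lambda>x. A x * G n x)" "locally_integrable a b (\<lambda>x. B x * F n x)" for n
    using locally_integrable_mult_primitive'[OF A] locally_integrable_mult_primitive'[OF B] by blast+
  have PF: "F (Suc n) c0 = \<alpha>" "primitive a b (F (Suc n)) (\<lambda>x. A x * G n x)"
    and PG: "G (Suc n) c0 = \<beta>" "primitive a b (G (Suc n)) (\<lambda>x. B x * F n x)" for n
    using prim[OF lint(1)] prim[OF lint(2)] unfolding FS GS by blast+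

  define \<omega> where "\<omega> x = cmod (A x) + cmod (B x)" for x
  have "locally_integrable a b (\<lambda>x. complex_of_real (\<omega> x))"
    unfolding \<omega>_def using A B
    by (intro locally_integrable_of_real set_integral_add(1) set_integrable_norm) (auto simp: locally_integrable_def)
  then obtain W0 where W0: "W0 c0 = 0" "primitive a b W0 (\<lambda>x. complex_of_real (\<omega> x))"
    using primitive_exists[OF _ c0] by metis
  define w where "w x = Re (W0 x)" for x
  have w0: "w c0 = 0" using W0(1) by (simp add: w_def)
  have W: "primitive a b (\<lambda>x. complex_of_real (w x)) (\<lambda>x. complex_of_real (\<omega> x))"
    using primitive_linear[OF bounded_linear_compose[OF bounded_linear_of_real bounded_linear_Re] W0(2)]
    by (simp add: w_def)
  have w_mono: "w x \<le> w y" if "x \<in> ?I" "y \<in> ?I" "x \<le> y" for x y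
    using primitive_dominated[OF primitive_const[of a b 0] W that] by (simp add: \<omega>_def)

  have iterate: "cmod (\<Phi> x) \<le> C * \<bar>w x\<bar> ^ Suc n / fact (Suc n)"
    if \<Phi>: "primitive a b \<Phi> \<phi>" "\<Phi> c0 = 0" and x: "x \<in> ?I"
      and le: "\<And>t. t \<in> ?I \<Longrightarrow> cmod (\<phi> t) \<le> \<omega> t * (C * \<bar>w t\<bar> ^ n / fact n)"
    for \<Phi> \<phi> n x and C :: real
  proof -
    \<comment> \<open>The comparison function on either side of \<open>c0\<close>, where \<open>k = 1\<close> or \<open>k = - 1\<close> is the sign of w.\<close>
    have P: "primitive a b (\<lambda>t. complex_of_real (k * C / fact (Suc n)) * complex_of_real (k * w t) ^ Suc n)
        (\<lambda>t. complex_of_real (\<omega> t * (C * (k * w t) ^ n / fact n)))" if "k = 1 \<or> k = - 1" for k :: real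
    proof (rule primitive_cong[OF primitive_cmult[OF primitive_power[OF primitive_cmult[OF W, of "complex_of_real k"]],
            of "complex_of_real (k * C / fact (Suc n))" "Suc n"]])
      fix t
      have gen: "k * C / (N * X) * (N * Z * (k * V)) = k * k * (V * (C * Z / X))" if "N \<noteq> 0" "X \<noteq> 0"
        for N X Z V :: real using that by (simp add: field_simps)
      have "k * C / fact (Suc n) * (real (Suc n) * (k * w t) ^ n * (k * \<omega> t)) = k * k * (\<omega> t * (C * (k * w t) ^ n / fact n))"
        unfolding fact_Suc by (rule gen) simp_all
      then have "k * C / fact (Suc n) * (real (Suc n) * (k * w t) ^ n * (k * \<omega> t)) = \<omega> t * (C * (k * w t) ^ n / fact n)"
        using that by auto
      then have "complex_of_real (k * C / fact (Suc n) * (real (Suc n) * (k * w t) ^ n * (k * \<omega> t))) =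
         complex_of_real (\<omega> t * (C * (k * w t) ^ n / fact n))" by (rule arg_cong)
      then show "complex_of_real (k * C / fact (Suc n)) *
         (of_nat (Suc n) * (complex_of_real k * complex_of_real (w t)) ^ (Suc n - 1) * (complex_of_real k * complex_of_real (\<omega> t))) =
         complex_of_real (\<omega> t * (C * (k * w t) ^ n / fact n))"
        by (simp only: of_real_mult[symmetric] of_real_power[symmetric] of_real_of_nat_eq[where 'a = complex, symmetric] diff_Suc_1)
    qed simp
    show ?thesis
    proof (cases "c0 \<le> x")
      case True
      have wt: "\<bar>w t\<bar> = 1 * w t" if "t \<in> {c0..x}" for t
        using w_mono[OF c0, of t] Icc_subset_einterval[OF c0 x] that w0 by auto
      have "cmod (\<Phi> x - \<Phi> c0) \<le> Re (complex_of_real (1 * C / fact (Suc n)) * complex_of_real (1 * w x) ^ Suc n)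
          - Re (complex_of_real (1 * C / fact (Suc n)) * complex_of_real (1 * w c0) ^ Suc n)"
      proof (rule primitive_dominated[OF \<Phi>(1) P c0 x True])
        fix t assume t: "t \<in> {c0..x}"
        then have "t \<in> ?I" using Icc_subset_einterval[OF c0 x] by blast
        from le[OF this] show "cmod (\<phi> t) \<le> Re (complex_of_real (\<omega> t * (C * (1 * w t) ^ n / fact n)))"
          by (simp only: wt[OF t] Re_complex_of_real)
      qed simp
      then have "cmod (\<Phi> x - \<Phi> c0) \<le> 1 * C / fact (Suc n) * (1 * w x) ^ Suc n - 1 * C / fact (Suc n) * (1 * w c0) ^ Suc n"
        by (simp only: of_real_power[symmetric] of_real_mult[symmetric] Re_complex_of_real)
      then show ?thesis using \<Phi>(2) w0 wt[of x] True by simp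
    next
      case False
      then have xc: "x \<le> c0" by simp
      have wt: "\<bar>w t\<bar> = -1 * w t" if "t \<in> {x..c0}" for t
        using w_mono[OF _ c0, of t] Icc_subset_einterval[OF x c0] that w0 by auto
      have "cmod (\<Phi> c0 - \<Phi> x) \<le> Re (complex_of_real (-1 * C / fact (Suc n)) * complex_of_real (-1 * w c0) ^ Suc n)
          - Re (complex_of_real (-1 * C / fact (Suc n)) * complex_of_real (-1 * w x) ^ Suc n)"
      proof (rule primitive_dominated[OF \<Phi>(1) P x c0 xc])
        fix t assume t: "t \<in> {x..c0}"
        then have "t \<in> ?I" using Icc_subset_einterval[OF x c0] by blast
        from le[OF this] show "cmod (\<phi> t) \<le> Re (complex_of_real (\<omega> t * (C * (-1 * w t) ^ n / fact n)))"
          by (simp only: wt[OF t] Re_complex_of_real)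
      qed simp
      then have "cmod (\<Phi> c0 - \<Phi> x) \<le> -1 * C / fact (Suc n) * (-1 * w c0) ^ Suc n - -1 * C / fact (Suc n) * (-1 * w x) ^ Suc n"
        by (simp only: of_real_power[symmetric] of_real_mult[symmetric] Re_complex_of_real)
      then show ?thesis using \<Phi>(2) w0 wt[of x] xc by simp
    qed
  qed

  define C where "C = cmod \<alpha> + cmod \<beta>"
  have step: "cmod (F (Suc n) x - F n x) \<le> C * \<bar>w x\<bar> ^ Suc n / fact (Suc n) \<and>
      cmod (G (Suc n) x - G n x) \<le> C * \<bar>w x\<bar> ^ Suc n / fact (Suc n)" if "x \<in> ?I" for n x
    using that
  proof (induction n arbitrary: x)
    case 0
    have le: "cmod (A t * \<beta>) \<le> \<omega> t * (C * \<bar>w t\<bar> ^ 0 / fact 0)" "cmod (B t * \<alpha>) \<le> \<omega> t * (C * \<bar>w t\<bar> ^ 0 / fact 0)" for t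
      by (auto simp: norm_mult \<omega>_def C_def intro!: mult_mono)
    have "cmod (F (Suc 0) x - \<alpha>) \<le> C * \<bar>w x\<bar> ^ Suc 0 / fact (Suc 0)"
      by (rule iterate[OF primitive_cong[OF primitive_diff[OF PF(2)[of 0] primitive_const[of a b \<alpha>]], OF refl refl] _ 0])
        (use PF(1) le(1) in \<open>auto simp: G0\<close>)
    moreover have "cmod (G (Suc 0) x - \<beta>) \<le> C * \<bar>w x\<bar> ^ Suc 0 / fact (Suc 0)"
      by (rule iterate[OF primitive_cong[OF primitive_diff[OF PG(2)[of 0] primitive_const[of a b \<beta>]], OF refl refl] _ 0])
        (use PG(1) le(2) in \<open>auto simp: F0\<close>)
    ultimately show ?case by (simp add: F0 G0)
  next
    case (Suc n)
    have le: "cmod (A t * G (Suc n) t - A t * G n t) \<le> \<omega> t * (C * \<bar>w t\<bar> ^ Suc n / fact (Suc n))"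
      "cmod (B t * F (Suc n) t - B t * F n t) \<le> \<omega> t * (C * \<bar>w t\<bar> ^ Suc n / fact (Suc n))" if "t \<in> ?I" for t
      unfolding right_diff_distrib[symmetric] norm_mult using Suc.IH[OF that]
      by (intro mult_mono; auto simp: \<omega>_def)+
    show ?case
      by (intro conjI iterate[OF primitive_diff[OF PF(2) PF(2)] _ Suc.prems le(1)]
            iterate[OF primitive_diff[OF PG(2) PG(2)] _ Suc.prems le(2)]) (simp_all add: PF(1) PG(1))
  qed

  have limits: "\<exists>l. (\<lambda>n. H n x) \<longlonglongrightarrow> l" "cmod (H n x) \<le> cmod (H 0 x) + C * exp \<bar>w x\<bar>"
    if H: "\<And>n. cmod (H (Suc n) x - H n x) \<le> C * \<bar>w x\<bar> ^ Suc n / fact (Suc n)"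
    for H :: "nat \<Rightarrow> real \<Rightarrow> complex" and x n
  proof -
    have tel: "H n x = H 0 x + (\<Sum>k<n. H (Suc k) x - H k x)" for n
      by (induction n) (simp_all add: algebra_simps)
    have "summable (\<lambda>n. \<bar>w x\<bar> ^ n / fact n)"
      using summable_exp[of "\<bar>w x\<bar>"] by (simp add: field_simps)
    then have "summable (\<lambda>n. \<bar>w x\<bar> ^ Suc n / fact (Suc n))"
      by (subst summable_Suc_iff[of "\<lambda>n. \<bar>w x\<bar> ^ n / fact n"])
    then have "summable (\<lambda>n. C * (\<bar>w x\<bar> ^ Suc n / fact (Suc n)))" by (rule summable_mult)
    then have "summable (\<lambda>n. H (Suc n) x - H n x)"
      by (rule summable_comparison_test[rotated]) (use H in auto)
    then have "(\<lambda>n. \<Sum>k<n. H (Suc k) x - H k x) \<longlonglongrightarrow> (\<Sum>k. H (Suc k) x - H k x)"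
      by (rule summable_LIMSEQ)
    from tendsto_add[OF tendsto_const this, of "H 0 x"]
    show "\<exists>l. (\<lambda>n. H n x) \<longlonglongrightarrow> l" unfolding tel[symmetric] by blast
    have "cmod (H n x) \<le> cmod (H 0 x) + (\<Sum>k<n. cmod (H (Suc k) x - H k x))"
      by (subst tel[of n]) (intro order_trans[OF norm_triangle_ineq] add_left_mono norm_sum)
    also have "(\<Sum>k<n. cmod (H (Suc k) x - H k x)) \<le> (\<Sum>k<n. C * (\<bar>w x\<bar> ^ Suc k / fact (Suc k)))"
      by (rule sum_mono) (use H in simp)
    also have "\<dots> \<le> C * exp \<bar>w x\<bar>"
      unfolding sum_distrib_left[symmetric]
      by (intro mult_left_mono exp_partial_sum_le) (auto simp: C_def)
    finally show "cmod (H n x) \<le> cmod (H 0 x) + C * exp \<bar>w x\<bar>" by simp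
  qed
  define f where "f x = lim (\<lambda>n. F n x)" for x
  define g where "g x = lim (\<lambda>n. G n x)" for x
  have f: "(\<lambda>n. F n x) \<longlonglongrightarrow> f x" and g: "(\<lambda>n. G n x) \<longlonglongrightarrow> g x" if "x \<in> ?I" for x
    using limits(1)[of F x] limits(1)[of G x] step[OF that] unfolding f_def g_def
    by (auto simp: convergent_LIMSEQ_iff[symmetric] convergent_def)
  have bound: "cmod (F n x) \<le> C + C * exp \<bar>w x\<bar>" "cmod (G n x) \<le> C + C * exp \<bar>w x\<bar>" if "x \<in> ?I" for n x
  proof -
    have "cmod (F 0 x) \<le> C" "cmod (G 0 x) \<le> C" by (simp_all add: F0 G0 C_def)
    moreover have "cmod (F n x) \<le> cmod (F 0 x) + C * exp \<bar>w x\<bar>" "cmod (G n x) \<le> cmod (G 0 x) + C * exp \<bar>w x\<bar>"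
      by (intro limits(2) conjunct1[OF step[OF that]] conjunct2[OF step[OF that]])+
    ultimately show "cmod (F n x) \<le> C + C * exp \<bar>w x\<bar>" "cmod (G n x) \<le> C + C * exp \<bar>w x\<bar>"
      by linarith+
  qed
  have pass: "primitive a b h (\<lambda>x. k x * h' x)"
    if k: "locally_integrable a b k" and P: "\<And>n. primitive a b (H (Suc n)) (\<lambda>x. k x * H' n x)"
      and H: "\<And>x. x \<in> ?I \<Longrightarrow> (\<lambda>n. H n x) \<longlonglongrightarrow> h x" and H': "\<And>x. x \<in> ?I \<Longrightarrow> (\<lambda>n. H' n x) \<longlonglongrightarrow> h' x"
      and H'_bound: "\<And>n x. x \<in> ?I \<Longrightarrow> cmod (H' n x) \<le> C + C * exp \<bar>w x\<bar>"
    for k h h' H H'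
  proof (rule primitiveI)
    fix x y assume xy: "x \<in> ?I" "y \<in> ?I" "x \<le> y"
    define K where "K = C + C * exp (max \<bar>w x\<bar> \<bar>w y\<bar>)"
    have mem: "t \<in> ?I" if "t \<in> {x..y}" for t using Icc_subset_einterval[OF xy(1,2)] that by blast
    have H'K: "cmod (H' n t) \<le> K" if t: "t \<in> {x..y}" for n t
    proof -
      have "\<bar>w t\<bar> \<le> max \<bar>w x\<bar> \<bar>w y\<bar>"
        using w_mono[OF xy(1) mem[OF t]] w_mono[OF mem[OF t] xy(2)] t by auto
      then have "C * exp \<bar>w t\<bar> \<le> C * exp (max \<bar>w x\<bar> \<bar>w y\<bar>)" by (intro mult_left_mono) (auto simp: C_def)
      then show ?thesis using H'_bound[OF mem[OF t], of n] unfolding K_def by linarith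
    qed
    have h'K: "cmod (h' t) \<le> K" if t: "t \<in> {x..y}" for t
      using tendsto_norm[OF H'[OF mem[OF t]]] H'K[OF t] by (intro LIMSEQ_le_const2) auto
    have kK: "(\<lambda>t. cmod (k t) * K) integrable_on {x..y}"
      using set_lebesgue_integral_eq_integral(1)[OF set_integrable_norm[OF locally_integrableD(1)[OF k xy(1,2)]]]
      by (rule integrable_on_mult_left)
    have conv: "(\<lambda>n. k t * H' n t) \<longlonglongrightarrow> k t * h' t" if "t \<in> {x..y}" for t
      by (intro tendsto_intros H' mem that)
    note PD = primitiveD[OF P xy]
    have "(\<lambda>n. integral {x..y} (\<lambda>t. k t * H' n t)) \<longlonglongrightarrow> integral {x..y} (\<lambda>t. k t * h' t)"
      by (rule dominated_convergence(2)[OF PD(2) kK _ conv]) (use H'K in \<open>auto simp: norm_mult intro!: mult_left_mono\<close>)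
    moreover have "(\<lambda>n. integral {x..y} (\<lambda>t. k t * H' n t)) \<longlonglongrightarrow> h y - h x"
      unfolding PD(3)[symmetric] by (intro tendsto_diff LIMSEQ_Suc H xy)
    ultimately have "h y - h x = integral {x..y} (\<lambda>t. k t * h' t)" using LIMSEQ_unique by blast
    moreover have "(\<lambda>t. k t * h' t) absolutely_integrable_on {x..y}"
      by (rule dominated_convergence_absolutely_integrable[OF PD(1) kK _ conv])
        (use h'K in \<open>auto simp: norm_mult intro!: mult_left_mono\<close>)
    ultimately show "(\<lambda>t. k t * h' t) absolutely_integrable_on {x..y} \<and> h y - h x = integral {x..y} (\<lambda>t. k t * h' t)"
      by blast
  qed
  have "F n c0 = \<alpha>" "G n c0 = \<beta>" for n
    by (cases n; simp add: F0 G0 PF(1) PG(1))+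
  then have "f c0 = \<alpha>" "g c0 = \<beta>" by (simp_all add: f_def g_def)
  moreover have "primitive a b f (\<lambda>x. A x * g x)"
    by (rule pass[OF A PF(2) f g bound(2)])
  moreover have "primitive a b g (\<lambda>x. B x * f x)"
    by (rule pass[OF B PG(2) g f bound(1)])
  ultimately show thesis using that by blast
qed

section \<open>Boundary values\<close>

lemma primitive_eq_set_integral:
  assumes F: "primitive a b F \<phi>" and xy: "x \<in> einterval a b" "y \<in> einterval a b" "x \<le> y"
  shows "F y - F x = (LINT t:{x..y}|lebesgue. \<phi> t)"
  using primitiveD[OF F xy] set_lebesgue_integral_eq_integral(2) by metis

lemma set_integral_tendsto_eventually_eq:
  fixes \<phi> :: "real \<Rightarrow> complex"
  assumes int: "set_integrable lebesgue S \<phi>" and A: "\<And>n. A n \<in> sets lebesgue" "\<And>n. A n \<subseteq> S"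
    and B: "B \<in> sets lebesgue" "B \<subseteq> S"
    and ev: "\<And>t. t \<in> S \<Longrightarrow> eventually (\<lambda>n. t \<in> A n \<longleftrightarrow> t \<in> B) sequentially"
  shows "(\<lambda>n. LINT t:A n|lebesgue. \<phi> t) \<longlonglongrightarrow> (LINT t:B|lebesgue. \<phi> t)"
  unfolding set_lebesgue_integral_def
proof (rule integral_dominated_convergence)
  show "integrable lebesgue (\<lambda>t. norm (indicator S t *\<^sub>R \<phi> t))"
    using int unfolding set_integrable_def by (rule integrable_norm)
  show "AE t in lebesgue. norm (indicator (A n) t *\<^sub>R \<phi> t) \<le> norm (indicator S t *\<^sub>R \<phi> t)" for n
    by (rule AE_I2) (use A(2)[of n] in \<open>auto simp: indicator_def\<close>)
  show "AE t in lebesgue. (\<lambda>n. indicator (A n) t *\<^sub>R \<phi> t) \<longlonglongrightarrow> indicator B t *\<^sub>R \<phi> t"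
  proof (rule AE_I2, rule tendsto_eventually)
    fix t
    have "eventually (\<lambda>n. t \<in> A n \<longleftrightarrow> t \<in> B) sequentially"
    proof (cases "t \<in> S")
      case False
      then have "t \<notin> A n" "t \<notin> B" for n using A(2) B(2) by blast+
      then show ?thesis by simp
    qed (rule ev)
    then show "eventually (\<lambda>n. indicator (A n) t *\<^sub>R \<phi> t = indicator B t *\<^sub>R \<phi> t) sequentially"
      by eventually_elim (simp add: indicator_def)
  qed
  show "(\<lambda>t. indicator (A n) t *\<^sub>R \<phi> t) \<in> borel_measurable lebesgue" for n
    using set_integrable_subset[OF int A] by (simp add: set_integrable_def)
  show "(\<lambda>t. indicator B t *\<^sub>R \<phi> t) \<in> borel_measurable lebesgue"
    using set_integrable_subset[OF int B] by (simp add: set_integrable_def)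
qed

lemma primitive_tendsto_right_end:
  assumes F: "primitive a b F \<phi>" and int: "set_integrable lebesgue (einterval a b) \<phi>"
    and c: "c \<in> einterval a b"
  shows "((\<lambda>x. F (real_of_ereal x)) \<longlongrightarrow> F c + (LINT t:einterval a b \<inter> {c..}|lebesgue. \<phi> t)) (at_left b)"
proof (rule tendsto_at_left_sequentially)
  show "ereal c < b" using c by (simp add: einterval_iff)
  fix S assume S: "\<And>n. S n < b" "\<And>n. ereal c < S n" "S \<longlonglongrightarrow> b"
  define s where "s n = real_of_ereal (S n)" for n
  have Ss: "S n = ereal (s n)" for n
    using S(1,2)[of n] unfolding s_def by (cases "S n") auto
  have s: "s n \<in> einterval a b" "c \<le> s n" for n
    using S(1,2)[of n] c unfolding Ss einterval_iff by (auto intro: less_trans)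
  have "(\<lambda>n. LINT t:{c..s n}|lebesgue. \<phi> t) \<longlonglongrightarrow> (LINT t:einterval a b \<inter> {c..}|lebesgue. \<phi> t)"
  proof (rule set_integral_tendsto_eventually_eq[OF int _ Icc_subset_einterval[OF c s(1)]])
    fix t assume t: "t \<in> einterval a b"
    then have "eventually (\<lambda>n. ereal t < S n) sequentially"
      using S(3) by (intro order_tendstoD(1)) (auto simp: einterval_iff)
    then show "eventually (\<lambda>n. t \<in> {c..s n} \<longleftrightarrow> t \<in> einterval a b \<inter> {c..}) sequentially"
      by eventually_elim (use t in \<open>auto simp: Ss\<close>)
  qed auto
  from tendsto_add[OF tendsto_const this, of "F c"]
  show "(\<lambda>n. F (real_of_ereal (S n))) \<longlonglongrightarrow> F c + (LINT t:einterval a b \<inter> {c..}|lebesgue. \<phi> t)"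
    unfolding primitive_eq_set_integral[OF F c s, symmetric] by (simp add: Ss)
qed

lemma primitive_tendsto_left_end:
  assumes F: "primitive a b F \<phi>" and int: "set_integrable lebesgue (einterval a b) \<phi>"
    and c: "c \<in> einterval a b"
  shows "((\<lambda>x. F (real_of_ereal x)) \<longlongrightarrow> F c - (LINT t:einterval a b \<inter> {..c}|lebesgue. \<phi> t)) (at_right a)"
proof (rule tendsto_at_right_sequentially)
  show "a < ereal c" using c by (simp add: einterval_iff)
  fix S assume S: "\<And>n. a < S n" "\<And>n. S n < ereal c" "S \<longlonglongrightarrow> a"
  define s where "s n = real_of_ereal (S n)" for n
  have Ss: "S n = ereal (s n)" for n
    using S(1,2)[of n] unfolding s_def by (cases "S n") auto
  have s: "s n \<in> einterval a b" "s n \<le> c" for n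
    using S(1,2)[of n] less_trans[OF S(2)[of n], of b] c unfolding Ss einterval_iff by auto
  have "(\<lambda>n. LINT t:{s n..c}|lebesgue. \<phi> t) \<longlonglongrightarrow> (LINT t:einterval a b \<inter> {..c}|lebesgue. \<phi> t)"
  proof (rule set_integral_tendsto_eventually_eq[OF int _ Icc_subset_einterval[OF s(1) c]])
    fix t assume t: "t \<in> einterval a b"
    then have "eventually (\<lambda>n. S n < ereal t) sequentially"
      using S(3) by (intro order_tendstoD(2)) (auto simp: einterval_iff)
    then show "eventually (\<lambda>n. t \<in> {s n..c} \<longleftrightarrow> t \<in> einterval a b \<inter> {..c}) sequentially"
      by eventually_elim (use t in \<open>auto simp: Ss\<close>)
  qed auto
  from tendsto_diff[OF tendsto_const this, of "F c"]
  show "(\<lambda>n. F (real_of_ereal (S n))) \<longlonglongrightarrow> F c - (LINT t:einterval a b \<inter> {..c}|lebesgue. \<phi> t)"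
    unfolding primitive_eq_set_integral[OF F s(1) c s(2), symmetric] by (simp add: Ss)
qed

text \<open>
  A primitive of a function that is integrable up to the endpoints has limits there, by dominated
  convergence along sequences.  The filters live on the extended reals, so that finite and
  infinite endpoints are treated alike.
\<close>
lemma primitive_limits:
  assumes F: "primitive a b F \<phi>" and int: "integrable (lebesgue_on (einterval a b)) \<phi>" and "a < b"
  obtains la lb where "((\<lambda>x. F (real_of_ereal x)) \<longlongrightarrow> la) (at_right a)"
    "((\<lambda>x. F (real_of_ereal x)) \<longlongrightarrow> lb) (at_left b)"
    "lb - la = integral\<^sup>L (lebesgue_on (einterval a b)) \<phi>"
proof -
  let ?I = "einterval a b"
  obtain c where c: "c \<in> ?I" using einterval_nonempty[OF \<open>a < b\<close>] by blast
  have int': "set_integrable lebesgue ?I \<phi>"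
    using int by (simp add: set_integrable_def integrable_restrict_space)
  have sub: "set_integrable lebesgue (?I \<inter> {c..}) \<phi>" "set_integrable lebesgue (?I \<inter> {..c}) \<phi>"
    by (rule set_integrable_subset[OF int']; auto)+
  have "(LINT t:(?I \<inter> {..c}) \<union> (?I \<inter> {c..})|lebesgue. \<phi> t) =
      (LINT t:?I \<inter> {..c}|lebesgue. \<phi> t) + (LINT t:?I \<inter> {c..}|lebesgue. \<phi> t)"
  proof (rule set_integral_Un_AE[OF _ _ _ sub(2,1)])
    have "negligible {c}" by simp
    then show "AE x in lebesgue. \<not> (x \<in> ?I \<inter> {..c} \<and> x \<in> ?I \<inter> {c..})"
      unfolding eventually_ae_filter_negligible by (intro exI[of _ "{c}"]) auto
  qed auto
  moreover have "(?I \<inter> {..c}) \<union> (?I \<inter> {c..}) = ?I" by auto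
  ultimately have "(LINT t:?I|lebesgue. \<phi> t) =
      (LINT t:?I \<inter> {..c}|lebesgue. \<phi> t) + (LINT t:?I \<inter> {c..}|lebesgue. \<phi> t)" by simp
  moreover have "(LINT t:?I|lebesgue. \<phi> t) = integral\<^sup>L (lebesgue_on ?I) \<phi>"
    by (simp add: set_lebesgue_integral_def integral_restrict_space)
  ultimately show thesis
    using that[OF primitive_tendsto_left_end[OF F int' c] primitive_tendsto_right_end[OF F int' c]] by simp
qed

context sturm_liouville
begin

abbreviation "br \<equiv> bracket a b p"
abbreviation "br_lim \<equiv> bracket_lim a b p"
abbreviation "br_a \<equiv> br_lim (at_right a)"
abbreviation "br_b \<equiv> br_lim (at_left b)"

definition endpoint :: "ereal filter \<Rightarrow> bool" where
  "endpoint F \<longleftrightarrow> F = at_right a \<or> F = at_left b"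

lemma endpoints [simp]: "endpoint (at_right a)" "endpoint (at_left b)"
  by (simp_all add: endpoint_def)

lemma endpoint_nontrivial: "endpoint F \<Longrightarrow> F \<noteq> bot"
  unfolding endpoint_def eventually_False[symmetric]
  using eventually_at_right[OF less, of "\<lambda>_. False"] eventually_at_left[OF less, of "\<lambda>_. False"]
  by (metis dense)

lemma eventually_endpoint:
  assumes "endpoint F" shows "eventually (\<lambda>x. real_of_ereal x \<in> I) F"
proof -
  have "real_of_ereal x \<in> I" if "a < x" "x < b" for x
    using that by (cases x) (auto simp: einterval_iff)
  then have "eventually (\<lambda>x. real_of_ereal x \<in> I) (at_right a)" "eventually (\<lambda>x. real_of_ereal x \<in> I) (at_left b)"
    unfolding eventually_at_right[OF less] eventually_at_left[OF less] using less by blast+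
  then show ?thesis using assms unfolding endpoint_def by blast
qed

text \<open>
  Lagrange's identity over the whole interval; for square integrable functions its right-hand side is
  integrable up to the endpoints.
\<close>
lemma lagrange_limits:
  assumes f: "f \<in> domain_max" and g: "g \<in> domain_max"
  shows "((\<lambda>x. br f g (real_of_ereal x)) \<longlongrightarrow> br_a f g) (at_right a)"
    and "((\<lambda>x. br f g (real_of_ereal x)) \<longlongrightarrow> br_b f g) (at_left b)"
    and "br_b f g - br_a f g = l2_inner M g (\<tau> f) - l2_inner M (\<tau> g) f"
proof -
  note f = domain_maxD[OF f] and g = domain_maxD[OF g]
  let ?k = "\<lambda>x. cnj (g x) * \<tau> f x - cnj (\<tau> g x) * f x"
  have P: "primitive a b (br f g) (\<lambda>x. of_real (r x) * ?k x)"
    using lagrange_identity[OF f(1) g(1)] by (simp add: bracket_def[abs_def])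
  have k: "integrable M ?k"
    by (intro Bochner_Integration.integrable_diff L2_inner_integrable f g)
  then have k': "integrable (lebesgue_on I) (\<lambda>x. of_real (r x) * ?k x)"
    "integral\<^sup>L (lebesgue_on I) (\<lambda>x. of_real (r x) * ?k x) = integral\<^sup>L M ?k"
    using integrable_M_iff[of ?k] by auto
  obtain la lb where l: "((\<lambda>x. br f g (real_of_ereal x)) \<longlongrightarrow> la) (at_right a)"
    "((\<lambda>x. br f g (real_of_ereal x)) \<longlongrightarrow> lb) (at_left b)"
    "lb - la = integral\<^sup>L (lebesgue_on I) (\<lambda>x. of_real (r x) * ?k x)"
    using primitive_limits[OF P k'(1) less] by blast
  have eq: "br_a f g = la" "br_b f g = lb"
    unfolding bracket_lim_def
    using tendsto_Lim[OF endpoint_nontrivial l(1)] tendsto_Lim[OF endpoint_nontrivial l(2)] by auto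
  show "((\<lambda>x. br f g (real_of_ereal x)) \<longlongrightarrow> br_a f g) (at_right a)"
    "((\<lambda>x. br f g (real_of_ereal x)) \<longlongrightarrow> br_b f g) (at_left b)"
    using l(1,2) eq by auto
  have "integral\<^sup>L M ?k = l2_inner M g (\<tau> f) - l2_inner M (\<tau> g) f"
    unfolding l2_inner_def
    by (intro Bochner_Integration.integral_diff L2_inner_integrable f g)
  then show "br_b f g - br_a f g = l2_inner M g (\<tau> f) - l2_inner M (\<tau> g) f"
    using l(3) k'(2) eq by simp
qed

lemma br_tendsto:
  assumes "endpoint F" "f \<in> domain_max" "g \<in> domain_max"
  shows "((\<lambda>x. br f g (real_of_ereal x)) \<longlongrightarrow> br_lim F f g) F"
  using assms lagrange_limits unfolding endpoint_def by auto

lemma br_lim_eqI: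
  assumes F: "endpoint F" and eq: "\<And>x. x \<in> I \<Longrightarrow> br f g x = k x"
    and k: "((\<lambda>x. k (real_of_ereal x)) \<longlongrightarrow> l) F"
  shows "br_lim F f g = l"
  unfolding bracket_lim_def
proof (rule tendsto_Lim[OF endpoint_nontrivial[OF F]])
  have "eventually (\<lambda>x. k (real_of_ereal x) = br f g (real_of_ereal x)) F"
    using eventually_endpoint[OF F] by eventually_elim (simp add: eq)
  then show "((\<lambda>x. br f g (real_of_ereal x)) \<longlongrightarrow> l) F" using k by (rule Lim_transform_eventually[rotated])
qed

lemma quasi_deriv_unique:
  assumes "f \<in> sl_domain a b p" "system g g' k" "\<And>x. x \<in> I \<Longrightarrow> f x = g x"
  shows "\<And>x. x \<in> I \<Longrightarrow> qd f x = g' x" "ae (\<lambda>x. \<tau> f x = k x)"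
proof -
  have "ae (\<lambda>x. f x = g x)" by (auto simp: AE_einterval_iff assms(3) intro: exI[of _ "{}"])
  from system_unique(2,3)[OF system_quasi_deriv[OF assms(1)] assms(2) this]
  show "\<And>x. x \<in> I \<Longrightarrow> qd f x = g' x" "ae (\<lambda>x. \<tau> f x = k x)" by blast+
qed

lemma domain_max_combination:
  assumes f: "f \<in> domain_max" and g: "g \<in> domain_max"
  shows "(\<lambda>x. c * f x + d * g x) \<in> domain_max"
    and "\<And>x. x \<in> I \<Longrightarrow> qd (\<lambda>x. c * f x + d * g x) x = c * qd f x + d * qd g x"
    and "ae (\<lambda>x. \<tau> (\<lambda>x. c * f x + d * g x) x = c * \<tau> f x + d * \<tau> g x)"
proof -
  note f = domain_maxD[OF f] and g = domain_maxD[OF g]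
  have sys: "system (\<lambda>x. c * f x + d * g x) (\<lambda>x. c * qd f x + d * qd g x) (\<lambda>x. c * \<tau> f x + d * \<tau> g x)"
    by (intro system_add system_cmult f g)
  then show "(\<lambda>x. c * f x + d * g x) \<in> domain_max"
    by (rule domain_maxI) (intro L2_add L2_cmult f g)+
  show "\<And>x. x \<in> I \<Longrightarrow> qd (\<lambda>x. c * f x + d * g x) x = c * qd f x + d * qd g x"
    and "ae (\<lambda>x. \<tau> (\<lambda>x. c * f x + d * g x) x = c * \<tau> f x + d * \<tau> g x)"
    using system_imp_sl_domain[OF sys] by blast+
qed

lemma domain_max_cnj:
  assumes f: "f \<in> domain_max"
  shows "(\<lambda>x. cnj (f x)) \<in> domain_max"
    and "\<And>x. x \<in> I \<Longrightarrow> qd (\<lambda>x. cnj (f x)) x = cnj (qd f x)"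
    and "ae (\<lambda>x. \<tau> (\<lambda>x. cnj (f x)) x = cnj (\<tau> f x))"
proof -
  note f = domain_maxD[OF f]
  have sys: "system (\<lambda>x. cnj (f x)) (\<lambda>x. cnj (qd f x)) (\<lambda>x. cnj (\<tau> f x))"
    by (intro system_cnj f)
  then show "(\<lambda>x. cnj (f x)) \<in> domain_max"
    by (rule domain_maxI) (intro L2_cnj f)+
  show "\<And>x. x \<in> I \<Longrightarrow> qd (\<lambda>x. cnj (f x)) x = cnj (qd f x)"
    and "ae (\<lambda>x. \<tau> (\<lambda>x. cnj (f x)) x = cnj (\<tau> f x))"
    using system_imp_sl_domain[OF sys] by blast+
qed

lemma br_lim_combination:
  assumes F: "endpoint F" and f: "f \<in> domain_max" and g: "g \<in> domain_max" and h: "h \<in> domain_max"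
  shows "br_lim F (\<lambda>x. c * f x + d * g x) h = c * br_lim F f h + d * br_lim F g h"
proof (rule br_lim_eqI[OF F])
  show "br (\<lambda>x. c * f x + d * g x) h x = c * br f h x + d * br g h x" if "x \<in> I" for x
    using domain_max_combination(2)[OF f g that] by (simp add: bracket_def algebra_simps)
  show "((\<lambda>x. c * br f h (real_of_ereal x) + d * br g h (real_of_ereal x)) \<longlongrightarrow>
      c * br_lim F f h + d * br_lim F g h) F"
    by (intro tendsto_intros br_tendsto F f g h)
qed

lemma br_lim_antisym:
  assumes F: "endpoint F" and f: "f \<in> domain_max" and g: "g \<in> domain_max"
  shows "br_lim F g f = - cnj (br_lim F f g)"
proof (rule br_lim_eqI[OF F])
  show "br g f x = - cnj (br f g x)" for x by (simp add: bracket_def)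
  show "((\<lambda>x. - cnj (br f g (real_of_ereal x))) \<longlongrightarrow> - cnj (br_lim F f g)) F"
    by (intro tendsto_minus tendsto_cnj br_tendsto F f g)
qed

lemma br_lim_cnj:
  assumes F: "endpoint F" and f: "f \<in> domain_max" and g: "g \<in> domain_max"
  shows "br_lim F (\<lambda>x. cnj (f x)) (\<lambda>x. cnj (g x)) = cnj (br_lim F f g)"
proof (rule br_lim_eqI[OF F])
  show "br (\<lambda>x. cnj (f x)) (\<lambda>x. cnj (g x)) x = cnj (br f g x)" if "x \<in> I" for x
    using domain_max_cnj(2)[OF f that] domain_max_cnj(2)[OF g that] by (simp add: bracket_def)
  show "((\<lambda>x. cnj (br f g (real_of_ereal x))) \<longlongrightarrow> cnj (br_lim F f g)) F"
    by (intro tendsto_cnj br_tendsto F f g)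
qed

lemma br_lim_cong:
  assumes F: "endpoint F" and "f \<in> domain_max" "f' \<in> domain_max" "g \<in> domain_max" "g' \<in> domain_max"
    and eq: "\<And>x. x \<in> I \<Longrightarrow> f x = f' x" "\<And>x. x \<in> I \<Longrightarrow> g x = g' x"
  shows "br_lim F f g = br_lim F f' g'"
proof (rule br_lim_eqI[OF F])
  show "br f g x = br f' g' x" if "x \<in> I" for x
  proof -
    have dom: "f \<in> sl_domain a b p" "g \<in> sl_domain a b p" using assms by (auto simp: dom_max_def)
    have "qd f x = qd f' x"
      by (rule quasi_deriv_unique(1)[OF dom(1) domain_maxD(1)[OF assms(3)] eq(1) that])
    moreover have "qd g x = qd g' x"
      by (rule quasi_deriv_unique(1)[OF dom(2) domain_maxD(1)[OF assms(5)] eq(2) that])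
    ultimately show ?thesis using eq that by (simp add: bracket_def)
  qed
  show "((\<lambda>x. br f' g' (real_of_ereal x)) \<longlongrightarrow> br_lim F f' g') F"
    by (intro br_tendsto assms)
qed

text \<open>
  The bracket is the symplectic form of the vectors of function and quasi-derivative, with the second
  one conjugated.  The real functions \<open>\<phi>\<close> and \<open>\<psi>\<close> give a basis of the plane wherever their bracket is
  nonzero, and expanding f in it gives the Pluecker identity.  The identity holds at every point of the
  interval, with an additional factor \<open>[\<psi>, \<phi>]\<close> that tends to 1.
\<close>
lemma br_pluecker:
  assumes F: "endpoint F" and basis: "bc_basis a b p q r F \<phi> \<psi>"
    and f: "f \<in> domain_max" and g: "g \<in> domain_max"
  shows "br_lim F f g = br_lim F f \<psi> * cnj (br_lim F g \<phi>) - br_lim F f \<phi> * cnj (br_lim F g \<psi>)"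
proof -
  have B: "\<phi> \<in> domain_max" "\<psi> \<in> domain_max" "br_lim F \<psi> \<phi> = 1"
    and real: "\<And>x. x \<in> I \<Longrightarrow> \<phi> x \<in> \<real>" "\<And>x. x \<in> I \<Longrightarrow> \<psi> x \<in> \<real>"
    using basis by (auto simp: bc_basis_def)
  have qd_real: "qd k x = cnj (qd k x)" if k: "k \<in> domain_max" "\<And>x. x \<in> I \<Longrightarrow> k x \<in> \<real>" and x: "x \<in> I" for k x
  proof -
    have "k \<in> sl_domain a b p" using k(1) by (auto simp: dom_max_def)
    moreover have "k x = cnj (k x)" if "x \<in> I" for x using k(2)[OF that] by (simp add: Reals_cnj_iff)
    ultimately show ?thesis
      using quasi_deriv_unique(1)[OF _ system_cnj[OF domain_maxD(1)[OF k(1)]] _ x] by blast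
  qed
  have pointwise: "br \<psi> \<phi> x * br f g x = - br f \<phi> x * cnj (br g \<psi> x) + br f \<psi> x * cnj (br g \<phi> x)" if x: "x \<in> I" for x
  proof -
    have c: "cnj (\<phi> x) = \<phi> x" "cnj (\<psi> x) = \<psi> x" "cnj (qd \<phi> x) = qd \<phi> x" "cnj (qd \<psi> x) = qd \<psi> x"
      using qd_real[OF B(1) real(1) x] qd_real[OF B(2) real(2) x] real x by (auto simp: Reals_cnj_iff)
    show ?thesis unfolding bracket_def by (simp add: c algebra_simps)
  qed
  have 1: "((\<lambda>x. br \<psi> \<phi> (real_of_ereal x) * br f g (real_of_ereal x)) \<longlongrightarrow> br_lim F \<psi> \<phi> * br_lim F f g) F"
    by (intro tendsto_mult br_tendsto F B f g)
  have 2: "((\<lambda>x. - br f \<phi> (real_of_ereal x) * cnj (br g \<psi> (real_of_ereal x)) +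
       br f \<psi> (real_of_ereal x) * cnj (br g \<phi> (real_of_ereal x))) \<longlongrightarrow>
       - br_lim F f \<phi> * cnj (br_lim F g \<psi>) + br_lim F f \<psi> * cnj (br_lim F g \<phi>)) F"
    by (intro tendsto_intros br_tendsto F B f g)
  have 3: "eventually (\<lambda>x. br \<psi> \<phi> (real_of_ereal x) * br f g (real_of_ereal x) =
       - br f \<phi> (real_of_ereal x) * cnj (br g \<psi> (real_of_ereal x)) +
       br f \<psi> (real_of_ereal x) * cnj (br g \<phi> (real_of_ereal x))) F"
    using eventually_endpoint[OF F] by eventually_elim (rule pointwise)
  have "br_lim F \<psi> \<phi> * br_lim F f g =
       - br_lim F f \<phi> * cnj (br_lim F g \<psi>) + br_lim F f \<psi> * cnj (br_lim F g \<phi>)"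
    by (rule tendsto_unique[OF endpoint_nontrivial[OF F] Lim_transform_eventually[OF 1 3] 2])
  then show ?thesis using B(3) by simp
qed

end

section \<open>The minimal operator in the limit circle case\<close>

context sturm_liouville
begin

lemma l2_inner_combination_right:
  assumes "f \<in> L2 M" "g \<in> L2 M" "h \<in> L2 M"
  shows "l2_inner M f (\<lambda>x. c * g x + d * h x) = c * l2_inner M f g + d * l2_inner M f h"
  using l2_inner_add_right[OF assms(1) L2_cmult[OF assms(2)] L2_cmult[OF assms(3)], of c d]
  by (simp add: l2_inner_cmult_right)

lemma l2_inner_combination_left:
  assumes "f \<in> L2 M" "g \<in> L2 M" "h \<in> L2 M"
  shows "l2_inner M (\<lambda>x. c * g x + d * h x) f = cnj c * l2_inner M g f + cnj d * l2_inner M h f"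
  unfolding l2_inner_commute[of _ f] l2_inner_combination_right[OF assms] by simp

lemma L2_combination: "f \<in> L2 M \<Longrightarrow> g \<in> L2 M \<Longrightarrow> (\<lambda>x. c * f x + d * g x) \<in> L2 M"
  by (intro L2_add L2_cmult)

lemma L2_zero: "(\<lambda>_. 0) \<in> L2 M"
  by (simp add: L2_def)

lemma L2_orthogonal_component:
  assumes "v \<in> L2 M" "w \<in> L2 M"
  obtains c where "l2_inner M v (\<lambda>x. 1 * w x + c * v x) = 0"
proof (cases "l2_inner M v v = 0")
  case True
  from l2_inner_self_eq_0[OF assms(1) this]
  have "l2_inner M v w = l2_inner M (\<lambda>_. 0) w"
    using assms by (intro l2_inner_cong_AE) auto
  then have "l2_inner M v w = 0" by (simp add: l2_inner_def)
  then show thesis using that[of 0] by simp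
next
  case False
  show thesis
    by (rule that[of "- l2_inner M v w / l2_inner M v v"])
      (subst l2_inner_combination_right[OF assms(1,2,1)], use False in simp)
qed

text \<open>
  Gram-Schmidt: let k be the component of w orthogonal to v1 and v2.  Then k is orthogonal to w by
  assumption, hence to itself.
\<close>
lemma L2_biorthogonal_imp_span:
  assumes v1: "v1 \<in> L2 M" and v2: "v2 \<in> L2 M" and w: "w \<in> L2 M"
    and orth: "\<And>k. k \<in> L2 M \<Longrightarrow> l2_inner M v1 k = 0 \<Longrightarrow> l2_inner M v2 k = 0 \<Longrightarrow> l2_inner M w k = 0"
  obtains c d where "ae (\<lambda>x. w x = c * v1 x + d * v2 x)"
proof -
  obtain \<alpha> where \<alpha>: "l2_inner M v1 (\<lambda>x. 1 * v2 x + \<alpha> * v1 x) = 0" using L2_orthogonal_component[OF v1 v2] .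
  define v3 where "v3 = (\<lambda>x. 1 * v2 x + \<alpha> * v1 x)"
  have v3: "v3 \<in> L2 M" unfolding v3_def by (intro L2_combination v1 v2)
  obtain \<beta> where \<beta>: "l2_inner M v1 (\<lambda>x. 1 * w x + \<beta> * v1 x) = 0" using L2_orthogonal_component[OF v1 w] .
  define w1 where "w1 = (\<lambda>x. 1 * w x + \<beta> * v1 x)"
  have w1: "w1 \<in> L2 M" unfolding w1_def by (intro L2_combination v1 w)
  obtain \<gamma> where \<gamma>: "l2_inner M v3 (\<lambda>x. 1 * w1 x + \<gamma> * v3 x) = 0" using L2_orthogonal_component[OF v3 w1] .
  define k where "k = (\<lambda>x. 1 * w1 x + \<gamma> * v3 x)"
  have k: "k \<in> L2 M" unfolding k_def by (intro L2_combination v3 w1)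
  have k1: "l2_inner M v1 k = 0"
    using \<alpha> \<beta> unfolding k_def l2_inner_combination_right[OF v1 w1 v3] by (simp add: v3_def w1_def)
  have k3: "l2_inner M v3 k = 0" using \<gamma> unfolding k_def .
  have k2: "l2_inner M v2 k = 0"
    using k1 k3 unfolding v3_def l2_inner_combination_left[OF k v2 v1] by simp
  have kw: "l2_inner M w k = 0" using orth[OF k k1 k2] .
  have kw1: "l2_inner M w1 k = 0"
    using kw k1 unfolding w1_def l2_inner_combination_left[OF k w v1] by simp
  have "l2_inner M (\<lambda>x. 1 * w1 x + \<gamma> * v3 x) k = 0"
    unfolding l2_inner_combination_left[OF k w1 v3] using kw1 k3 by simp
  then have "ae (\<lambda>x. k x = 0)" using l2_inner_self_eq_0[OF k] by (simp add: k_def)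
  then have "ae (\<lambda>x. w x = (- \<beta> - \<gamma> * \<alpha>) * v1 x + (- \<gamma>) * v2 x)"
    by eventually_elim (simp add: k_def w1_def v3_def algebra_simps eq_neg_iff_add_eq_0)
  then show thesis by (rule that)
qed

lemma sl_operator_iff:
  "(f, h) \<in> sl_operator a b p q r S \<longleftrightarrow>
     f \<in> L2 M \<and> h \<in> L2 M \<and> (\<exists>g\<in>S. ae (\<lambda>x. f x = g x) \<and> ae (\<lambda>x. h x = \<tau> g x))"
  by (simp add: sl_operator_def AE_M_iff)

lemma integrable_imp_locally_integrable:
  assumes "integrable (lebesgue_on I) \<phi>" shows "locally_integrable a b \<phi>"
proof -
  have "set_integrable lebesgue I \<phi>"
    using assms by (simp add: set_integrable_def integrable_restrict_space)
  then show ?thesis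
    unfolding locally_integrable_def by (auto intro: set_integrable_subset)
qed

text \<open>
  The bound is the value at one point plus the total integral of \<open>|\<phi>|\<close>.
\<close>
lemma primitive_bounded_of_integrable:
  assumes F: "primitive a b F \<phi>" and int: "integrable (lebesgue_on I) \<phi>"
  obtains C where "\<And>x. x \<in> I \<Longrightarrow> cmod (F x) \<le> C"
proof -
  obtain c where c: "c \<in> I" using einterval_nonempty[OF less] by blast
  have int': "set_integrable lebesgue I \<phi>"
    using int by (simp add: set_integrable_def integrable_restrict_space)
  define N where "N = (LINT t:I|lebesgue. cmod (\<phi> t))"
  have le: "cmod (F y - F x) \<le> N" if xy: "x \<in> I" "y \<in> I" "x \<le> y" for x y
  proof -
    have sub: "set_integrable lebesgue {x..y} \<phi>"
      by (rule set_integrable_subset[OF int']) (use Icc_subset_einterval[OF xy(1,2)] in auto)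
    have "cmod (F y - F x) \<le> (LINT t:{x..y}|lebesgue. cmod (\<phi> t))"
      unfolding primitive_eq_set_integral[OF F xy] by (rule set_integral_norm_bound[OF sub])
    also have "\<dots> \<le> N"
      unfolding N_def set_lebesgue_integral_def
    proof (rule integral_mono)
      show "integrable lebesgue (\<lambda>t. indicator {x..y} t *\<^sub>R cmod (\<phi> t))"
        using set_integrable_norm[OF sub] by (simp add: set_integrable_def)
      show "integrable lebesgue (\<lambda>t. indicator I t *\<^sub>R cmod (\<phi> t))"
        using set_integrable_norm[OF int'] by (simp add: set_integrable_def)
      show "indicator {x..y} t *\<^sub>R cmod (\<phi> t) \<le> indicator I t *\<^sub>R cmod (\<phi> t)" for t
        using Icc_subset_einterval[OF xy(1,2)] by (auto simp: indicator_def)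
    qed
    finally show ?thesis .
  qed
  have "cmod (F x) \<le> cmod (F c) + N" if x: "x \<in> I" for x
  proof -
    have "cmod (F x - F c) \<le> N"
      using le[OF c x] le[OF x c] by (cases "c \<le> x") (auto simp: norm_minus_commute)
    then show ?thesis using norm_triangle_sub[of "F x" "F c"] by linarith
  qed
  then show thesis by (rule that)
qed

lemma primitive_from_left_end:
  assumes int: "integrable (lebesgue_on I) \<phi>"
  obtains F C where "primitive a b F \<phi>" "((\<lambda>x. F (real_of_ereal x)) \<longlongrightarrow> 0) (at_right a)"
    "((\<lambda>x. F (real_of_ereal x)) \<longlongrightarrow> integral\<^sup>L (lebesgue_on I) \<phi>) (at_left b)"
    "\<And>x. x \<in> I \<Longrightarrow> cmod (F x) \<le> C"
proof -
  obtain c where c: "c \<in> I" using einterval_nonempty[OF less] by blast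
  obtain G where G: "primitive a b G \<phi>"
    using primitive_exists[OF integrable_imp_locally_integrable[OF int] c] by blast
  obtain la lb where l: "((\<lambda>x. G (real_of_ereal x)) \<longlongrightarrow> la) (at_right a)"
    "((\<lambda>x. G (real_of_ereal x)) \<longlongrightarrow> lb) (at_left b)"
    "lb - la = integral\<^sup>L (lebesgue_on I) \<phi>"
    using primitive_limits[OF G int less] by blast
  have F: "primitive a b (\<lambda>x. G x - la) \<phi>"
    using primitive_diff[OF G primitive_const[of a b la]] by simp
  obtain C where C: "\<And>x. x \<in> I \<Longrightarrow> cmod (G x - la) \<le> C"
    using primitive_bounded_of_integrable[OF F int] by blast
  show thesis
    using that[OF F _ _ C] tendsto_diff[OF l(1) tendsto_const, of la] tendsto_diff[OF l(2) tendsto_const, of la] l(3)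
    by simp
qed

end

locale limit_circle = sturm_liouville +
  assumes limit_circle: "limit_circle_a a b p q r" "limit_circle_b a b p q r"
begin

text \<open>
  Near the endpoints this is the limit circle assumption; on the compact interval in between a solution
  is bounded and r is integrable.
\<close>
lemma solution_L2:
  assumes y: "system y y' (\<lambda>x. z * y x)"
  shows "y \<in> L2 M"
proof -
  have "sl_solution a b p q r z y"
    using system_imp_sl_domain(1,3)[OF y] by (simp add: sl_solution_def)
  then obtain ca cb where c: "ca \<in> I" "cb \<in> I"
    and ia: "set_integrable M {..<ca} (\<lambda>x. (cmod (y x))\<^sup>2)"
    and ib: "set_integrable M {cb<..} (\<lambda>x. (cmod (y x))\<^sup>2)"
    using limit_circle unfolding limit_circle_a_def limit_circle_b_def by blast
  obtain B where B: "\<And>x. x \<in> {ca..cb} \<Longrightarrow> cmod (y x) \<le> B"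
    using primitive_bounded[OF _ Icc_subset_einterval[OF c]] y unfolding system_def by metis
  have meas_ind: "(\<lambda>x. complex_of_real (indicator {ca..cb} x)) \<in> borel_measurable M"
  proof -
    have "{ca..cb} \<in> sets M"
      using Icc_subset_einterval[OF c] by (simp add: sets_M sets_restrict_space_iff)
    moreover have "(\<lambda>x. complex_of_real (indicator {ca..cb} x)) = indicator {ca..cb}"
      by (auto simp: indicator_def)
    ultimately show ?thesis by simp
  qed
  have "integrable (lebesgue_on I) (\<lambda>x. of_real (r x) * complex_of_real (indicator {ca..cb} x))"
  proof -
    have "set_integrable lebesgue {ca..cb} (\<lambda>x. complex_of_real (r x))"
      using locally_integrableD(1)[OF locally_integrable_coefficients(3) c] .
    moreover have "indicator {ca..cb} x *\<^sub>R complex_of_real (r x) =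
        indicator I x *\<^sub>R (of_real (r x) * complex_of_real (indicator {ca..cb} x))" for x
      using Icc_subset_einterval[OF c] by (auto simp: indicator_def)
    ultimately show ?thesis
      by (simp add: set_integrable_def integrable_restrict_space)
  qed
  then have "integrable M (\<lambda>x. complex_of_real (indicator {ca..cb} x))"
    using integrable_M_iff(1)[OF meas_ind] by simp
  then have ind: "integrable M (\<lambda>x. indicator {ca..cb} x :: real)"
    by (simp add: complex_of_real_integrable_eq)
  have "integrable M (\<lambda>x. (cmod (y x))\<^sup>2)"
  proof (rule Bochner_Integration.integrable_bound)
    show "integrable M (\<lambda>x. indicator {..<ca} x *\<^sub>R (cmod (y x))\<^sup>2 + indicator {cb<..} x *\<^sub>R (cmod (y x))\<^sup>2
        + B\<^sup>2 * indicator {ca..cb} x)"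
      using ia ib ind unfolding set_integrable_def by auto
    show "(\<lambda>x. (cmod (y x))\<^sup>2) \<in> borel_measurable M"
      using system_measurable(1)[OF y] by measurable
    have "(cmod (y x))\<^sup>2 \<le> indicator {..<ca} x *\<^sub>R (cmod (y x))\<^sup>2 + indicator {cb<..} x *\<^sub>R (cmod (y x))\<^sup>2
        + B\<^sup>2 * indicator {ca..cb} x" for x
    proof -
      have "(cmod (y x))\<^sup>2 \<le> B\<^sup>2" if "x \<in> {ca..cb}" using B[OF that] by (intro power_mono) auto
      then show ?thesis by (auto simp: indicator_def)
    qed
    then show "AE x in M. norm ((cmod (y x))\<^sup>2) \<le> norm (indicator {..<ca} x *\<^sub>R (cmod (y x))\<^sup>2
        + indicator {cb<..} x *\<^sub>R (cmod (y x))\<^sup>2 + B\<^sup>2 * indicator {ca..cb} x)"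
      by (intro AE_I2) (metis abs_ge_self abs_of_nonneg order_trans real_norm_def zero_le_power2)
  qed
  then show ?thesis using system_measurable(1)[OF y] by (simp add: L2_def)
qed

lemma solution_domain_max:
  assumes y: "sl_solution a b p q r z y"
  shows "y \<in> domain_max" "ae (\<lambda>x. \<tau> y x = z * y x)"
proof -
  have y': "y \<in> sl_domain a b p" "ae (\<lambda>x. \<tau> y x = z * y x)" using y by (auto simp: sl_solution_def)
  have "system y (qd y) (\<lambda>x. z * y x)"
    by (rule system_cong_AE[OF system_quasi_deriv[OF y'(1)] y'(2)])
  then show "y \<in> domain_max" using solution_L2 L2_cmult domain_maxI by blast
qed (use y in \<open>simp add: sl_solution_def\<close>)

text \<open>
  Two solutions of \<open>\<tau> y = 0\<close> with independent initial values; their Wronskian is constant by Lagrange's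
  identity.
\<close>
lemma fundamental_system:
  obtains u u' v v' where "system u u' (\<lambda>_. 0)" "system v v' (\<lambda>_. 0)"
    "\<And>x. x \<in> I \<Longrightarrow> u x * v' x - u' x * v x = 1"
proof -
  obtain c where c: "c \<in> I" using einterval_nonempty[OF less] by blast
  note coeff = locally_integrable_coefficients(1,2)
  obtain u u' where u: "u c = 1" "u' c = 0"
    "primitive a b u (\<lambda>x. of_real (1 / p x) * u' x)" "primitive a b u' (\<lambda>x. of_real (q x) * u x)"
    using linear_system_exists[OF coeff c] by blast
  obtain v v' where v: "v c = 0" "v' c = 1"
    "primitive a b v (\<lambda>x. of_real (1 / p x) * v' x)" "primitive a b v' (\<lambda>x. of_real (q x) * v x)"
    using linear_system_exists[OF coeff c] by blast
  have su: "system u u' (\<lambda>_. 0)" and sv: "system v v' (\<lambda>_. 0)"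
    using u v by (simp_all add: system_def)
  have P: "primitive a b (\<lambda>x. u x * v' x - u' x * v x) (\<lambda>x. 0)"
    using lagrange_identity[OF su system_cnj[OF sv]] by simp
  have "u x * v' x - u' x * v x = 1" if x: "x \<in> I" for x
  proof (cases "c \<le> x")
    case True
    then show ?thesis using primitiveD(3)[OF P c x True] u(1,2) v(1,2) by simp
  next
    case False
    then show ?thesis using primitiveD(3)[OF P x c] u(1,2) v(1,2) by simp
  qed
  then show thesis using that su sv by blast
qed

context
  fixes u u' v v'
  assumes u: "system u u' (\<lambda>_. 0)" and v: "system v v' (\<lambda>_. 0)"
    and wronskian: "\<And>x. x \<in> I \<Longrightarrow> u x * v' x - u' x * v x = 1"
begin

lemma fundamental_domain_max: "u \<in> domain_max" "v \<in> domain_max"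
  using solution_L2[of _ _ 0] u v L2_zero by (auto intro!: domain_maxI)

text \<open>
  The coefficients of the two solutions are the primitives of \<open>r v k\<close> and \<open>r u k\<close> that vanish at a.  They
  are bounded, hence \<open>f\<close> is square integrable, and their limits at b are inner products with k.
\<close>
lemma variation_of_constants:
  assumes k: "k \<in> L2 M"
  obtains f f' where "system f f' k" "f \<in> domain_max"
    "\<And>g. g \<in> domain_max \<Longrightarrow> br_a f g = 0"
    "\<And>g. g \<in> domain_max \<Longrightarrow> br_b f g =
       l2_inner M (\<lambda>x. cnj (v x)) k * br_b u g - l2_inner M (\<lambda>x. cnj (u x)) k * br_b v g"
proof -
  have uL2: "u \<in> L2 M" and vL2: "v \<in> L2 M"
    using fundamental_domain_max domain_maxD by auto
  have int: "integrable (lebesgue_on I) (\<lambda>x. of_real (r x) * (y x * k x))"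
    "integral\<^sup>L (lebesgue_on I) (\<lambda>x. of_real (r x) * (y x * k x)) = l2_inner M (\<lambda>x. cnj (y x)) k"
    if "y \<in> L2 M" for y
    using L2_inner_integrable[OF L2_cnj[OF that] k] integrable_M_iff[of "\<lambda>x. y x * k x"]
    by (auto simp: l2_inner_def)
  obtain A CA where A: "primitive a b A (\<lambda>x. of_real (r x) * (v x * k x))"
    "((\<lambda>x. A (real_of_ereal x)) \<longlongrightarrow> 0) (at_right a)"
    "((\<lambda>x. A (real_of_ereal x)) \<longlongrightarrow> l2_inner M (\<lambda>x. cnj (v x)) k) (at_left b)"
    "\<And>x. x \<in> I \<Longrightarrow> cmod (A x) \<le> CA"
    using primitive_from_left_end[OF int(1)[OF vL2]] unfolding int(2)[OF vL2] by blast
  obtain B CB where B: "primitive a b B (\<lambda>x. of_real (r x) * (u x * k x))"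
    "((\<lambda>x. B (real_of_ereal x)) \<longlongrightarrow> 0) (at_right a)"
    "((\<lambda>x. B (real_of_ereal x)) \<longlongrightarrow> l2_inner M (\<lambda>x. cnj (u x)) k) (at_left b)"
    "\<And>x. x \<in> I \<Longrightarrow> cmod (B x) \<le> CB"
    using primitive_from_left_end[OF int(1)[OF uL2]] unfolding int(2)[OF uL2] by blast
  define f where "f = (\<lambda>x. A x * u x - B x * v x)"
  define f' where "f' = (\<lambda>x. A x * u' x - B x * v' x)"
  note U = u[unfolded system_def] and V = v[unfolded system_def]
  have sys: "system f f' k"
    unfolding system_def
  proof
    show "primitive a b f (\<lambda>x. of_real (1 / p x) * f' x)"
      unfolding f_def f'_def
      by (rule primitive_cong[OF primitive_diff[OF primitive_mult[OF A(1) conjunct1[OF U]]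
            primitive_mult[OF B(1) conjunct1[OF V]]]])
        (simp_all add: algebra_simps diff_divide_distrib)
    show "primitive a b f' (\<lambda>x. of_real (q x) * f x - of_real (r x) * k x)"
      unfolding f_def f'_def
    proof (rule primitive_cong[OF primitive_diff[OF primitive_mult[OF A(1) conjunct2[OF U]]
            primitive_mult[OF B(1) conjunct2[OF V]]]])
      fix x assume "x \<in> I"
      have "of_real (r x) * (v x * k x) * u' x + A x * (of_real (q x) * u x - of_real (r x) * 0)
          - (of_real (r x) * (u x * k x) * v' x + B x * (of_real (q x) * v x - of_real (r x) * 0))
        = of_real (q x) * (A x * u x - B x * v x) - of_real (r x) * k x * (u x * v' x - u' x * v x)"
        by (simp add: algebra_simps)
      then show "of_real (r x) * (v x * k x) * u' x + A x * (of_real (q x) * u x - of_real (r x) * 0)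
          - (of_real (r x) * (u x * k x) * v' x + B x * (of_real (q x) * v x - of_real (r x) * 0))
        = of_real (q x) * (A x * u x - B x * v x) - of_real (r x) * k x"
        unfolding wronskian[OF \<open>x \<in> I\<close>] by simp
    qed simp
  qed
  have L2: "(\<lambda>x. A x * y x) \<in> L2 M"
    if "primitive a b A \<phi>" "\<And>x. x \<in> I \<Longrightarrow> cmod (A x) \<le> C" "y \<in> L2 M" for A \<phi> C y
  proof (rule L2_bound[OF that(3)])
    have "A \<in> borel_measurable M"
      unfolding measurable_M using primitive_continuous_on[OF that(1)]
      by (intro continuous_imp_measurable_on_sets_lebesgue) auto
    then show "(\<lambda>x. A x * y x) \<in> borel_measurable M"
      using L2_measurable[OF that(3)] by (rule borel_measurable_times)
    show "AE x in M. cmod (A x * y x) \<le> C * cmod (y x)"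
      by (rule AE_I2) (auto simp: norm_mult intro!: mult_right_mono that(2))
  qed
  have "f \<in> L2 M"
    unfolding f_def by (intro L2_diff L2[OF A(1,4) uL2] L2[OF B(1,4) vL2])
  then have dom: "f \<in> domain_max" using domain_maxI[OF sys _ k] by blast
  have br: "br f g x = A x * br u g x - B x * br v g x" if "x \<in> I" for g x
    unfolding bracket_def system_imp_sl_domain(2)[OF sys that] system_imp_sl_domain(2)[OF u that]
      system_imp_sl_domain(2)[OF v that]
    by (simp add: f_def f'_def algebra_simps)
  show thesis
  proof (rule that[OF sys dom])
    fix g assume g: "g \<in> domain_max"
    show "br_a f g = 0"
    proof (rule br_lim_eqI[OF endpoints(1) br])
      have "((\<lambda>x. A (real_of_ereal x) * br u g (real_of_ereal x) - B (real_of_ereal x) * br v g (real_of_ereal x))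
         \<longlongrightarrow> 0 * br_a u g - 0 * br_a v g) (at_right a)"
        by (intro tendsto_intros A B br_tendsto fundamental_domain_max g endpoints)
      then show "((\<lambda>x. A (real_of_ereal x) * br u g (real_of_ereal x) - B (real_of_ereal x) * br v g (real_of_ereal x))
         \<longlongrightarrow> 0) (at_right a)" by simp
    qed
    show "br_b f g = l2_inner M (\<lambda>x. cnj (v x)) k * br_b u g - l2_inner M (\<lambda>x. cnj (u x)) k * br_b v g"
      by (rule br_lim_eqI[OF endpoints(2) br])
        (auto intro!: tendsto_intros A B br_tendsto fundamental_domain_max g)
  qed
qed

text \<open>
  At each point the vectors of u and v form a basis of the plane, so the boundary values of g against
  them control its boundary values against everything.
\<close>
lemma br_lim_eq_0_if_fundamental:
  assumes F: "endpoint F" and f: "f \<in> domain_max" and g: "g \<in> domain_max"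
    and "br_lim F u g = 0" "br_lim F v g = 0"
  shows "br_lim F f g = 0"
proof (rule br_lim_eqI[OF F])
  let ?cu = "\<lambda>x. cnj (u x)" and ?cv = "\<lambda>x. cnj (v x)"
  note c = domain_max_cnj(1)[OF fundamental_domain_max(1)] domain_max_cnj(1)[OF fundamental_domain_max(2)]
  show "br f g x = br f ?cv x * br u g x - br f ?cu x * br v g x" if x: "x \<in> I" for x
  proof -
    have qd: "qd u x = u' x" "qd v x = v' x" "qd ?cu x = cnj (u' x)" "qd ?cv x = cnj (v' x)"
      using system_imp_sl_domain(2)[OF u x] system_imp_sl_domain(2)[OF v x]
        domain_max_cnj(2)[OF fundamental_domain_max(1) x] domain_max_cnj(2)[OF fundamental_domain_max(2) x] by simp_all
    have "br f ?cv x * br u g x - br f ?cu x * br v g x = br f g x * (u x * v' x - u' x * v x)"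
      unfolding bracket_def qd by (simp add: algebra_simps)
    then show ?thesis using wronskian[OF x] by simp
  qed
  have "((\<lambda>x. br f ?cv (real_of_ereal x) * br u g (real_of_ereal x) - br f ?cu (real_of_ereal x) * br v g (real_of_ereal x))
     \<longlongrightarrow> br_lim F f ?cv * br_lim F u g - br_lim F f ?cu * br_lim F v g) F"
    by (intro tendsto_intros br_tendsto F f g c fundamental_domain_max)
  then show "((\<lambda>x. br f ?cv (real_of_ereal x) * br u g (real_of_ereal x) - br f ?cu (real_of_ereal x) * br v g (real_of_ereal x))
     \<longlongrightarrow> 0) F" using assms(4,5) by simp
qed

text \<open>
  The first step shows that g agrees almost everywhere with an element of the maximal domain, to which
  the second step applies under the same name.  Choose \<open>\<tau> g0 = h\<close>.  For k orthogonal to the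
  conjugated solutions, variation of constants yields \<open>\<tau> f = k\<close> with vanishing boundary values at both
  ends, hence \<open>\<langle>g - g0, k\<rangle> = 0\<close>.  Therefore \<open>g - g0\<close> is a combination of the conjugated solutions, and
  these solve the homogeneous equation, since the coefficients are real.

  The second step computes the boundary values.  For every k, the solution of \<open>\<tau> f = k\<close> given by
  variation of constants has vanishing boundary values at a, so its bracket with g vanishes at b too;
  written out, this says that k is orthogonal to a fixed combination \<open>\<kappa>\<close> of the conjugated solutions,
  whose coefficients are the boundary values of g at b up to sign and conjugation.  Taking \<open>k = \<kappa>\<close> gives
  \<open>\<kappa> = 0\<close>, and the coefficients vanish since the solutions are linearly independent.  Lagrange's identity
  carries the result from b to a.
\<close>
lemma T_min_boundary:
  assumes "(g, h) \<in> T_min a b p q r"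
  shows "\<exists>\<gamma>\<in>domain_max. ae (\<lambda>x. g x = \<gamma> x) \<and> ae (\<lambda>x. h x = \<tau> \<gamma> x) \<and>
    (\<forall>f\<in>domain_max. \<forall>F. endpoint F \<longrightarrow> br_lim F \<gamma> f = 0)"
proof -
  have g: "g \<in> L2 M" and h: "h \<in> L2 M"
    and adj: "\<And>f k. (f, k) \<in> T_max a b p q r \<Longrightarrow> l2_inner M g k = l2_inner M h f"
    using assms unfolding T_min_def op_adjoint_def by auto
  have T_max: "(f, k) \<in> T_max a b p q r" if "f \<in> domain_max" "k \<in> L2 M" "ae (\<lambda>x. k x = \<tau> f x)" for f k
    unfolding T_max_def sl_operator_iff using that domain_maxD(2)[OF that(1)]
    by (auto intro!: bexI[of _ f])
  note uv = fundamental_domain_max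
  let ?cu = "\<lambda>x. cnj (u x)" and ?cv = "\<lambda>x. cnj (v x)"
  have cu: "?cu \<in> L2 M" and cv: "?cv \<in> L2 M" using uv domain_maxD L2_cnj by auto
  have "\<exists>g0 g0'. system g0 g0' h \<and> g0 \<in> domain_max"
    by (rule variation_of_constants[OF h]) blast
  then obtain g0 g0' where g0: "system g0 g0' h" "g0 \<in> domain_max" by blast
  have tau: "ae (\<lambda>x. \<tau> f x = k x)" if "system f f' k" for f f' k using system_imp_sl_domain(3)[OF that] .
  have "l2_inner M (\<lambda>x. 1 * g x + (-1) * g0 x) k = 0"
    if k: "k \<in> L2 M" "l2_inner M ?cu k = 0" "l2_inner M ?cv k = 0" for k
  proof -
    have "\<exists>f f'. system f f' k \<and> f \<in> domain_max \<and> br_a f g0 = 0 \<and>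
      br_b f g0 = l2_inner M ?cv k * br_b u g0 - l2_inner M ?cu k * br_b v g0"
      by (rule variation_of_constants[OF k(1)]) (use g0(2) in blast)
    then obtain f f' where f: "system f f' k" "f \<in> domain_max" "br_a f g0 = 0"
      "br_b f g0 = l2_inner M ?cv k * br_b u g0 - l2_inner M ?cu k * br_b v g0" by blast
    have "l2_inner M g0 (\<tau> f) = l2_inner M (\<tau> g0) f"
      using lagrange_limits(3)[OF f(2) g0(2)] f(3,4) k(2,3) by simp
    moreover have "l2_inner M g0 (\<tau> f) = l2_inner M g0 k"
      by (rule l2_inner_cong_AE) (use domain_maxD[OF g0(2)] domain_maxD[OF f(2)] tau[OF f(1)] in auto)
    moreover have "l2_inner M (\<tau> g0) f = l2_inner M h f"
      by (rule l2_inner_cong_AE) (use domain_maxD[OF g0(2)] domain_maxD[OF f(2)] tau[OF g0(1)] in auto)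
    moreover have "l2_inner M g k = l2_inner M h f"
      by (intro adj T_max f k) (use tau[OF f(1)] in eventually_elim, simp)
    ultimately show ?thesis
      unfolding l2_inner_combination_left[OF k(1) g domain_maxD(2)[OF g0(2)]] by simp
  qed
  then obtain c d where cd: "ae (\<lambda>x. 1 * g x + (-1) * g0 x = c * ?cu x + d * ?cv x)"
    using L2_biorthogonal_imp_span[OF cu cv L2_combination[OF g domain_maxD(2)[OF g0(2)]]] by blast
  define \<gamma> where "\<gamma> = (\<lambda>x. g0 x + (c * ?cu x + d * ?cv x))"
  define \<gamma>' where "\<gamma>' = (\<lambda>x. g0' x + (c * cnj (u' x) + d * cnj (v' x)))"
  have "system \<gamma> \<gamma>' (\<lambda>x. h x + (c * cnj 0 + d * cnj 0))"
    unfolding \<gamma>_def \<gamma>'_def by (intro system_add system_cmult system_cnj g0 u v)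
  then have sys: "system \<gamma> \<gamma>' h" by simp
  have g\<gamma>: "ae (\<lambda>x. g x = \<gamma> x)" using cd by eventually_elim (simp add: \<gamma>_def algebra_simps)
  have \<gamma>: "\<gamma> \<in> domain_max" using domain_maxI[OF sys L2_cong_AE[OF g g\<gamma>] h] .
  have lagrange: "br_b f \<gamma> = br_a f \<gamma>" if f: "f \<in> domain_max" for f
  proof -
    have "br_b f \<gamma> - br_a f \<gamma> = l2_inner M \<gamma> (\<tau> f) - l2_inner M (\<tau> \<gamma>) f"
      by (rule lagrange_limits(3)[OF f \<gamma>])
    also have "l2_inner M \<gamma> (\<tau> f) = l2_inner M g (\<tau> f)"
      by (rule l2_inner_cong_AE[symmetric]) (use g domain_maxD[OF f] g\<gamma> in auto)
    also have "l2_inner M (\<tau> \<gamma>) f = l2_inner M h f"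
      by (rule l2_inner_cong_AE) (use domain_maxD[OF \<gamma>] domain_maxD[OF f] tau[OF sys] in auto)
    also have "l2_inner M g (\<tau> f) = l2_inner M h f"
      by (intro adj T_max f domain_maxD(3)[OF f]) simp
    finally show ?thesis by simp
  qed
  define \<alpha> where "\<alpha> = br_b u \<gamma>"
  define \<beta> where "\<beta> = br_b v \<gamma>"
  define \<kappa> where "\<kappa> = (\<lambda>x. cnj \<alpha> * ?cv x + - cnj \<beta> * ?cu x)"
  have \<kappa>: "\<kappa> \<in> L2 M" unfolding \<kappa>_def by (intro L2_combination cu cv)
  have "\<exists>f. f \<in> domain_max \<and> br_a f \<gamma> = 0 \<and>
      br_b f \<gamma> = l2_inner M ?cv \<kappa> * \<alpha> - l2_inner M ?cu \<kappa> * \<beta>"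
    unfolding \<alpha>_def \<beta>_def by (rule variation_of_constants[OF \<kappa>]) (use \<gamma> in blast)
  then obtain f where f: "f \<in> domain_max" "br_a f \<gamma> = 0"
      "br_b f \<gamma> = l2_inner M ?cv \<kappa> * \<alpha> - l2_inner M ?cu \<kappa> * \<beta>" by blast
  have "l2_inner M \<kappa> \<kappa> = \<alpha> * l2_inner M ?cv \<kappa> - \<beta> * l2_inner M ?cu \<kappa>"
    using l2_inner_combination_left[OF \<kappa> cv cu, of "cnj \<alpha>" "- cnj \<beta>"] by (simp add: \<kappa>_def)
  also have "\<dots> = 0" using lagrange[OF f(1)] f(2,3) by (simp add: mult.commute)
  finally have "ae (\<lambda>x. \<kappa> x = 0)" by (rule l2_inner_self_eq_0[OF \<kappa>])
  then have ae0: "ae (\<lambda>x. \<kappa> x = 0 * u x)" by simp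
  have "system \<kappa> (\<lambda>x. cnj \<alpha> * cnj (v' x) + - cnj \<beta> * cnj (u' x)) (\<lambda>x. cnj \<alpha> * cnj 0 + - cnj \<beta> * cnj 0)"
    unfolding \<kappa>_def by (intro system_add system_cmult system_cnj u v)
  note z = system_unique(1,2)[OF this system_cmult[OF u, of 0] ae0]
  obtain x where x: "x \<in> I" using einterval_nonempty[OF less] by blast
  have e: "\<alpha> * v x = \<beta> * u x" "\<alpha> * v' x = \<beta> * u' x"
    using arg_cong[OF z(1)[OF x], of cnj] arg_cong[OF z(2)[OF x], of cnj] by (simp_all add: \<kappa>_def)
  have "\<alpha> * (u x * v' x - u' x * v x) = u x * (\<alpha> * v' x) - u' x * (\<alpha> * v x)"
    by (simp add: algebra_simps)
  also have "\<dots> = 0" unfolding e by (simp add: algebra_simps)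
  finally have "\<alpha> = 0" using wronskian[OF x] by simp
  have "\<beta> * (u x * v' x - u' x * v x) = (\<beta> * u x) * v' x - (\<beta> * u' x) * v x"
    by (simp add: algebra_simps)
  also have "\<dots> = 0" unfolding e[symmetric] by (simp add: algebra_simps)
  finally have "\<beta> = 0" using wronskian[OF x] by simp
  have zero: "br_lim F u \<gamma> = 0 \<and> br_lim F v \<gamma> = 0" if "endpoint F" for F
    using that \<open>\<alpha> = 0\<close> \<open>\<beta> = 0\<close> lagrange[OF uv(1)] lagrange[OF uv(2)]
    unfolding \<alpha>_def \<beta>_def endpoint_def by auto
  have "br_lim F \<gamma> f = 0" if "f \<in> domain_max" "endpoint F" for f F
    using br_lim_antisym[OF that(2,1) \<gamma>] br_lim_eq_0_if_fundamental[OF that(2,1) \<gamma>] zero[OF that(2)] by simp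
  moreover have "ae (\<lambda>x. h x = \<tau> \<gamma> x)" using tau[OF sys] by eventually_elim simp
  ultimately show ?thesis using \<gamma> g\<gamma> by blast
qed

end

lemma T_min_boundary_values:
  assumes "(g, h) \<in> T_min a b p q r"
  obtains \<gamma> where "\<gamma> \<in> domain_max" "ae (\<lambda>x. g x = \<gamma> x)" "ae (\<lambda>x. h x = \<tau> \<gamma> x)"
    "\<And>f F. f \<in> domain_max \<Longrightarrow> endpoint F \<Longrightarrow> br_lim F \<gamma> f = 0"
proof -
  obtain u u' v v' where "system u u' (\<lambda>_. 0)" "system v v' (\<lambda>_. 0)"
    "\<And>x. x \<in> I \<Longrightarrow> u x * v' x - u' x * v x = 1"
    using fundamental_system by metis
  from T_min_boundary[OF this assms] show thesis using that by blast
qed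

end

section \<open>Coupled boundary conditions and the resolvent formula\<close>

context sturm_liouville
begin

lemma op_resolvent_sl_operator_iff:
  assumes S: "S \<subseteq> domain_max"
  shows "(k, f) \<in> op_resolvent M (sl_operator a b p q r S) z \<longleftrightarrow>
    k \<in> L2 M \<and> f \<in> L2 M \<and> (\<exists>g\<in>S. ae (\<lambda>x. f x = g x) \<and> ae (\<lambda>x. k x = \<tau> g x - z * g x))"
  (is "?lhs \<longleftrightarrow> ?rhs")
proof
  assume ?lhs
  then obtain h where k: "k \<in> L2 M" and fh: "(f, h) \<in> sl_operator a b p q r S" and kh: "ae (\<lambda>x. k x = h x - z * f x)"
    unfolding op_resolvent_def op_shift_def AE_M_iff by blast
  from fh obtain g where g: "f \<in> L2 M" "g \<in> S" "ae (\<lambda>x. f x = g x)" "ae (\<lambda>x. h x = \<tau> g x)"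
    unfolding sl_operator_iff by blast
  have "ae (\<lambda>x. k x = \<tau> g x - z * g x)" using kh g(3,4) by eventually_elim simp
  then show ?rhs using k g by blast
next
  assume ?rhs
  then obtain g where k: "k \<in> L2 M" and f: "f \<in> L2 M" and g: "g \<in> S" "ae (\<lambda>x. f x = g x)"
    and kg: "ae (\<lambda>x. k x = \<tau> g x - z * g x)" by blast
  have "(f, \<tau> g) \<in> sl_operator a b p q r S"
    unfolding sl_operator_iff using f g domain_maxD(3)[of g] S by auto
  moreover have "ae (\<lambda>x. k x = \<tau> g x - z * f x)" using kg g(2) by eventually_elim simp
  ultimately show ?lhs unfolding op_resolvent_def op_shift_def AE_M_iff using k by blast
qed

text \<open>
  The norm bound in the definition of the resolvent set, applied to the right-hand side 0.
\<close>
lemma resolvent_set_injective: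
  assumes S: "S \<subseteq> domain_max" and z: "z \<in> resolvent_set M (sl_operator a b p q r S)"
    and g: "g \<in> S" "ae (\<lambda>x. \<tau> g x = z * g x)"
  shows "x \<in> I \<Longrightarrow> g x = 0"
proof -
  have dom: "g \<in> domain_max" using S g(1) by blast
  have "ae (\<lambda>x. 0 = \<tau> g x - z * g x)" using g(2) by eventually_elim simp
  then have "((\<lambda>_. 0), g) \<in> op_resolvent M (sl_operator a b p q r S) z"
    unfolding op_resolvent_sl_operator_iff[OF S] using L2_zero domain_maxD(2)[OF dom] g(1)
    by (auto intro!: bexI[of _ g])
  then obtain C where "l2_norm M g \<le> C * l2_norm M (\<lambda>_. 0)"
    using z unfolding resolvent_set_def by blast
  moreover have "l2_norm M (\<lambda>_. 0) = 0" by (simp add: l2_norm_def)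
  moreover have "(\<integral>x. (cmod (g x))\<^sup>2 \<partial>M) \<ge> 0" by (rule integral_nonneg_AE) simp
  ultimately have "(\<integral>x. (cmod (g x))\<^sup>2 \<partial>M) = 0" by (simp add: l2_norm_def)
  then have "AE x in M. (cmod (g x))\<^sup>2 = 0"
    using domain_maxD(2)[OF dom] by (subst (asm) integral_nonneg_eq_0_iff_AE) (auto simp: L2_def)
  then have "ae (\<lambda>x. g x = 0)" unfolding AE_M_iff by simp
  then show "g x = 0" if "x \<in> I"
    using AE_eq_imp_eq_on_einterval[OF system_continuous_on(1)[OF domain_maxD(1)[OF dom]] continuous_on_const _ that, of 0]
    by simp
qed

lemma br_lim_cnj_real:
  assumes F: "endpoint F" and g: "g \<in> domain_max" and \<phi>: "\<phi> \<in> domain_max" "\<And>x. x \<in> I \<Longrightarrow> \<phi> x \<in> \<real>"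
  shows "br_lim F (\<lambda>x. cnj (g x)) \<phi> = cnj (br_lim F g \<phi>)"
proof -
  have "br_lim F (\<lambda>x. cnj (g x)) \<phi> = br_lim F (\<lambda>x. cnj (g x)) (\<lambda>x. cnj (\<phi> x))"
    by (intro br_lim_cong F domain_max_cnj(1) g \<phi>(1)) (use \<phi>(2) in \<open>auto simp: Reals_cnj_iff\<close>)
  then show ?thesis using br_lim_cnj[OF F g \<phi>(1)] by simp
qed

text \<open>
  Complex conjugation commutes with \<open>\<tau>\<close>, because the coefficients are real; so it turns the resolvent
  at z into the resolvent at \<open>cnj z\<close> whenever it preserves the domain.
\<close>
lemma resolvent_set_cnj:
  assumes S: "S \<subseteq> domain_max" and cnj_S: "\<And>g. g \<in> S \<Longrightarrow> (\<lambda>x. cnj (g x)) \<in> S"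
    and z: "z \<in> resolvent_set M (sl_operator a b p q r S)"
  shows "cnj z \<in> resolvent_set M (sl_operator a b p q r S)"
proof -
  let ?R = "op_resolvent M (sl_operator a b p q r S)"
  have conj: "((\<lambda>x. cnj (k x)), (\<lambda>x. cnj (f x))) \<in> ?R (cnj w)" if kf: "(k, f) \<in> ?R w" for k f w
  proof -
    obtain g where g: "k \<in> L2 M" "f \<in> L2 M" "g \<in> S" "ae (\<lambda>x. f x = g x)" "ae (\<lambda>x. k x = \<tau> g x - w * g x)"
      using kf unfolding op_resolvent_sl_operator_iff[OF S] by blast
    have "ae (\<lambda>x. cnj (f x) = cnj (g x))" using g(4) by eventually_elim simp
    moreover have "ae (\<lambda>x. cnj (k x) = \<tau> (\<lambda>x. cnj (g x)) x - cnj w * cnj (g x))"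
      using g(5) domain_max_cnj(3)[OF subsetD[OF S g(3)]] by eventually_elim simp
    ultimately show ?thesis
      unfolding op_resolvent_sl_operator_iff[OF S]
      by (intro conjI L2_cnj g(1,2) bexI[OF _ cnj_S[OF g(3)]])
  qed
  have norm: "l2_norm M (\<lambda>x. cnj (f x)) = l2_norm M f" for f by (simp add: l2_norm_def)
  have "Domain (?R z) = L2 M" using z by (simp add: resolvent_set_def)
  have "k \<in> Domain (?R (cnj z))" if kL2: "k \<in> L2 M" for k
  proof -
    obtain f where "((\<lambda>x. cnj (k x)), f) \<in> ?R z"
      using L2_cnj[OF kL2] \<open>Domain (?R z) = L2 M\<close> by blast
    from conj[OF this] show ?thesis by auto
  qed
  moreover have "k \<in> L2 M" if "k \<in> Domain (?R (cnj z))" for k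
    using that unfolding Domain_iff op_resolvent_sl_operator_iff[OF S] by blast
  ultimately have dom: "Domain (?R (cnj z)) = L2 M" by blast
  obtain C where C: "\<And>k f. (k, f) \<in> ?R z \<Longrightarrow> l2_norm M f \<le> C * l2_norm M k"
    using z unfolding resolvent_set_def by blast
  have "l2_norm M f \<le> C * l2_norm M k" if "(k, f) \<in> ?R (cnj z)" for k f
    using C[of "\<lambda>x. cnj (k x)" "\<lambda>x. cnj (f x)"] conj[OF that] by (simp add: norm)
  then show ?thesis using dom unfolding resolvent_set_def by blast
qed

end

text \<open>
  Since \<open>R12\<close> is nonzero, the first condition can be solved for Ga; then the determinant condition
  simplifies the second one.  Here \<open>c1\<close>, \<open>c2\<close> stand for the brackets with \<open>\<phi>\<close> at b and at a, and Gb, Ga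
  for those with \<open>\<psi>\<close>.
\<close>
lemma coupled_boundary_condition_iff:
  fixes e e' c1 c2 Ga Gb :: complex and R11 R12 R21 R22 :: real
  assumes det: "R11 * R22 - R12 * R21 = 1" and "R12 \<noteq> 0" and e: "e * e' = 1"
  shows "c1 = e * (R11 * c2 + R12 * Ga) \<and> Gb = e * (R21 * c2 + R22 * Ga) \<longleftrightarrow>
    R22 / R12 * c1 - e / R12 * c2 = Gb \<and> - (e' / R12) * c1 + R11 / R12 * c2 = - Ga"
proof -
  have R: "complex_of_real R12 \<noteq> 0" using \<open>R12 \<noteq> 0\<close> by simp
  have det': "complex_of_real R11 * of_real R22 = 1 + of_real R12 * of_real R21"
    using arg_cong[OF det, of complex_of_real] by (simp add: algebra_simps)
  have "c1 = e * (R11 * c2 + R12 * Ga) \<longleftrightarrow> e' * c1 = R11 * c2 + R12 * Ga"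
    using e by (metis mult.assoc mult.commute mult_1)
  also have "\<dots> \<longleftrightarrow> - (e' / R12) * c1 + R11 / R12 * c2 = - Ga"
    using R by (simp add: field_simps) (auto simp: algebra_simps)
  finally have 1: "c1 = e * (R11 * c2 + R12 * Ga) \<longleftrightarrow> - (e' / R12) * c1 + R11 / R12 * c2 = - Ga" .
  have 2: "R22 / R12 * c1 - e / R12 * c2 = e * (R21 * c2 + R22 * Ga)" if "c1 = e * (R11 * c2 + R12 * Ga)"
  proof -
    have "R22 * c1 - e * c2 = e * ((of_real R11 * of_real R22 - 1) * c2 + R12 * R22 * Ga)"
      unfolding that by (simp add: algebra_simps)
    also have "\<dots> = R12 * (e * (R21 * c2 + R22 * Ga))"
      unfolding det' by (simp add: algebra_simps)
    finally show ?thesis using R by (simp add: field_simps)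
  qed
  show ?thesis using 1 2 by metis
qed

locale coupled_extension = limit_circle +
  fixes \<phi>a \<psi>a \<phi>b \<psi>b :: "real \<Rightarrow> complex" and R :: "real^2^2" and \<eta> :: real
  assumes basis_a: "bc_basis a b p q r (at_right a) \<phi>a \<psi>a"
    and basis_b: "bc_basis a b p q r (at_left b) \<phi>b \<psi>b"
    and det_R: "det R = 1" and R12: "R$1$2 \<noteq> 0"
begin

abbreviation "T0 \<equiv> T_00 a b p q r \<phi>a \<phi>b"
abbreviation "TR \<equiv> T_R a b p q r \<phi>a \<psi>a \<phi>b \<psi>b R \<eta>"

definition domain_0 :: "(real \<Rightarrow> complex) set" where
  "domain_0 = {g \<in> domain_max. br_a g \<phi>a = 0 \<and> br_b g \<phi>b = 0}"

definition domain_R :: "(real \<Rightarrow> complex) set" where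
  "domain_R = {g \<in> domain_max.
     br_b g \<phi>b = exp (\<i> * \<eta>) * (R$1$1 * br_a g \<phi>a + R$1$2 * br_a g \<psi>a) \<and>
     br_b g \<psi>b = exp (\<i> * \<eta>) * (R$2$1 * br_a g \<phi>a + R$2$2 * br_a g \<psi>a)}"

lemma T0_eq: "T0 = sl_operator a b p q r domain_0"
  by (simp add: T_00_def domain_0_def)

lemma TR_eq: "TR = sl_operator a b p q r domain_R"
  by (simp add: T_R_def domain_R_def vec_eq_iff forall_2 matrix_vector_mult_def sum_2 map_matrix_def)

lemma domain_0_subset: "domain_0 \<subseteq> domain_max" and domain_R_subset: "domain_R \<subseteq> domain_max"
  by (auto simp: domain_0_def domain_R_def)

lemma basis: "\<phi>a \<in> domain_max" "\<psi>a \<in> domain_max" "\<phi>b \<in> domain_max" "\<psi>b \<in> domain_max"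
  and basis_real: "\<And>x. x \<in> I \<Longrightarrow> \<phi>a x \<in> \<real>" "\<And>x. x \<in> I \<Longrightarrow> \<phi>b x \<in> \<real>"
  using basis_a basis_b by (auto simp: bc_basis_def)

lemma domain_R_diff:
  assumes "f \<in> domain_R" "g \<in> domain_R" shows "(\<lambda>x. 1 * f x + (- 1) * g x) \<in> domain_R"
proof -
  have fg: "f \<in> domain_max" "g \<in> domain_max" using assms domain_R_subset by auto
  have "br_lim F (\<lambda>x. 1 * f x + (- 1) * g x) h = br_lim F f h - br_lim F g h"
    if "endpoint F" "h \<in> domain_max" for F h
    using br_lim_combination[OF that(1) fg that(2), of 1 "-1"] by simp
  note c = this[OF endpoints(1) basis(1)] this[OF endpoints(1) basis(2)]
    this[OF endpoints(2) basis(3)] this[OF endpoints(2) basis(4)]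
  show ?thesis
    unfolding domain_R_def mem_Collect_eq c
    using assms domain_max_combination(1)[OF fg, of 1 "- 1"] unfolding domain_R_def mem_Collect_eq
    by (auto simp: algebra_simps)
qed

lemma domain_0_cnj: "g \<in> domain_0 \<Longrightarrow> (\<lambda>x. cnj (g x)) \<in> domain_0"
  unfolding domain_0_def
  using br_lim_cnj_real[OF endpoints(1) _ basis(1) basis_real(1)] br_lim_cnj_real[OF endpoints(2) _ basis(3) basis_real(2)]
    domain_max_cnj(1) by auto

text \<open>
  A function in both domains has vanishing brackets with \<open>\<phi>a\<close> and \<open>\<phi>b\<close>; then \<open>R12 \<noteq> 0\<close> forces the
  bracket with \<open>\<psi>a\<close> to vanish, and the second row of the coupled condition the one with \<open>\<psi>b\<close>.
\<close>
theorem T0_TR_relatively_prime: "relatively_prime M (T_min a b p q r) T0 TR"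
  unfolding relatively_prime_def
proof (rule set_eqI, clarify)
  fix f h
  show "(f, h) \<in> maximal_common_part M T0 TR \<longleftrightarrow> (f, h) \<in> T_min a b p q r"
  proof
    assume "(f, h) \<in> T_min a b p q r"
    then have L2: "f \<in> L2 M" "h \<in> L2 M" by (auto simp: T_min_def op_adjoint_def)
    obtain \<gamma> where \<gamma>: "\<gamma> \<in> domain_max" "ae (\<lambda>x. f x = \<gamma> x)" "ae (\<lambda>x. h x = \<tau> \<gamma> x)"
      "\<And>g F. g \<in> domain_max \<Longrightarrow> endpoint F \<Longrightarrow> br_lim F \<gamma> g = 0"
      using T_min_boundary_values[OF \<open>(f, h) \<in> T_min a b p q r\<close>] by metis
    have "\<gamma> \<in> domain_0" "\<gamma> \<in> domain_R"
      using \<gamma>(1) \<gamma>(4) basis by (simp_all add: domain_0_def domain_R_def)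
    then have "(f, h) \<in> T0" "(f, h) \<in> TR"
      unfolding T0_eq TR_eq sl_operator_iff using L2 \<gamma>(2,3) by blast+
    then show "(f, h) \<in> maximal_common_part M T0 TR"
      unfolding maximal_common_part_def by auto
  next
    assume "(f, h) \<in> maximal_common_part M T0 TR"
    then obtain h' where "(f, h) \<in> T0" "(f, h') \<in> TR" unfolding maximal_common_part_def by blast
    then obtain g g' where L2: "f \<in> L2 M" "h \<in> L2 M"
      and g: "g \<in> domain_0" "ae (\<lambda>x. f x = g x)" "ae (\<lambda>x. h x = \<tau> g x)"
      and g': "g' \<in> domain_R" "ae (\<lambda>x. f x = g' x)"
      unfolding T0_eq TR_eq sl_operator_iff by blast
    have dom: "g \<in> domain_max" "g' \<in> domain_max" using g(1) g'(1) domain_0_subset domain_R_subset by auto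
    have "ae (\<lambda>x. g x = g' x)" using g(2) g'(2) by eventually_elim simp
    from system_unique(1)[OF domain_maxD(1)[OF dom(1)] domain_maxD(1)[OF dom(2)] this]
    have eq: "br_lim F g k = br_lim F g' k" if "endpoint F" "k \<in> domain_max" for F k
      using br_lim_cong[OF that(1) dom that(2,2)] by blast
    have \<phi>: "br_a g \<phi>a = 0" "br_b g \<phi>b = 0" using g(1) by (auto simp: domain_0_def)
    then have \<psi>a: "br_a g \<psi>a = 0"
      using g'(1) R12 unfolding domain_R_def by (simp add: basis flip: eq)
    then have \<psi>b: "br_b g \<psi>b = 0"
      using g'(1) \<phi> unfolding domain_R_def by (simp add: basis flip: eq)
    have zero: "br_a k g = 0" "br_b k g = 0" if k: "k \<in> domain_max" for k
      using br_pluecker[OF endpoints(1) basis_a k dom(1)] br_pluecker[OF endpoints(2) basis_b k dom(1)] \<phi> \<psi>a \<psi>b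
      by simp_all
    have "l2_inner M f k = l2_inner M h f'" if fk: "(f', k) \<in> T_max a b p q r" for f' k
    proof -
      obtain m where m: "f' \<in> L2 M" "k \<in> L2 M" "m \<in> domain_max" "ae (\<lambda>x. f' x = m x)" "ae (\<lambda>x. k x = \<tau> m x)"
        using fk unfolding T_max_def sl_operator_iff by blast
      have "l2_inner M f k = l2_inner M g (\<tau> m)" by (rule l2_inner_cong_AE) (use L2 m g in auto)
      also have "\<dots> = l2_inner M (\<tau> g) m" using lagrange_limits(3)[OF m(3) dom(1)] zero[OF m(3)] by simp
      also have "\<dots> = l2_inner M h f'" by (rule l2_inner_cong_AE[symmetric]) (use L2 m g in auto)
      finally show ?thesis .
    qed
    then show "(f, h) \<in> T_min a b p q r" using L2 unfolding T_min_def op_adjoint_def by blast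
  qed
qed

lemma T0_resolvent_set_cnj: "z \<in> resolvent_set M T0 \<Longrightarrow> cnj z \<in> resolvent_set M T0"
  unfolding T0_eq by (rule resolvent_set_cnj[OF domain_0_subset domain_0_cnj])

context
  fixes u :: "complex \<Rightarrow> 2 \<Rightarrow> real \<Rightarrow> complex"
  assumes u1: "\<And>z. z \<in> resolvent_set M T0 \<Longrightarrow> sl_solution a b p q r z (u z 1) \<and>
      br_a (u z 1) \<phi>a = 0 \<and> br_b (u z 1) \<phi>b = 1"
    and u2: "\<And>z. z \<in> resolvent_set M T0 \<Longrightarrow> sl_solution a b p q r z (u z 2) \<and>
      br_a (u z 2) \<phi>a = 1 \<and> br_b (u z 2) \<phi>b = 0"
begin

abbreviation "K z \<equiv> K_R a b p \<psi>a \<psi>b R \<eta> (u z)"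

lemma K_entries:
  "K z $ 1 $ 1 = of_real (R$2$2) / of_real (R$1$2) - br_b (u z 1) \<psi>b"
  "K z $ 1 $ 2 = - (exp (- (\<i> * of_real \<eta>)) / of_real (R$1$2)) + br_a (u z 1) \<psi>a"
  "K z $ 2 $ 1 = - (exp (\<i> * of_real \<eta>) / of_real (R$1$2)) - br_b (u z 2) \<psi>b"
  "K z $ 2 $ 2 = of_real (R$1$1) / of_real (R$1$2) + br_a (u z 2) \<psi>a"
  by (simp_all add: K_R_def)

lemma u_domain_max:
  assumes "z \<in> resolvent_set M T0"
  shows "u z j \<in> domain_max" "ae (\<lambda>x. \<tau> (u z j) x = z * u z j x)"
  using solution_domain_max u1[OF assms] u2[OF assms] exhaust_2[of j] by blast+

text \<open>
  Both sides solve \<open>\<tau> y = cnj z * y\<close> and have the same boundary values against \<open>\<phi>a\<close> and \<open>\<phi>b\<close>, so that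
  their difference is in the kernel of \<open>T0 - cnj z\<close>.
\<close>
lemma u_cnj:
  assumes z: "z \<in> resolvent_set M T0" and x: "x \<in> I"
  shows "u (cnj z) j x = cnj (u z j x)"
proof -
  note z' = T0_resolvent_set_cnj[OF z]
  note U = u_domain_max[OF z, of j] and U' = u_domain_max[OF z', of j]
  note C = domain_max_cnj[OF U(1)]
  define w where "w = (\<lambda>x. 1 * u (cnj z) j x + (- 1) * cnj (u z j x))"
  note D = domain_max_combination[where c = 1 and d = "- 1", OF U'(1) C(1), folded w_def]
  have "w \<in> domain_0"
  proof -
    have "br_a w \<phi>a = br_a (u (cnj z) j) \<phi>a - cnj (br_a (u z j) \<phi>a)"
      using br_lim_combination[OF endpoints(1) U'(1) C(1) basis(1), of 1 "- 1"]
        br_lim_cnj_real[OF endpoints(1) U(1) basis(1) basis_real(1)] by (simp add: w_def)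
    moreover have "br_b w \<phi>b = br_b (u (cnj z) j) \<phi>b - cnj (br_b (u z j) \<phi>b)"
      using br_lim_combination[OF endpoints(2) U'(1) C(1) basis(3), of 1 "- 1"]
        br_lim_cnj_real[OF endpoints(2) U(1) basis(3) basis_real(2)] by (simp add: w_def)
    ultimately show ?thesis
      using D(1) u1[OF z] u2[OF z] u1[OF z'] u2[OF z'] exhaust_2[of j] by (auto simp: domain_0_def)
  qed
  moreover have "ae (\<lambda>x. \<tau> w x = cnj z * w x)"
    using D(3) U(2) U'(2) C(3) by eventually_elim (simp add: w_def algebra_simps)
  ultimately have "w x = 0"
    using resolvent_set_injective[OF domain_0_subset z'[unfolded T0_eq] _ _ x] by blast
  then show ?thesis by (simp add: w_def)
qed

text \<open>
  Lagrange's identity for f and the conjugate of \<open>u z j\<close>: the terms with z cancel, and the boundary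
  terms reduce to products of a bracket of f with \<open>\<psi>\<close> and a bracket of \<open>u z j\<close> with \<open>\<phi>\<close>.
\<close>
lemma inner_u_eq_boundary_value:
  assumes z: "z \<in> resolvent_set M T0" and f: "f \<in> domain_0" and k: "k \<in> L2 M" "ae (\<lambda>x. k x = \<tau> f x - z * f x)"
  shows "l2_inner M (u (cnj z) 1) k = br_b f \<psi>b" "l2_inner M (u (cnj z) 2) k = - br_a f \<psi>a"
proof -
  have fd: "f \<in> domain_max" "br_a f \<phi>a = 0" "br_b f \<phi>b = 0" using f by (auto simp: domain_0_def)
  have inner: "l2_inner M (u (cnj z) j) k = br_b f \<psi>b * br_b (u z j) \<phi>b - br_a f \<psi>a * br_a (u z j) \<phi>a" for j
  proof -
    note U = u_domain_max[OF z, of j]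
    note C = domain_max_cnj[OF U(1)]
    let ?c = "\<lambda>x. cnj (u z j x)"
    note cd = domain_maxD[OF C(1)] and f' = domain_maxD[OF fd(1)]
    have "l2_inner M (u (cnj z) j) k = l2_inner M ?c (\<lambda>x. 1 * \<tau> f x + (- z) * f x)"
    proof (rule l2_inner_cong_AE)
      show "u (cnj z) j \<in> L2 M" by (rule domain_maxD(2)[OF u_domain_max(1)[OF T0_resolvent_set_cnj[OF z]]])
      show "ae (\<lambda>x. u (cnj z) j x = ?c x)"
        using u_cnj[OF z] by (auto simp: AE_einterval_iff intro: exI[of _ "{}"])
      show "ae (\<lambda>x. k x = 1 * \<tau> f x + (- z) * f x)" using k(2) by eventually_elim simp
    qed (rule k(1))
    also have "\<dots> = l2_inner M ?c (\<tau> f) - z * l2_inner M ?c f"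
      by (subst l2_inner_combination_right[OF cd(2) f'(3,2)]) simp
    also have "z * l2_inner M ?c f = l2_inner M (\<lambda>x. cnj z * ?c x + 0 * ?c x) f"
      by (subst l2_inner_combination_left[OF f'(2) cd(2,2)]) simp
    also have "\<dots> = l2_inner M (\<tau> ?c) f"
    proof (rule l2_inner_cong_AE[OF L2_combination[OF cd(2,2)] f'(2)])
      show "ae (\<lambda>x. cnj z * ?c x + 0 * ?c x = \<tau> ?c x)"
        using C(3) U(2) by eventually_elim simp
    qed simp
    also have "l2_inner M ?c (\<tau> f) - l2_inner M (\<tau> ?c) f = br_b f ?c - br_a f ?c"
      by (rule lagrange_limits(3)[OF fd(1) C(1), symmetric])
    also have "br_b f ?c = br_b f \<psi>b * br_b (u z j) \<phi>b"
      using br_pluecker[OF endpoints(2) basis_b fd(1) C(1)] fd(3)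
        br_lim_cnj_real[OF endpoints(2) U(1) basis(3) basis_real(2)] by simp
    also have "br_a f ?c = br_a f \<psi>a * br_a (u z j) \<phi>a"
      using br_pluecker[OF endpoints(1) basis_a fd(1) C(1)] fd(2)
        br_lim_cnj_real[OF endpoints(1) U(1) basis(1) basis_real(1)] by simp
    finally show ?thesis .
  qed
  show "l2_inner M (u (cnj z) 1) k = br_b f \<psi>b" "l2_inner M (u (cnj z) 2) k = - br_a f \<psi>a"
    using inner[of 1] inner[of 2] u1[OF z] u2[OF z] by simp_all
qed

text \<open>
  The factors 1 make this a literal instance of the linear combinations for which domain, \<open>\<tau>\<close> and
  boundary values have been computed.
\<close>
definition correction :: "complex \<Rightarrow> (real \<Rightarrow> complex) \<Rightarrow> complex \<Rightarrow> complex \<Rightarrow> real \<Rightarrow> complex" where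
  "correction z f c1 c2 x = 1 * f x + 1 * (c1 * u z 1 x + c2 * u z 2 x)"

lemma correction_domain_max:
  assumes z: "z \<in> resolvent_set M T0" and f: "f \<in> domain_max"
  shows "correction z f c1 c2 \<in> domain_max"
    and "ae (\<lambda>x. \<tau> (correction z f c1 c2) x = \<tau> f x + z * (c1 * u z 1 x + c2 * u z 2 x))"
    and "endpoint F \<Longrightarrow> h \<in> domain_max \<Longrightarrow> br_lim F (correction z f c1 c2) h =
       br_lim F f h + c1 * br_lim F (u z 1) h + c2 * br_lim F (u z 2) h"
proof -
  note U = u_domain_max[OF z, of 1] and V = u_domain_max[OF z, of 2]
  note W = domain_max_combination[where c = c1 and d = c2, OF U(1) V(1)]
  note G = domain_max_combination[where c = 1 and d = 1, OF f W(1)]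
  have eq: "correction z f c1 c2 = (\<lambda>x. 1 * f x + 1 * (c1 * u z 1 x + c2 * u z 2 x))"
    by (rule ext) (simp add: correction_def)
  show "correction z f c1 c2 \<in> domain_max" unfolding eq by (rule G(1))
  show "ae (\<lambda>x. \<tau> (correction z f c1 c2) x = \<tau> f x + z * (c1 * u z 1 x + c2 * u z 2 x))"
    unfolding eq using G(3) W(3) U(2) V(2) by eventually_elim (simp add: algebra_simps)
  show "br_lim F (correction z f c1 c2) h = br_lim F f h + c1 * br_lim F (u z 1) h + c2 * br_lim F (u z 2) h"
    if "endpoint F" "h \<in> domain_max"
    unfolding eq br_lim_combination[OF that(1) f W(1) that(2)] br_lim_combination[OF that(1) U(1) V(1) that(2)]
    by simp
qed

lemma correction_in_domain_R_iff:
  assumes z: "z \<in> resolvent_set M T0" and f: "f \<in> domain_0"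
  shows "correction z f c1 c2 \<in> domain_R \<longleftrightarrow>
    K z $ 1 $ 1 * c1 + K z $ 2 $ 1 * c2 = br_b f \<psi>b \<and> K z $ 1 $ 2 * c1 + K z $ 2 $ 2 * c2 = - br_a f \<psi>a"
proof -
  have fd: "f \<in> domain_max" "br_a f \<phi>a = 0" "br_b f \<phi>b = 0" using f by (auto simp: domain_0_def)
  let ?g = "correction z f c1 c2"
  note B = correction_domain_max(3)[OF z fd(1)]
  have \<phi>: "br_b ?g \<phi>b = c1" "br_a ?g \<phi>a = c2"
    using B[OF endpoints(2) basis(3)] B[OF endpoints(1) basis(1)] fd u1[OF z] u2[OF z] by simp_all
  have \<psi>b: "br_b ?g \<psi>b = br_b f \<psi>b + c1 * br_b (u z 1) \<psi>b + c2 * br_b (u z 2) \<psi>b"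
    and \<psi>a: "br_a ?g \<psi>a = br_a f \<psi>a + c1 * br_a (u z 1) \<psi>a + c2 * br_a (u z 2) \<psi>a"
    using B[OF endpoints(2) basis(4)] B[OF endpoints(1) basis(2)] by simp_all
  have e: "exp (\<i> * of_real \<eta>) * exp (- (\<i> * complex_of_real \<eta>)) = 1"
    by (simp flip: exp_add)
  have "?g \<in> domain_R \<longleftrightarrow> c1 = exp (\<i> * \<eta>) * (R$1$1 * c2 + R$1$2 * br_a ?g \<psi>a) \<and>
     br_b ?g \<psi>b = exp (\<i> * \<eta>) * (R$2$1 * c2 + R$2$2 * br_a ?g \<psi>a)"
    unfolding domain_R_def mem_Collect_eq \<phi> using correction_domain_max(1)[OF z fd(1)] by blast
  also have "\<dots> \<longleftrightarrow> R$2$2 / R$1$2 * c1 - exp (\<i> * \<eta>) / R$1$2 * c2 = br_b ?g \<psi>b \<and>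
     - (exp (- (\<i> * \<eta>)) / R$1$2) * c1 + R$1$1 / R$1$2 * c2 = - br_a ?g \<psi>a"
    by (rule coupled_boundary_condition_iff[OF _ R12 e]) (use det_R in \<open>simp add: det_2\<close>)
  also have "\<dots> \<longleftrightarrow>
    K z $ 1 $ 1 * c1 + K z $ 2 $ 1 * c2 = br_b f \<psi>b \<and> K z $ 1 $ 2 * c1 + K z $ 2 $ 2 * c2 = - br_a f \<psi>a"
    unfolding K_entries \<psi>a \<psi>b by (intro arg_cong2[where f = "(\<and>)"]) (auto simp: algebra_simps)
  finally show ?thesis .
qed

text \<open>
  A kernel vector of the transpose of \<open>K z\<close> corrects \<open>f = 0\<close> to an eigenfunction of \<open>TR\<close> for the
  eigenvalue z, which vanishes as z is in the resolvent set; its boundary values against \<open>\<phi>b\<close> and \<open>\<phi>a\<close>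
  are the components of the vector.
\<close>
lemma K_invertible:
  assumes z: "z \<in> resolvent_set M T0" "z \<in> resolvent_set M TR"
  shows "invertible (K z)"
proof -
  have zero_max: "(\<lambda>_. 0) \<in> domain_max"
    using domain_max_combination(1)[OF basis(1,1), of 0 0] by simp
  have zero_tau: "ae (\<lambda>x. \<tau> (\<lambda>_. 0) x = 0)"
    using domain_max_combination(3)[OF basis(1,1), of 0 0] by simp
  have zero: "br_lim F (\<lambda>_. 0) h = 0" if "endpoint F" "h \<in> domain_max" for F h
    using br_lim_combination[OF that(1) basis(1,1) that(2), of 0 0] by simp
  have zero_0: "(\<lambda>_. 0) \<in> domain_0" using zero_max zero basis by (simp add: domain_0_def)
  have kernel: "c1 = 0 \<and> c2 = 0"
    if c: "K z $ 1 $ 1 * c1 + K z $ 2 $ 1 * c2 = 0" "K z $ 1 $ 2 * c1 + K z $ 2 $ 2 * c2 = 0" for c1 c2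
  proof -
    let ?g = "correction z (\<lambda>_. 0) c1 c2"
    have "?g \<in> domain_R"
      using correction_in_domain_R_iff[OF z(1) zero_0, of c1 c2] zero basis c by simp
    moreover have "ae (\<lambda>x. \<tau> ?g x = z * ?g x)"
      using correction_domain_max(2)[OF z(1) zero_max, of c1 c2] zero_tau
      by eventually_elim (simp add: correction_def)
    ultimately have g0: "?g x = 0" if "x \<in> I" for x
      using resolvent_set_injective[OF domain_R_subset z(2)[unfolded TR_eq] _ _ that] by blast
    have g_zero: "br_lim F ?g h = 0" if "endpoint F" "h \<in> domain_max" for F h
      using br_lim_cong[OF that(1) correction_domain_max(1)[OF z(1) zero_max] zero_max that(2,2) g0 refl]
        zero[OF that] by simp
    show ?thesis
      using correction_domain_max(3)[OF z(1) zero_max endpoints(2) basis(3), of c1 c2]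
        correction_domain_max(3)[OF z(1) zero_max endpoints(1) basis(1), of c1 c2]
        g_zero zero basis u1[OF z(1)] u2[OF z(1)] by simp
  qed
  have "det (K z) \<noteq> 0"
  proof
    assume "det (K z) = 0"
    then have det: "K z $ 1 $ 1 * K z $ 2 $ 2 = K z $ 1 $ 2 * K z $ 2 $ 1" by (simp add: det_2)
    \<comment> \<open>The columns of the adjugate are kernel vectors; all entries vanish, and then (1, 0) is one too.\<close>
    have "K z $ 2 $ 2 = 0 \<and> - K z $ 1 $ 2 = 0" by (rule kernel) (use det in \<open>simp_all add: algebra_simps\<close>)
    moreover have "K z $ 2 $ 1 = 0 \<and> - K z $ 1 $ 1 = 0" by (rule kernel) (use det in \<open>simp_all add: algebra_simps\<close>)
    ultimately show False using kernel[of 1 0] by simp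
  qed
  then show ?thesis by (simp add: invertible_det_nz)
qed

text \<open>
  The correction of \<open>(T0 - z)\<^sup>-\<^sup>1 k\<close> by the coefficients in the formula lies in the domain of \<open>TR\<close>; so the
  right-hand side is contained in the resolvent of \<open>TR\<close>.  The converse inclusion follows, since the
  resolvent of \<open>T0\<close> is defined everywhere and \<open>TR - z\<close> is injective.
\<close>
theorem krein_formula:
  assumes z: "z \<in> resolvent_set M T0" "z \<in> resolvent_set M TR"
  shows "op_resolvent M TR z = op_add M (op_resolvent M T0 z)
    (op_of M (\<lambda>f x. \<Sum>j\<in>UNIV. \<Sum>k\<in>UNIV.
       matrix_inv (K z) $ j $ k * l2_inner M (u (cnj z) j) f * u z k x))"
  (is "_ = op_add M _ (op_of M ?P)")
proof -
  define d where "d f j = l2_inner M (u (cnj z) j) f" for f j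
  define c where "c f k = (\<Sum>j\<in>UNIV. matrix_inv (K z) $ j $ k * d f j)" for f and k :: 2
  have P: "?P f x = c f 1 * u z 1 x + c f 2 * u z 2 x" for f x
    unfolding sum_2 c_def d_def by (simp add: algebra_simps)
  have inv: "matrix_inv (K z) ** K z = mat 1"
    using someI_ex[OF K_invertible[OF z, unfolded invertible_def]] unfolding matrix_inv_def by blast
  have K_c: "K z $ 1 $ i * c f 1 + K z $ 2 $ i * c f 2 = d f i" for f i
  proof -
    have "K z $ 1 $ i * c f 1 + K z $ 2 $ i * c f 2 = (\<Sum>j\<in>UNIV. (matrix_inv (K z) ** K z) $ j $ i * d f j)"
      unfolding c_def sum_2 matrix_matrix_mult_def by (simp add: sum_2 algebra_simps)
    also have "\<dots> = d f i"
      unfolding inv sum_2 mat_def using exhaust_2[of i] by auto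
    finally show ?thesis .
  qed
  have main: "correction z f (c k 1) (c k 2) \<in> domain_R \<and>
      ae (\<lambda>x. k x = \<tau> (correction z f (c k 1) (c k 2)) x - z * correction z f (c k 1) (c k 2) x)"
    if f: "f \<in> domain_0" and k: "k \<in> L2 M" "ae (\<lambda>x. k x = \<tau> f x - z * f x)" for f k
  proof
    have fd: "f \<in> domain_max" using f domain_0_subset by blast
    show "correction z f (c k 1) (c k 2) \<in> domain_R"
      using correction_in_domain_R_iff[OF z(1) f] K_c[of 1 k] K_c[of 2 k]
        inner_u_eq_boundary_value[OF z(1) f k] by (simp add: d_def)
    show "ae (\<lambda>x. k x = \<tau> (correction z f (c k 1) (c k 2)) x - z * correction z f (c k 1) (c k 2) x)"
      using correction_domain_max(2)[OF z(1) fd, of "c k 1" "c k 2"] k(2)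
      by eventually_elim (simp add: correction_def algebra_simps)
  qed
  have uL2: "(\<lambda>x. c1 * u z 1 x + c2 * u z 2 x) \<in> L2 M" for c1 c2
    by (intro L2_combination domain_maxD(2) u_domain_max(1) z(1))
  note res0 = op_resolvent_sl_operator_iff[OF domain_0_subset, folded T0_eq]
    and resR = op_resolvent_sl_operator_iff[OF domain_R_subset, folded TR_eq]
  show ?thesis
  proof (rule set_eqI, clarify)
    fix k g
    show "(k, g) \<in> op_resolvent M TR z \<longleftrightarrow> (k, g) \<in> op_add M (op_resolvent M T0 z) (op_of M ?P)"
    proof
      assume "(k, g) \<in> op_resolvent M TR z"
      then obtain G where k: "k \<in> L2 M" and g: "g \<in> L2 M" and G: "G \<in> domain_R" "ae (\<lambda>x. g x = G x)"
        "ae (\<lambda>x. k x = \<tau> G x - z * G x)" unfolding resR by blast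
      have "k \<in> Domain (op_resolvent M T0 z)" using z(1) k by (simp add: resolvent_set_def)
      then obtain f0 where f0: "(k, f0) \<in> op_resolvent M T0 z" by blast
      then obtain f where f: "f \<in> domain_0" "ae (\<lambda>x. f0 x = f x)" "ae (\<lambda>x. k x = \<tau> f x - z * f x)"
        unfolding res0 by blast
      define H where "H = correction z f (c k 1) (c k 2)"
      have H: "H \<in> domain_R" "ae (\<lambda>x. k x = \<tau> H x - z * H x)"
        using main[OF f(1) k f(3)] by (simp_all add: H_def)
      have GH: "G \<in> domain_max" "H \<in> domain_max" using G(1) H(1) domain_R_subset by auto
      have "ae (\<lambda>x. \<tau> (\<lambda>x. 1 * G x + (- 1) * H x) x = z * (1 * G x + (- 1) * H x))"
        using domain_max_combination(3)[OF GH, of 1 "- 1"] G(3) H(2)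
      proof eventually_elim
        case (elim x)
        have "\<tau> G x = k x + z * G x" unfolding elim(2) by simp
        moreover have "\<tau> H x = k x + z * H x" unfolding elim(3) by simp
        ultimately show ?case unfolding elim(1) by (simp add: algebra_simps)
      qed
      then have "1 * G x + (- 1) * H x = 0" if "x \<in> I" for x
        using resolvent_set_injective[OF domain_R_subset z(2)[unfolded TR_eq] domain_R_diff[OF G(1) H(1)] _ that] by simp
      then have "ae (\<lambda>x. G x = H x)"
        by (auto simp: AE_einterval_iff intro!: exI[of _ "{}"])
      then have "ae (\<lambda>x. g x = f0 x + (c k 1 * u z 1 x + c k 2 * u z 2 x))"
        using G(2) f(2) by eventually_elim (simp add: H_def correction_def)
      moreover have "(k, (\<lambda>x. c k 1 * u z 1 x + c k 2 * u z 2 x)) \<in> op_of M ?P"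
        unfolding op_of_def P using k uL2 by simp
      ultimately show "(k, g) \<in> op_add M (op_resolvent M T0 z) (op_of M ?P)"
        unfolding op_add_def AE_M_iff using g f0 by blast
    next
      assume "(k, g) \<in> op_add M (op_resolvent M T0 z) (op_of M ?P)"
      then obtain g1 g2 where g: "g \<in> L2 M" and g1: "(k, g1) \<in> op_resolvent M T0 z"
        and g2: "ae (\<lambda>x. g2 x = c k 1 * u z 1 x + c k 2 * u z 2 x)" and sum: "ae (\<lambda>x. g x = g1 x + g2 x)"
        unfolding op_add_def op_of_def P AE_M_iff by blast
      obtain f where k: "k \<in> L2 M" and f: "f \<in> domain_0" "ae (\<lambda>x. g1 x = f x)" "ae (\<lambda>x. k x = \<tau> f x - z * f x)"
        using g1 unfolding res0 by blast
      have "ae (\<lambda>x. g x = correction z f (c k 1) (c k 2) x)"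
        using sum g2 f(2) by eventually_elim (simp add: correction_def)
      then show "(k, g) \<in> op_resolvent M TR z"
        unfolding resR using k g main[OF f(1) k f(3)] by blast
    qed
  qed
qed

end

end

theorem theorem4p6:
  fixes a b :: ereal and p q r :: "real \<Rightarrow> real"
    and \<phi>a \<psi>a \<phi>b \<psi>b :: "real \<Rightarrow> complex"
    and R :: "real^2^2" and \<eta> :: real
    and u :: "complex \<Rightarrow> 2 \<Rightarrow> real \<Rightarrow> complex"
  defines "M \<equiv> sl_measure a b r"
    and "T0 \<equiv> T_00 a b p q r \<phi>a \<phi>b"
    and "TR \<equiv> T_R a b p q r \<phi>a \<psi>a \<phi>b \<psi>b R \<eta>"
    and "K \<equiv> \<lambda>z. K_R a b p \<psi>a \<psi>b R \<eta> (u z)"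
  assumes "a < b"
    and "sl_coefficients a b p q r"
    and "limit_circle_a a b p q r"
    and "limit_circle_b a b p q r"
    and "bc_basis a b p q r (at_right a) \<phi>a \<psi>a"
    and "bc_basis a b p q r (at_left b) \<phi>b \<psi>b"
    and "\<And>z. z \<in> resolvent_set M T0 \<Longrightarrow>
           sl_solution a b p q r z (u z 1) \<and>
           bracket_a a b p (u z 1) \<phi>a = 0 \<and> bracket_b a b p (u z 1) \<phi>b = 1"
    and "\<And>z. z \<in> resolvent_set M T0 \<Longrightarrow>
           sl_solution a b p q r z (u z 2) \<and>
           bracket_a a b p (u z 2) \<phi>a = 1 \<and> bracket_b a b p (u z 2) \<phi>b = 0"
    and "0 \<le> \<eta>" "\<eta> < pi"
    and "det R = 1"
    and "R$1$2 \<noteq> 0"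
  shows "relatively_prime M (T_min a b p q r) T0 TR \<and>
    (\<forall>z \<in> resolvent_set M T0 \<inter> resolvent_set M TR.
       invertible (K z) \<and>
       op_resolvent M TR z = op_add M (op_resolvent M T0 z)
         (op_of M (\<lambda>f x. \<Sum>j\<in>UNIV. \<Sum>k\<in>UNIV.
            matrix_inv (K z) $ j $ k * l2_inner M (u (cnj z) j) f * u z k x)))"
proof -
  interpret coupled_extension a b p q r \<phi>a \<psi>a \<phi>b \<psi>b R \<eta>
    by unfold_locales (fact assms)+
  note u = assms(11,12)[unfolded M_def T0_def]
  show ?thesis
    unfolding M_def T0_def TR_def K_def
  proof (intro conjI ballI, goal_cases)
    case 1
    show ?case by (rule T0_TR_relatively_prime)
  next
    case (2 z)
    then show ?case using K_invertible[OF u] by blast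
  next
    case (3 z)
    then show ?case using krein_formula[OF u] by blast
  qed
qed

end
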